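(* Let $v$ be a $\mathrm{C}^2$ vector field on $\mathbb{R}^n$ generating a flow $\{\chi^t:\mathbb{R}^n\to\mathbb{R}^n\}_{t\in\mathbb{R}}$, let $\mathcal{D}\subset\mathbb{R}^n$ be a domain, and let $\mathcal{M}\subset\mathcal{D}$ be a compact, stable, attracting invariant $\mathrm{C}^1$-submanifold of dimension $m<n$. If the flow $\{\chi^t\}$ is hyperbolic along $\mathcal{M}$, then there is a neighborhood $\mathcal{U}$ of $\mathcal{M}$ in $\mathbb{R}^n$ such that any motion starting in $\mathcal{U}$ has an asymptotic phase; that is, for every $p\in\mathcal{U}$ there exists $p_*\in\mathcal{M}$ such that $\|\chi^t(p)-\chi^t(p_* )\|\to 0$ as $t\to\infty$.
   Context: $\mathbb{R}^n$ carries a scalar product $\langle\cdot,\cdot\rangle$ and norm $\|\cdot\|=\sqrt{\langle\cdot,\cdot\rangle}$. The flow $\chi^t$ is that of $\dot x=v(x)$. Attracting invariant: $\chi^t(\mathcal{M})=\mathcal{M}$ for all $t\in\mathbb{R}$, and $\lim_{t\to\infty}\inf_{\xi\in\mathcal{M}}\|\chi^t(x)-\xi\|=0$ for all $x\in\mathcal{D}$. Put $X^t(x):=\partial\chi^t(x)/\partial x$. The flow is hyperbolic along $\mathcal{M}$ if: (1) at every $x\in\mathcal{M}$ there is a direct sum decomposition $T_x\mathbb{R}^n\simeq\mathbb{R}^n=\mathbb{L}_x^-\oplus\mathbb{L}_x^+\oplus\mathbb{L}_x^0$ with $\dim\mathbb{L}^{\pm}_x=n_\pm$, $\dim\mathbb{L}^0_x=n_0$,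 where $\mathbb{L}_x^0=\{\lambda v(x):\lambda\in\mathbb{R}\}$ is one-dimensional (so $v(x)\neq0$ on $\mathcal{M}$); (2) the maps $x\mapsto\mathbb{L}_x^{\pm}$ are continuous fields of planes on $\mathcal{M}$ which are $X^t$-invariant: $X^t(x)\mathbb{L}_x^\pm=\mathbb{L}^\pm_{\chi^t(x)}$ for all $(t,x)\in\mathbb{R}\times\mathcal{M}$; (3) there are constants $c\ge1$, $\alpha>0$ such that $\|X^t(x)\eta\|\le c\,e^{-\alpha t}\|\eta\|$ for all $t\ge0$, $x\in\mathcal{M}$, $\eta\in\mathbb{L}_x^-$, and $\|X^t(x)\eta\|\le c\,e^{\alpha t}\|\eta\|$ for all $t\le0$, $x\in\mathcal{M}$, $\eta\in\mathbb{L}_x^+$. The submanifold $\mathcal{M}$ is assumed to be stable, and thus $\mathbb{L}_x^+\subset T_x\mathcal{M}$ for every $x\in\mathcal{M}$. *)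

theory Defs
  imports "HOL-Analysis.Analysis"
begin

text \<open>Derivatives are taken in the full space; these notions are meant for open \<open>S\<close> only.\<close>

definition C1_on :: "'a::real_normed_vector set \<Rightarrow> ('a \<Rightarrow> 'b::real_normed_vector) \<Rightarrow> bool" where
  "C1_on S f \<longleftrightarrow> (\<exists>f' :: 'a \<Rightarrow> 'a \<Rightarrow>\<^sub>L 'b.
     (\<forall>x\<in>S. (f has_derivative blinfun_apply (f' x)) (at x)) \<and> continuous_on S f')"

definition C2_on :: "'a::real_normed_vector set \<Rightarrow> ('a \<Rightarrow> 'b::real_normed_vector) \<Rightarrow> bool" where
  "C2_on S f \<longleftrightarrow> (\<exists>f' :: 'a \<Rightarrow> 'a \<Rightarrow>\<^sub>L 'b.
     (\<forall>x\<in>S. (f has_derivative blinfun_apply (f' x)) (at x)) \<and> C1_on S f')"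

text \<open>Embedded submanifolds without boundary: \<open>\<phi>\<close> is a \<open>C\<^sup>1\<close> diffeomorphism of open
  subsets of the ambient space that straightens \<open>M\<close> locally.\<close>

definition C1_submanifold :: "nat \<Rightarrow> 'a::euclidean_space set \<Rightarrow> bool" where
  "C1_submanifold m M \<longleftrightarrow> (\<forall>x\<in>M. \<exists>U V S \<phi> \<psi>.
     open U \<and> x \<in> U \<and> open V \<and> subspace (S :: 'a set) \<and> dim S = m \<and>
     homeomorphism U V \<phi> \<psi> \<and> C1_on U \<phi> \<and> C1_on V \<psi> \<and>
     \<phi> ` (U \<inter> M) = V \<inter> S)"

definition flow_of :: "('a::real_normed_vector \<Rightarrow> 'a) \<Rightarrow> (real \<Rightarrow> 'a \<Rightarrow> 'a) \<Rightarrow> bool" where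
  "flow_of v \<Phi> \<longleftrightarrow>
     (\<forall>x. \<Phi> 0 x = x) \<and>
     (\<forall>s t x. \<Phi> (s + t) x = \<Phi> s (\<Phi> t x)) \<and>
     (\<forall>t x. ((\<lambda>s. \<Phi> s x) has_vector_derivative v (\<Phi> t x)) (at t))"

definition invariant_set :: "(real \<Rightarrow> 'a \<Rightarrow> 'a) \<Rightarrow> 'a set \<Rightarrow> bool" where
  "invariant_set \<Phi> M \<longleftrightarrow> (\<forall>t. \<Phi> t ` M = M)"

definition attracting_on :: "(real \<Rightarrow> 'a \<Rightarrow> 'a) \<Rightarrow> 'a::metric_space set \<Rightarrow> 'a set \<Rightarrow> bool" where
  "attracting_on \<Phi> D M \<longleftrightarrow> (\<forall>x\<in>D. ((\<lambda>t. infdist (\<Phi> t x) M) \<longlongrightarrow> 0) at_top)"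

text \<open>Stability is understood in the sense of Lyapunov.\<close>

definition stable_set :: "(real \<Rightarrow> 'a \<Rightarrow> 'a) \<Rightarrow> 'a::topological_space set \<Rightarrow> bool" where
  "stable_set \<Phi> M \<longleftrightarrow> (\<forall>U. open U \<and> M \<subseteq> U \<longrightarrow>
     (\<exists>V. open V \<and> M \<subseteq> V \<and> (\<forall>x\<in>V. \<forall>t\<ge>0. \<Phi> t x \<in> U)))"

text \<open>A field of \<open>k\<close>-planes is continuous iff it has continuous local frames; this is continuity
  as a map into the Grassmannian. Since \<open>L x\<close> has dimension \<open>k\<close>, the \<open>k\<close> spanning
  vectors are automatically a basis.\<close>

definition continuous_plane_field :: "nat \<Rightarrow> 'a::euclidean_space set \<Rightarrow> ('a \<Rightarrow> 'a set) \<Rightarrow> bool" where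
  "continuous_plane_field k M L \<longleftrightarrow>
     (\<forall>x\<in>M. subspace (L x) \<and> dim (L x) = k) \<and>
     (\<forall>x\<in>M. \<exists>U. open U \<and> x \<in> U \<and> (\<exists>e :: nat \<Rightarrow> 'a \<Rightarrow> 'a.
        (\<forall>i<k. continuous_on (M \<inter> U) (e i)) \<and>
        (\<forall>y\<in>M \<inter> U. L y = span ((\<lambda>i. e i y) ` {..<k}))))"

definition direct_sum3 :: "'a::real_vector set \<Rightarrow> 'a set \<Rightarrow> 'a set \<Rightarrow> bool" where
  "direct_sum3 A B C \<longleftrightarrow>
     (\<forall>w. \<exists>!(a, b, c). a \<in> A \<and> b \<in> B \<and> c \<in> C \<and> w = a + b + c)"

text \<open>Meaningful because the flow of a \<open>C\<^sup>1\<close> vector field is differentiable in the initial point.\<close>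

definition flow_derivative :: "(real \<Rightarrow> 'a \<Rightarrow> 'a) \<Rightarrow> real \<Rightarrow> 'a::real_normed_vector \<Rightarrow> 'a \<Rightarrow> 'a" where
  "flow_derivative \<Phi> t x = frechet_derivative (\<Phi> t) (at x)"

definition hyperbolic_along ::
    "('a::euclidean_space \<Rightarrow> 'a) \<Rightarrow> (real \<Rightarrow> 'a \<Rightarrow> 'a) \<Rightarrow> 'a set \<Rightarrow> bool" where
  "hyperbolic_along v \<Phi> M \<longleftrightarrow> (\<exists>Lminus Lplus Lzero nminus nplus c \<alpha>.
     (\<forall>x\<in>M. Lzero x = {l *\<^sub>R v x | l. True} \<and> dim (Lzero x) = 1) \<and>
     (\<forall>x\<in>M. direct_sum3 (Lminus x) (Lplus x) (Lzero x)) \<and>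
     continuous_plane_field nminus M Lminus \<and>
     continuous_plane_field nplus M Lplus \<and>
     (\<forall>t. \<forall>x\<in>M. flow_derivative \<Phi> t x ` Lminus x = Lminus (\<Phi> t x)) \<and>
     (\<forall>t. \<forall>x\<in>M. flow_derivative \<Phi> t x ` Lplus x = Lplus (\<Phi> t x)) \<and>
     c \<ge> 1 \<and> \<alpha> > 0 \<and>
     (\<forall>t\<ge>0. \<forall>x\<in>M. \<forall>\<eta>\<in>Lminus x.
        norm (flow_derivative \<Phi> t x \<eta>) \<le> c * exp (- \<alpha> * t) * norm \<eta>) \<and>
     (\<forall>t\<le>0. \<forall>x\<in>M. \<forall>\<eta>\<in>Lplus x.
        norm (flow_derivative \<Phi> t x \<eta>) \<le> c * exp (\<alpha> * t) * norm \<eta>))"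

definition has_asymptotic_phase ::
    "(real \<Rightarrow> 'a \<Rightarrow> 'a) \<Rightarrow> 'a::real_normed_vector set \<Rightarrow> 'a \<Rightarrow> bool" where
  "has_asymptotic_phase \<Phi> M p \<longleftrightarrow>
     (\<exists>q\<in>M. ((\<lambda>t. norm (\<Phi> t p - \<Phi> t q)) \<longlongrightarrow> 0) at_top)"

end

theory Submission
  imports Defs
begin

text \<open>
  Let \<open>p\<close> start near \<open>M\<close> and let \<open>\<xi> \<in> M\<close> be close to \<open>p\<close>. The asymptotic phase of \<open>p\<close> is the point \<open>q\<close> in
  which the strong stable leaf of \<open>p\<close> (points whose forward orbits approach that of \<open>p\<close> exponentially
  fast) meets the strong unstable leaf of a small time shift \<open>\<Phi> s \<xi>\<close>. Such a \<open>q\<close> exists because the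
  three displacements involved, along the stable plane, along the unstable plane and along \<open>v \<xi>\<close>,
  span the space. Backwards in time \<open>q\<close> converges to \<open>M\<close>. Lyapunov stability then puts \<open>q\<close> into
  every neighbourhood of \<open>M\<close>: some point of its past is so close to \<open>M\<close> that its whole future,
  \<open>q\<close> included, stays in the given neighbourhood. So \<open>q \<in> M\<close>. Stability also keeps the orbit of \<open>p\<close>
  close to \<open>M\<close>, which is where its stable leaf comes from.

  The leaves are built by the Lyapunov-Perron method (\<open>decaying_orbit_exists\<close>). Along the time-\<open>T\<close>
  orbit of \<open>p\<close> one looks for differences \<open>\<eta> k\<close> that decay like \<open>\<theta> ^ k\<close>. The stable components are
  propagated forwards and the remaining ones are recovered from the future; in the weighted norm
  both operations contract as soon as \<open>\<theta>\<close> lies well between the contraction on the stable planes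
  and 1, since the flow direction, being neutral, then counts as unstable. The splitting lives on \<open>M\<close>
  only, so the linearisation is taken at points of \<open>M\<close> that shadow the orbit of \<open>p\<close>; the resulting
  sequence is a pseudo-orbit of \<open>M\<close>, and \<open>Ps_uniformly_continuous\<close> says that its projections fit
  together up to a small error. Unstable leaves are the stable leaves of the reversed flow.

  To intersect the leaves (\<open>leaves_intersect\<close>) one needs that their slopes over the stable and
  the unstable plane are small and that they move little with \<open>s\<close> (\<open>decaying_orbits_compare\<close>). The
  second property is a Lipschitz statement about \<open>\<Phi> T (z + \<eta>) - \<Phi> T z\<close> as a function of \<open>z\<close> with a
  constant proportional to \<open>norm \<eta>\<close>. This bound on second differences is the regularity of the flow
  used throughout: it follows from Gronwall's inequality for a \<open>C\<^sup>2\<close> field, and it yields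
  the derivative of the flow as well as the Lipschitz continuity of that derivative.\<close>

section \<open>Gronwall's inequality and bounds on differences\<close>

text \<open>The function \<open>exp (- 2 * (K + 1) * t) * ((norm (e t))\<^sup>2 + \<rho>\<^sup>2)\<close> is nonincreasing. Working with the
  square avoids the points where the norm is not differentiable.\<close>

lemma gronwall_differential:
  fixes e e' :: "real \<Rightarrow> 'a::real_inner"
  assumes "0 \<le> T" "0 \<le> K" "0 \<le> \<rho>"
    and der: "\<And>t. 0 \<le> t \<Longrightarrow> t \<le> T \<Longrightarrow> (e has_vector_derivative e' t) (at t)"
    and bnd: "\<And>t. 0 \<le> t \<Longrightarrow> t \<le> T \<Longrightarrow> norm (e' t) \<le> K * norm (e t) + \<rho>"
  shows "norm (e T) \<le> exp ((K + 1) * T) * (norm (e 0) + \<rho>)"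
proof -
  define \<kappa> where "\<kappa> = 2 * (K + 1)"
  define g where "g t = exp (- \<kappa> * t) * (e t \<bullet> e t + \<rho>\<^sup>2)" for t
  have "g T \<le> g 0"
  proof (rule DERIV_nonpos_imp_nonincreasing[OF assms(1)])
    fix t assume t: "0 \<le> t" "t \<le> T"
    have d: "(e has_derivative (\<lambda>h. h *\<^sub>R e' t)) (at t)"
      using der[OF t] by (simp add: has_vector_derivative_def)
    have "(g has_real_derivative
        exp (- \<kappa> * t) * (2 * (e t \<bullet> e' t) - \<kappa> * (e t \<bullet> e t + \<rho>\<^sup>2))) (at t)"
      unfolding g_def has_field_derivative_def
      by (rule derivative_eq_intros d refl)+
        (auto simp: algebra_simps inner_commute)
    moreover have "2 * (e t \<bullet> e' t) \<le> \<kappa> * (e t \<bullet> e t + \<rho>\<^sup>2)"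
    proof -
      have "e t \<bullet> e' t \<le> norm (e t) * norm (e' t)" by (rule norm_cauchy_schwarz)
      also have "\<dots> \<le> norm (e t) * (K * norm (e t) + \<rho>)"
        by (intro mult_left_mono bnd t) auto
      finally have "2 * (e t \<bullet> e' t) \<le> 2 * K * (norm (e t))\<^sup>2 + 2 * norm (e t) * \<rho>"
        by (simp add: algebra_simps power2_eq_square)
      moreover have "2 * norm (e t) * \<rho> \<le> (norm (e t))\<^sup>2 + \<rho>\<^sup>2"
        using sum_squares_bound[of "norm (e t)" \<rho>] by simp
      moreover have "0 \<le> 2 * K * \<rho>\<^sup>2" "0 \<le> \<rho>\<^sup>2" "0 \<le> (norm (e t))\<^sup>2"
        using assms by auto
      moreover have "\<kappa> * ((norm (e t))\<^sup>2 + \<rho>\<^sup>2)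
          = 2 * K * (norm (e t))\<^sup>2 + 2 * (norm (e t))\<^sup>2 + 2 * K * \<rho>\<^sup>2 + 2 * \<rho>\<^sup>2"
        by (simp add: \<kappa>_def algebra_simps)
      ultimately show ?thesis
        unfolding power2_norm_eq_inner[symmetric] by linarith
    qed
    ultimately show "\<exists>y. (g has_real_derivative y) (at t) \<and> y \<le> 0"
      by (intro exI conjI) (auto intro!: mult_nonneg_nonpos)
  qed
  moreover have growth: "exp (\<kappa> * T) * g T = e T \<bullet> e T + \<rho>\<^sup>2"
    by (simp add: g_def exp_minus field_simps)
  ultimately have "exp (\<kappa> * T) * g T \<le> exp (\<kappa> * T) * g 0" by (intro mult_left_mono) auto
  then have "e T \<bullet> e T + \<rho>\<^sup>2 \<le> exp (\<kappa> * T) * (e 0 \<bullet> e 0 + \<rho>\<^sup>2)"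
    unfolding growth by (simp add: g_def)
  then have "(norm (e T))\<^sup>2 \<le> exp (\<kappa> * T) * ((norm (e 0))\<^sup>2 + \<rho>\<^sup>2)"
    unfolding power2_norm_eq_inner using zero_le_power2[of \<rho>] by linarith
  also have "\<dots> \<le> exp (\<kappa> * T) * (norm (e 0) + \<rho>)\<^sup>2"
    using assms by (intro mult_left_mono) (auto simp: power2_sum)
  also have "\<dots> = (exp ((K + 1) * T) * (norm (e 0) + \<rho>))\<^sup>2"
    by (simp only: \<kappa>_def power_mult_distrib mult.assoc exp_double)
  finally show ?thesis
    using assms by (simp add: power2_le_iff_abs_le)
qed

lemma C1_imp_lipschitz_on_cball:
  fixes f :: "'a::euclidean_space \<Rightarrow> 'b::real_normed_vector"
  assumes "C1_on UNIV f"
  obtains K where "0 \<le> K"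
    "\<And>x y. x \<in> cball 0 R \<Longrightarrow> y \<in> cball 0 R \<Longrightarrow> norm (f x - f y) \<le> K * norm (x - y)"
proof -
  obtain f' :: "'a \<Rightarrow> 'a \<Rightarrow>\<^sub>L 'b" where
    f': "\<And>x. (f has_derivative blinfun_apply (f' x)) (at x)" and cont: "continuous_on UNIV f'"
    using assms unfolding C1_on_def by auto
  have "bounded (f' ` cball 0 R)"
    by (intro compact_imp_bounded compact_continuous_image continuous_on_subset[OF cont]) auto
  then obtain K where K: "K > 0" "\<And>x. x \<in> cball 0 R \<Longrightarrow> norm (f' x) \<le> K"
    unfolding bounded_pos by auto
  show thesis
  proof (rule that[of K])
    show "norm (f x - f y) \<le> K * norm (x - y)"
      if "x \<in> cball 0 R" "y \<in> cball 0 R" for x y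
    proof (rule differentiable_bound[OF convex_cball _ _ that])
      show "(f has_derivative blinfun_apply (f' x)) (at x within cball 0 R)" for x
        by (rule has_derivative_at_withinI[OF f'])
      show "onorm (blinfun_apply (f' x)) \<le> K" if "x \<in> cball 0 R" for x
        using K(2)[OF that] by (simp add: norm_blinfun.rep_eq)
    qed
  qed (use K in auto)
qed

text \<open>The second summand bounds how the increment \<open>f (y + (a' - b')) - f y\<close> changes between \<open>y = b\<close> and \<open>y = b'\<close>:
  its derivative in \<open>y\<close> is a difference of two values of the Lipschitz map \<open>Df\<close>.\<close>

lemma C2_imp_second_difference_bound:
  fixes f :: "'a::euclidean_space \<Rightarrow> 'b::real_normed_vector"
  assumes "C2_on UNIV f"
  obtains K where "0 \<le> K"
    "\<And>x y. x \<in> cball 0 R \<Longrightarrow> y \<in> cball 0 R \<Longrightarrow> norm (f x - f y) \<le> K * norm (x - y)"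
    "\<And>a b a' b'. {a, b, a', b', b + (a' - b')} \<subseteq> cball 0 R \<Longrightarrow>
       norm (f a - f b - (f a' - f b'))
         \<le> K * norm (a - b - (a' - b')) + K * (norm (a' - b') * norm (b - b'))"
proof -
  obtain f' :: "'a \<Rightarrow> 'a \<Rightarrow>\<^sub>L 'b" where
    f': "\<And>x. (f has_derivative blinfun_apply (f' x)) (at x)" and C1: "C1_on UNIV f'"
    using assms unfolding C2_on_def by auto
  have "continuous_on UNIV f'"
    using C1 unfolding C1_on_def
    by (metis UNIV_I continuous_at_imp_continuous_on has_derivative_continuous)
  then have "C1_on UNIV f" using f' unfolding C1_on_def by auto
  then obtain K1 where K1: "0 \<le> K1"
    "\<And>x y. x \<in> cball 0 R \<Longrightarrow> y \<in> cball 0 R \<Longrightarrow> norm (f x - f y) \<le> K1 * norm (x - y)"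
    using C1_imp_lipschitz_on_cball by blast
  obtain K2 where K2: "0 \<le> K2"
    "\<And>x y. x \<in> cball 0 R \<Longrightarrow> y \<in> cball 0 R \<Longrightarrow> norm (f' x - f' y) \<le> K2 * norm (x - y)"
    using C1 C1_imp_lipschitz_on_cball by blast
  show thesis
  proof (rule that[of "max K1 K2"])
    fix x y assume "x \<in> (cball 0 R :: 'a set)" "y \<in> (cball 0 R :: 'a set)"
    from K1(2)[OF this] show "norm (f x - f y) \<le> max K1 K2 * norm (x - y)"
      by (meson dual_order.trans max.cobounded1 mult_right_mono norm_ge_zero)
  next
    fix a b a' b' :: 'a assume in_ball: "{a, b, a', b', b + (a' - b')} \<subseteq> cball 0 R"
    define \<eta> where "\<eta> = a' - b'"
    define G where "G y = f (y + \<eta>) - f y" for y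
    define S where "S = (\<lambda>y. - \<eta> + y) ` cball 0 R \<inter> cball 0 R"
    have S: "y \<in> cball 0 R" "y + \<eta> \<in> cball 0 R" if "y \<in> S" for y
      using that by (auto simp: S_def)
    have SI: "y \<in> S" if "y \<in> cball 0 R" "y + \<eta> \<in> cball 0 R" for y
      unfolding S_def using that by (intro IntI image_eqI[of _ _ "y + \<eta>"]) simp_all
    have "b \<in> S" "b' \<in> S"
      using in_ball SI[of b] SI[of b'] by (simp_all add: \<eta>_def)
    have cvx: "convex S"
      unfolding S_def by (intro convex_Int convex_translation convex_cball)
    have "norm (G b - G b') \<le> (K2 * norm \<eta>) * norm (b - b')"
    proof (rule differentiable_bound[OF cvx])
      show "(G has_derivative blinfun_apply (f' (y + \<eta>) - f' y))
              (at y within S)" for y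
      proof -
        have "((\<lambda>y. f (y + \<eta>)) has_derivative blinfun_apply (f' (y + \<eta>))) (at y)"
          using has_derivative_compose[of "\<lambda>y. y + \<eta>" "\<lambda>h. h" y UNIV f "blinfun_apply (f' (y + \<eta>))"]
            f'[of "y + \<eta>"]
          by (simp add: has_derivative_add_const)
        then have "(G has_derivative (\<lambda>h. blinfun_apply (f' (y + \<eta>)) h - blinfun_apply (f' y) h)) (at y)"
          unfolding G_def by (intro has_derivative_diff f')
        then show ?thesis
          by (simp add: has_derivative_at_withinI flip: blinfun.diff_left)
      qed
      show "onorm (blinfun_apply (f' (y + \<eta>) - f' y)) \<le> K2 * norm \<eta>"
        if "y \<in> S" for y
        using K2(2)[OF S(2)[OF that] S(1)[OF that]] by (simp add: norm_blinfun.rep_eq)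
    qed (fact \<open>b \<in> S\<close> \<open>b' \<in> S\<close>)+
    then have 1: "norm (G b - G b') \<le> K2 * (norm \<eta> * norm (b - b'))" by (simp add: mult.assoc)
    have 2: "norm (f a - f (b + \<eta>)) \<le> K1 * norm (a - b - \<eta>)"
      using K1(2)[of a "b + \<eta>"] in_ball by (simp add: \<eta>_def algebra_simps)
    have "f a - f b - (f a' - f b') = (f a - f (b + \<eta>)) + (G b - G b')"
      by (simp add: G_def \<eta>_def)
    then have "norm (f a - f b - (f a' - f b')) \<le> norm (f a - f (b + \<eta>)) + norm (G b - G b')"
      by (simp only: norm_triangle_ineq)
    then have "norm (f a - f b - (f a' - f b'))
        \<le> K1 * norm (a - b - \<eta>) + K2 * (norm \<eta> * norm (b - b'))"
      using 1 2 by linarith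
    also have "\<dots> \<le> max K1 K2 * norm (a - b - \<eta>) + max K1 K2 * (norm \<eta> * norm (b - b'))"
      by (intro add_mono mult_right_mono) auto
    finally show "norm (f a - f b - (f a' - f b'))
         \<le> max K1 K2 * norm (a - b - (a' - b')) + max K1 K2 * (norm (a' - b') * norm (b - b'))"
      by (simp add: \<eta>_def)
  qed (use K1 in auto)
qed

lemma curve_lipschitz:
  fixes h :: "real \<Rightarrow> 'a::real_normed_vector"
  assumes "\<And>s. s \<in> {a..b} \<Longrightarrow> (h has_vector_derivative h' s) (at s)"
    and "\<And>s. s \<in> {a..b} \<Longrightarrow> norm (h' s) \<le> B"
    and "s \<in> {a..b}" "s' \<in> {a..b}"
  shows "norm (h s - h s') \<le> B * \<bar>s - s'\<bar>"
proof -
  have "norm (h s - h s') \<le> B * norm (s - s')"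
  proof (rule differentiable_bound[where f' = "\<lambda>s x. x *\<^sub>R h' s"])
    show "(h has_derivative (\<lambda>x. x *\<^sub>R h' s)) (at s within {a..b})" if "s \<in> {a..b}" for s
      using assms(1)[OF that] unfolding has_vector_derivative_def by (rule has_derivative_at_withinI)
    show "onorm (\<lambda>x. x *\<^sub>R h' s) \<le> B" if "s \<in> {a..b}" for s
      using assms(2)[OF that] by (intro onorm_le) (simp add: mult.commute[of B] mult_left_mono)
  qed (use assms in auto)
  then show ?thesis by simp
qed

section \<open>Second differences of the flow near a compact invariant set\<close>

locale C2_flow =
  fixes v :: "'a::euclidean_space \<Rightarrow> 'a" and \<Phi> :: "real \<Rightarrow> 'a \<Rightarrow> 'a"
  assumes C2: "C2_on UNIV v" and flow: "flow_of v \<Phi>"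
begin

lemma flow_zero [simp]: "\<Phi> 0 x = x"
  using flow by (simp add: flow_of_def)

lemma flow_add: "\<Phi> (s + t) x = \<Phi> s (\<Phi> t x)"
  using flow by (simp add: flow_of_def)

lemma flow_inverse [simp]: "\<Phi> t (\<Phi> (- t) x) = x" "\<Phi> (- t) (\<Phi> t x) = x"
  using flow_add[of t "- t" x] flow_add[of "- t" t x] by simp_all

lemma flow_has_vector_derivative: "((\<lambda>s. \<Phi> s x) has_vector_derivative v (\<Phi> t x)) (at t)"
  using flow by (simp add: flow_of_def)

lemma continuous_on_flow_time: "continuous_on S (\<lambda>t. \<Phi> t x)"
  using flow_has_vector_derivative
  by (meson continuous_at_imp_continuous_on has_vector_derivative_continuous)

lemma reversed_flow: "C2_flow (\<lambda>x. - v x) (\<lambda>t. \<Phi> (- t))"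
proof
  obtain f' f'' where d: "\<And>x. (v has_derivative blinfun_apply (f' x)) (at x)"
    "\<And>x. (f' has_derivative blinfun_apply (f'' x)) (at x)" "continuous_on UNIV f''"
    using C2 unfolding C2_on_def C1_on_def by auto
  have "C1_on UNIV (\<lambda>x. - f' x)"
    unfolding C1_on_def
    by (rule exI[of _ "\<lambda>x. - f'' x"])
       (use d in \<open>auto intro!: has_derivative_minus continuous_intros simp: blinfun.minus_left[abs_def]\<close>)
  then show "C2_on UNIV (\<lambda>x. - v x)"
    unfolding C2_on_def
    by (intro exI[of _ "\<lambda>x. - f' x"] conjI ballI)
       (use d in \<open>auto intro!: has_derivative_minus simp: blinfun.minus_left[abs_def]\<close>)
  have "((\<lambda>s. \<Phi> (- s) x) has_vector_derivative - v (\<Phi> (- t) x)) (at t)" for t x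
  proof -
    have "((\<lambda>s. - s) has_vector_derivative -1) (at (t::real))"
      by (auto intro!: derivative_eq_intros simp: has_real_derivative_iff_has_vector_derivative[symmetric])
    from vector_diff_chain_at[OF this flow_has_vector_derivative[of x "- t"]]
    show ?thesis by (simp add: o_def)
  qed
  moreover have "\<Phi> (- (s + t)) x = \<Phi> (- s) (\<Phi> (- t) x)" for s t x
    using flow_add[of "- s" "- t"] by simp
  ultimately show "flow_of (\<lambda>x. - v x) (\<lambda>t. \<Phi> (- t))"
    by (simp add: flow_of_def)
qed

text \<open>Gronwall's inequality applies while the orbits stay within distance 1 of the orbit of \<open>x \<in> M\<close>, and it
  shows that orbits starting sufficiently close to \<open>x\<close> cannot reach that distance before time \<open>T\<close>.\<close>

lemma flow_estimates_nonneg: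
  assumes "compact M" and inv: "invariant_set \<Phi> M" and "0 \<le> T"
  obtains \<delta> L where "0 < \<delta>" "0 \<le> L"
    "\<And>x t a b. x \<in> M \<Longrightarrow> t \<in> {0..T} \<Longrightarrow> {a, b} \<subseteq> ball x \<delta> \<Longrightarrow>
      norm (\<Phi> t a - \<Phi> t b) \<le> L * norm (a - b)"
    "\<And>x t a b a' b'. x \<in> M \<Longrightarrow> t \<in> {0..T} \<Longrightarrow> {a, b, a', b'} \<subseteq> ball x \<delta> \<Longrightarrow>
      a - b = a' - b' \<Longrightarrow>
      norm (\<Phi> t a - \<Phi> t b - (\<Phi> t a' - \<Phi> t b')) \<le> L * (norm (a - b) * norm (b - b'))"
proof -
  obtain R where R: "\<And>x. x \<in> M \<Longrightarrow> norm x \<le> R"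
    using compact_imp_bounded[OF \<open>compact M\<close>] unfolding bounded_iff by auto
  obtain K where K: "0 \<le> K"
    "\<And>x y. x \<in> cball 0 (R + 3) \<Longrightarrow> y \<in> cball 0 (R + 3) \<Longrightarrow> norm (v x - v y) \<le> K * norm (x - y)"
    "\<And>a b a' b'. {a, b, a', b', b + (a' - b')} \<subseteq> cball 0 (R + 3) \<Longrightarrow>
       norm (v a - v b - (v a' - v b'))
         \<le> K * norm (a - b - (a' - b')) + K * (norm (a' - b') * norm (b - b'))"
    using C2_imp_second_difference_bound[OF C2, of "R + 3"] by blast
  define L where "L = exp ((K + 1) * T)"
  have L: "1 \<le> L" using \<open>0 \<le> T\<close> K(1) by (simp add: L_def)
  have exp_le: "exp ((K + 1) * t) \<le> L" if "t \<in> {0..T}" for t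
    using that K(1) by (auto simp: L_def intro!: mult_left_mono)
  define \<delta> where "\<delta> = 1 / (2 * L)"
  have \<delta>: "0 < \<delta>" "\<delta> < 1" "L * \<delta> < 1" using L by (auto simp: \<delta>_def field_simps)
  have inM: "\<Phi> t x \<in> M" if "x \<in> M" for t x
    using inv that unfolding invariant_set_def by blast
  have vd: "((\<lambda>s. \<Phi> s a - \<Phi> s b) has_vector_derivative (v (\<Phi> t a) - v (\<Phi> t b))) (at t)" for a b t
    by (intro has_vector_derivative_diff flow_has_vector_derivative)
  have stay: "norm (\<Phi> t a - \<Phi> t x) < 1" if x: "x \<in> M" and a: "a \<in> ball x \<delta>" and t: "t \<in> {0..T}" for x a t
  proof (rule ccontr)
    assume contra: "\<not> ?thesis"
    define g where "g s = norm (\<Phi> s a - \<Phi> s x)" for s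
    have cont_g: "continuous_on S g" for S
      unfolding g_def by (intro continuous_intros continuous_on_flow_time)
    define S where "S = {s \<in> {0..T}. 1 \<le> g s}"
    have "S = {0..T} \<inter> g -` {1..}" by (auto simp: S_def)
    then have "closed S"
      using continuous_closed_preimage[OF cont_g[of "{0..T}"], of "{1..}"] by simp
    moreover have "S \<subseteq> {0..T}" by (auto simp: S_def)
    ultimately have "compact S"
      using bounded_subset[OF bounded_closed_interval] by (auto simp: compact_eq_bounded_closed)
    moreover have "t \<in> S" using t contra by (auto simp: S_def g_def)
    ultimately obtain u where u: "u \<in> S" "\<And>s. s \<in> S \<Longrightarrow> u \<le> s"
      using compact_attains_inf[of S] by auto
    have g0: "g 0 < \<delta>" using a by (simp add: g_def dist_norm norm_minus_commute)
    have le1: "g s \<le> 1" if s: "0 \<le> s" "s \<le> u" for s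
    proof (rule ccontr)
      assume "\<not> g s \<le> 1"
      then have "\<exists>r\<ge>0. r \<le> s \<and> g r = 1"
        using g0 \<delta> s by (intro IVT') (auto intro: cont_g)
      then obtain r where r: "0 \<le> r" "r \<le> s" "g r = 1" by auto
      then have "r \<in> S" using s u(1) by (auto simp: S_def)
      then have "r = s" using u(2)[of r] r s by linarith
      then show False using r \<open>\<not> g s \<le> 1\<close> by simp
    qed
    have "norm (v (\<Phi> s a) - v (\<Phi> s x)) \<le> K * norm (\<Phi> s a - \<Phi> s x) + 0" if "0 \<le> s" "s \<le> u" for s
    proof -
      have "norm (\<Phi> s x) \<le> R" using R[OF inM[OF x]] .
      moreover have "norm (\<Phi> s a) \<le> norm (\<Phi> s x) + g s"
        unfolding g_def by (metis add.commute norm_triangle_sub)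
      ultimately show ?thesis
        using le1[OF that] by (simp add: K(2))
    qed
    from gronwall_differential[OF _ K(1) order_refl vd this, of u]
    have "g u \<le> exp ((K + 1) * u) * g 0" using u(1) by (simp add: g_def S_def)
    also have "\<dots> \<le> L * \<delta>"
      using exp_le[of u] u(1) g0 L by (intro mult_mono) (auto simp: S_def g_def)
    finally show False using \<delta> u(1) by (simp add: S_def)
  qed
  have in_ball: "norm (\<Phi> t a) \<le> R + 1" if "x \<in> M" "a \<in> ball x \<delta>" "t \<in> {0..T}" for x a t
    using stay[OF that] R[OF inM[OF that(1)], of t] norm_triangle_sub[of "\<Phi> t a" "\<Phi> t x"] by simp
  have lip: "norm (\<Phi> t a - \<Phi> t b) \<le> L * norm (a - b)"
    if x: "x \<in> M" and t: "t \<in> {0..T}" and ab: "{a, b} \<subseteq> ball x \<delta>" for x t a b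
  proof -
    have "norm (v (\<Phi> s a) - v (\<Phi> s b)) \<le> K * norm (\<Phi> s a - \<Phi> s b) + 0" if "0 \<le> s" "s \<le> t" for s
      using in_ball[OF x, of a s] in_ball[OF x, of b s] ab t that by (simp add: K(2))
    from gronwall_differential[OF _ K(1) order_refl vd this, of t]
    have "norm (\<Phi> t a - \<Phi> t b) \<le> exp ((K + 1) * t) * norm (a - b)" using t by simp
    also have "\<dots> \<le> L * norm (a - b)" using exp_le[OF t] by (intro mult_right_mono) auto
    finally show ?thesis .
  qed
  have second: "norm (\<Phi> t a - \<Phi> t b - (\<Phi> t a' - \<Phi> t b')) \<le> L ^ 3 * K * (norm (a - b) * norm (b - b'))"
    if x: "x \<in> M" and t: "t \<in> {0..T}" and pts: "{a, b, a', b'} \<subseteq> ball x \<delta>" and eq: "a - b = a' - b'"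
    for x t a b a' b'
  proof -
    define \<rho> where "\<rho> = K * ((L * norm (a - b)) * (L * norm (b - b')))"
    have \<rho>: "0 \<le> \<rho>" using K(1) L by (simp add: \<rho>_def)
    have bnd: "norm (v (\<Phi> s a) - v (\<Phi> s b) - (v (\<Phi> s a') - v (\<Phi> s b')))
       \<le> K * norm (\<Phi> s a - \<Phi> s b - (\<Phi> s a' - \<Phi> s b')) + \<rho>" if "0 \<le> s" "s \<le> t" for s
    proof -
      have s: "s \<in> {0..T}" using that t by auto
      have "norm (\<Phi> s y) \<le> R + 1" if "y \<in> {a, b, a', b'}" for y
        using in_ball[OF x _ s, of y] pts that by auto
      moreover have "norm (\<Phi> s a' - \<Phi> s b') \<le> 2"
      proof -
        have "norm (\<Phi> s a' - \<Phi> s x) < 1" "norm (\<Phi> s b' - \<Phi> s x) < 1"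
          using stay[OF x _ s] pts by auto
        then show ?thesis
          using norm_triangle_ineq4[of "\<Phi> s a' - \<Phi> s x" "\<Phi> s b' - \<Phi> s x"] by simp
      qed
      moreover have "norm (\<Phi> s b + (\<Phi> s a' - \<Phi> s b')) \<le> norm (\<Phi> s b) + norm (\<Phi> s a' - \<Phi> s b')"
        by (rule norm_triangle_ineq)
      moreover have "norm (\<Phi> s b) \<le> R + 1" using calculation by blast
      ultimately have "{\<Phi> s a, \<Phi> s b, \<Phi> s a', \<Phi> s b', \<Phi> s b + (\<Phi> s a' - \<Phi> s b')} \<subseteq> cball 0 (R + 3)"
        by (smt (verit) empty_subsetI insert_subset insertI1 insertI2 mem_cball_0)
      from K(3)[OF this] have "norm (v (\<Phi> s a) - v (\<Phi> s b) - (v (\<Phi> s a') - v (\<Phi> s b')))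
         \<le> K * norm (\<Phi> s a - \<Phi> s b - (\<Phi> s a' - \<Phi> s b')) + K * (norm (\<Phi> s a' - \<Phi> s b') * norm (\<Phi> s b - \<Phi> s b'))" .
      moreover have "K * (norm (\<Phi> s a' - \<Phi> s b') * norm (\<Phi> s b - \<Phi> s b')) \<le> \<rho>"
        unfolding \<rho>_def eq using lip[OF x s] pts K(1) L
        by (intro mult_left_mono mult_mono) auto
      ultimately show ?thesis by linarith
    qed
    have "norm (\<Phi> t a - \<Phi> t b - (\<Phi> t a' - \<Phi> t b')) \<le> exp ((K + 1) * t) * (norm (\<Phi> 0 a - \<Phi> 0 b - (\<Phi> 0 a' - \<Phi> 0 b')) + \<rho>)"
      by (rule gronwall_differential[OF _ K(1) \<rho> has_vector_derivative_diff[OF vd vd] bnd])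
         (use t in auto)
    also have "\<dots> \<le> L * \<rho>"
      using exp_le[OF t] eq \<rho> by (simp add: mult_right_mono)
    also have "\<dots> = L ^ 3 * K * (norm (a - b) * norm (b - b'))"
      by (simp add: \<rho>_def power3_eq_cube mult_ac)
    finally show ?thesis .
  qed
  show thesis
  proof (rule that[of \<delta> "max L (L ^ 3 * K)"])
    show "norm (\<Phi> t a - \<Phi> t b) \<le> max L (L ^ 3 * K) * norm (a - b)"
      if "x \<in> M" "t \<in> {0..T}" "{a, b} \<subseteq> ball x \<delta>" for x t a b
      using lip[OF that] by (rule order_trans) (intro mult_right_mono, auto)
    show "norm (\<Phi> t a - \<Phi> t b - (\<Phi> t a' - \<Phi> t b')) \<le> max L (L ^ 3 * K) * (norm (a - b) * norm (b - b'))"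
      if "x \<in> M" "t \<in> {0..T}" "{a, b, a', b'} \<subseteq> ball x \<delta>" "a - b = a' - b'" for x t a b a' b'
      using second[OF that] by (rule order_trans) (intro mult_right_mono, auto)
  qed (use \<delta> L in auto)
qed

lemma continuous_on_v: "continuous_on S v"
  using C2 unfolding C2_on_def
  by (metis UNIV_I continuous_at_imp_continuous_on has_derivative_continuous)

lemma flow_estimates:
  assumes "compact M" and inv: "invariant_set \<Phi> M"
  obtains \<delta> L where "0 < \<delta>" "0 \<le> L"
    "\<And>x t a b. x \<in> M \<Longrightarrow> t \<in> {- T..T} \<Longrightarrow> {a, b} \<subseteq> ball x \<delta> \<Longrightarrow>
      norm (\<Phi> t a - \<Phi> t b) \<le> L * norm (a - b)"
    "\<And>x t a b a' b'. x \<in> M \<Longrightarrow> t \<in> {- T..T} \<Longrightarrow> {a, b, a', b'} \<subseteq> ball x \<delta> \<Longrightarrow>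
      a - b = a' - b' \<Longrightarrow>
      norm (\<Phi> t a - \<Phi> t b - (\<Phi> t a' - \<Phi> t b')) \<le> L * (norm (a - b) * norm (b - b'))"
proof -
  interpret rev: C2_flow "\<lambda>x. - v x" "\<lambda>t. \<Phi> (- t)" by (rule reversed_flow)
  have inv': "invariant_set (\<lambda>t. \<Phi> (- t)) M" using inv by (simp add: invariant_set_def)
  have T: "0 \<le> \<bar>T\<bar>" by simp
  obtain \<delta>1 L1 where 1: "0 < \<delta>1" "0 \<le> L1"
    "\<And>x t a b. x \<in> M \<Longrightarrow> t \<in> {0..\<bar>T\<bar>} \<Longrightarrow> {a, b} \<subseteq> ball x \<delta>1 \<Longrightarrow>
      norm (\<Phi> t a - \<Phi> t b) \<le> L1 * norm (a - b)"
    "\<And>x t a b a' b'. x \<in> M \<Longrightarrow> t \<in> {0..\<bar>T\<bar>} \<Longrightarrow> {a, b, a', b'} \<subseteq> ball x \<delta>1 \<Longrightarrow>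
      a - b = a' - b' \<Longrightarrow>
      norm (\<Phi> t a - \<Phi> t b - (\<Phi> t a' - \<Phi> t b')) \<le> L1 * (norm (a - b) * norm (b - b'))"
    using flow_estimates_nonneg[OF \<open>compact M\<close> inv T] by blast
  obtain \<delta>2 L2 where 2: "0 < \<delta>2" "0 \<le> L2"
    "\<And>x t a b. x \<in> M \<Longrightarrow> t \<in> {0..\<bar>T\<bar>} \<Longrightarrow> {a, b} \<subseteq> ball x \<delta>2 \<Longrightarrow>
      norm (\<Phi> (- t) a - \<Phi> (- t) b) \<le> L2 * norm (a - b)"
    "\<And>x t a b a' b'. x \<in> M \<Longrightarrow> t \<in> {0..\<bar>T\<bar>} \<Longrightarrow> {a, b, a', b'} \<subseteq> ball x \<delta>2 \<Longrightarrow>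
      a - b = a' - b' \<Longrightarrow>
      norm (\<Phi> (- t) a - \<Phi> (- t) b - (\<Phi> (- t) a' - \<Phi> (- t) b')) \<le> L2 * (norm (a - b) * norm (b - b'))"
    using rev.flow_estimates_nonneg[OF \<open>compact M\<close> inv' T] by blast
  have balls: "ball x (min \<delta>1 \<delta>2) \<subseteq> ball x \<delta>1" "ball x (min \<delta>1 \<delta>2) \<subseteq> ball x \<delta>2" for x :: 'a
    by auto
  have weaken: "r \<le> max L1 L2 * s" if "r \<le> L1 * s \<or> r \<le> L2 * s" "0 \<le> s" for r s
    using that by (smt (verit) max.cobounded1 max.cobounded2 mult_right_mono)
  show thesis
  proof (rule that[of "min \<delta>1 \<delta>2" "max L1 L2"])
    fix x t a b assume x: "x \<in> M" and t: "t \<in> {- T..T}" and ab: "{a, b} \<subseteq> ball x (min \<delta>1 \<delta>2)"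
    have ab': "{a, b} \<subseteq> ball x \<delta>1" "{a, b} \<subseteq> ball x \<delta>2" using ab balls by blast+
    have "norm (\<Phi> t a - \<Phi> t b) \<le> L1 * norm (a - b) \<or> norm (\<Phi> t a - \<Phi> t b) \<le> L2 * norm (a - b)"
      using 1(3)[OF x _ ab'(1), of t] 2(3)[OF x _ ab'(2), of "- t"] t by (cases "0 \<le> t") auto
    then show "norm (\<Phi> t a - \<Phi> t b) \<le> max L1 L2 * norm (a - b)" by (rule weaken) simp
  next
    fix x t a b a' b' assume x: "x \<in> M" and t: "t \<in> {- T..T}"
      and pts: "{a, b, a', b'} \<subseteq> ball x (min \<delta>1 \<delta>2)" and eq: "a - b = a' - b'"
    have pts': "{a, b, a', b'} \<subseteq> ball x \<delta>1" "{a, b, a', b'} \<subseteq> ball x \<delta>2" using pts balls by blast+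
    have "norm (\<Phi> t a - \<Phi> t b - (\<Phi> t a' - \<Phi> t b')) \<le> L1 * (norm (a - b) * norm (b - b')) \<or>
        norm (\<Phi> t a - \<Phi> t b - (\<Phi> t a' - \<Phi> t b')) \<le> L2 * (norm (a - b) * norm (b - b'))"
      using 1(4)[OF x _ pts'(1) eq, of t] 2(4)[OF x _ pts'(2) eq, of "- t"] t by (cases "0 \<le> t") auto
    then show "norm (\<Phi> t a - \<Phi> t b - (\<Phi> t a' - \<Phi> t b')) \<le> max L1 L2 * (norm (a - b) * norm (b - b'))"
      by (rule weaken) simp
  qed (use 1 2 in auto)
qed

end

section \<open>Differentiability from second differences\<close>

text \<open>The defect \<open>X (r *\<^sub>R x) - r *\<^sub>R X x\<close> is additive in \<open>r\<close>, vanishes at integers and is bounded.\<close>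

lemma additive_bounded_imp_bounded_linear:
  fixes X :: "'a::real_normed_vector \<Rightarrow> 'b::real_normed_vector"
  assumes add: "\<And>x y. X (x + y) = X x + X y" and bnd: "\<And>x. norm (X x) \<le> L * norm x"
  shows "bounded_linear X"
proof (rule bounded_linear_intro[where K = L])
  show "X (r *\<^sub>R x) = r *\<^sub>R X x" for r x
  proof -
    define g where "g r = X (r *\<^sub>R x) - r *\<^sub>R X x" for r
    have g_add: "g (r + s) = g r + g s" for r s
      by (simp add: g_def scaleR_add_left add)
    have g0: "g 0 = 0" using g_add[of 0 0] by simp
    have g_nat: "g (of_nat n * r) = of_nat n *\<^sub>R g r" for n r
      by (induction n) (simp_all add: g0 g_add distrib_right scaleR_add_left)
    have g1: "g 1 = 0" by (simp add: g_def)
    have g_n: "g (of_nat n) = 0" for n using g_nat[of n 1] g1 by simp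
    have g_minus: "g (- r) = - g r" for r
      using g_add[of r "- r"] g0 by (simp add: eq_neg_iff_add_eq_0 add.commute)
    have g_int: "g (of_int k) = 0" for k
      by (cases k rule: int_cases2) (simp_all add: g_n g_minus)
    \<comment> \<open>an additive function of period 1 that is bounded near 0 is bounded, hence zero\<close>
    have g_bounded: "norm (g r) \<le> 2 * \<bar>L\<bar> * norm x" for r
    proof -
      have "g r = g (frac r + of_int \<lfloor>r\<rfloor>)" by (simp add: frac_def)
      also have "\<dots> = g (frac r)" unfolding g_add g_int by simp
      finally have "norm (g r) = norm (X (frac r *\<^sub>R x) - frac r *\<^sub>R X x)" by (simp add: g_def)
      also have "\<dots> \<le> norm (X (frac r *\<^sub>R x)) + norm (frac r *\<^sub>R X x)" by (rule norm_triangle_ineq4)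
      also have "\<dots> \<le> \<bar>L\<bar> * norm x + \<bar>L\<bar> * norm x"
      proof (rule add_mono)
        have fr: "0 \<le> frac r" "frac r \<le> 1" using frac_lt_1[of r] by simp_all
        have Lx: "norm (X y) \<le> \<bar>L\<bar> * norm y" for y
          using bnd[of y] by (smt (verit) mult_right_mono norm_ge_zero)
        have small: "frac r * norm x \<le> norm x"
          using fr by (simp add: mult_left_le_one_le)
        have "norm (X (frac r *\<^sub>R x)) \<le> \<bar>L\<bar> * (frac r * norm x)"
          using Lx[of "frac r *\<^sub>R x"] fr by simp
        also have "\<dots> \<le> \<bar>L\<bar> * norm x" by (intro mult_left_mono small) auto
        finally show "norm (X (frac r *\<^sub>R x)) \<le> \<bar>L\<bar> * norm x" .
        have "norm (frac r *\<^sub>R X x) \<le> norm (X x)"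
          using fr by (simp add: mult_left_le_one_le)
        then show "norm (frac r *\<^sub>R X x) \<le> \<bar>L\<bar> * norm x" using Lx[of x] by linarith
      qed
      finally show ?thesis by simp
    qed
    have "g r = 0"
    proof (rule ccontr)
      assume "g r \<noteq> 0"
      then obtain n :: nat where n: "2 * \<bar>L\<bar> * norm x < real n * norm (g r)"
        using reals_Archimedean3[of "norm (g r)"] by auto
      show False
        using g_bounded[of "of_nat n * r"] n unfolding g_nat by simp
    qed
    then show ?thesis by (simp add: g_def)
  qed
qed (use add bnd in \<open>auto simp: mult.commute\<close>)

text \<open>The dyadic quotients \<open>2 ^ n *\<^sub>R (f (x + \<eta> / 2 ^ n) - f x)\<close> form a Cauchy sequence, because halving the
  increment costs only a second-order error. Their limit is additive for the same reason. This
  produces the derivative of the flow without solving the variational equation.\<close>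

lemma second_difference_imp_derivative:
  fixes f :: "'a::real_normed_vector \<Rightarrow> 'b::banach"
  assumes \<delta>: "0 < \<delta>" and L: "0 \<le> L"
    and lip: "\<And>a b. {a, b} \<subseteq> ball x \<delta> \<Longrightarrow> norm (f a - f b) \<le> L * norm (a - b)"
    and snd: "\<And>a b a' b'. {a, b, a', b'} \<subseteq> ball x \<delta> \<Longrightarrow> a - b = a' - b' \<Longrightarrow>
      norm (f a - f b - (f a' - f b')) \<le> L * (norm (a - b) * norm (b - b'))"
  obtains X where "(f has_derivative X) (at x)"
    "\<And>\<eta>. norm (X \<eta>) \<le> L * norm \<eta>"
    "\<And>\<eta>. norm \<eta> < \<delta> \<Longrightarrow> norm (f (x + \<eta>) - f x - X \<eta>) \<le> L * (norm \<eta>)\<^sup>2"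
proof -
  define d where "d \<eta> = f (x + \<eta>) - f x" for \<eta>
  define D where "D \<eta> n = 2 ^ n *\<^sub>R d ((1 / 2 ^ n) *\<^sub>R \<eta>)" for \<eta> and n :: nat
  have ball: "x + \<eta> \<in> ball x \<delta> \<longleftrightarrow> norm \<eta> < \<delta>" for \<eta> by (simp add: dist_norm)
  have x_in: "x \<in> ball x \<delta>" using \<delta> by simp
  have d_add: "norm (d (\<eta> + \<theta>) - d \<eta> - d \<theta>) \<le> L * (norm \<eta> * norm \<theta>)"
    if "norm \<eta> + norm \<theta> < \<delta>" for \<eta> \<theta>
  proof -
    have "norm \<eta> < \<delta>" "norm \<theta> < \<delta>" "norm (\<eta> + \<theta>) < \<delta>"
      using that norm_triangle_ineq[of \<eta> \<theta>] norm_ge_zero[of \<eta>] norm_ge_zero[of \<theta>] by linarith+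
    then have "{x + (\<eta> + \<theta>), x + \<theta>, x + \<eta>, x} \<subseteq> ball x \<delta>"
      using x_in by (simp only: ball insert_subset empty_subsetI simp_thms)
    from snd[OF this] show ?thesis by (simp add: d_def algebra_simps)
  qed
  have d_lip: "norm (d \<eta>) \<le> L * norm \<eta>" if "norm \<eta> < \<delta>" for \<eta>
    using lip[of "x + \<eta>" x] that \<delta> unfolding d_def by (simp add: dist_norm)
  have small: "\<forall>\<^sub>F n in sequentially. norm ((1 / 2 ^ n) *\<^sub>R \<eta>) < r" if "0 < r" for \<eta> :: 'a and r
  proof -
    have "(\<lambda>n. (1 / 2) ^ n * norm \<eta>) \<longlonglongrightarrow> 0 * norm \<eta>"
      by (intro tendsto_intros LIMSEQ_realpow_zero) auto
    then have "(\<lambda>n. norm ((1 / 2 ^ n) *\<^sub>R \<eta>)) \<longlonglongrightarrow> 0" by (simp add: power_one_over)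
    from order_tendstoD(2)[OF this that] show ?thesis .
  qed
  have step: "norm (D \<eta> (Suc n) - D \<eta> n) \<le> L * (norm \<eta>)\<^sup>2 * (1 / 2) ^ Suc n"
    if "norm ((1 / 2 ^ n) *\<^sub>R \<eta>) < \<delta>" for \<eta> n
  proof -
    define \<theta> where "\<theta> = (1 / 2 ^ Suc n) *\<^sub>R \<eta>"
    have two: "(1 / 2 ^ n) *\<^sub>R \<eta> = \<theta> + \<theta>"
      by (simp add: \<theta>_def flip: scaleR_add_left)
    have "norm \<theta> + norm \<theta> < \<delta>"
      using that by (simp add: \<theta>_def)
    then have "norm (d (\<theta> + \<theta>) - d \<theta> - d \<theta>) \<le> L * (norm \<theta> * norm \<theta>)" by (rule d_add)
    moreover have "D \<eta> (Suc n) - D \<eta> n = - (2 ^ n *\<^sub>R (d (\<theta> + \<theta>) - d \<theta> - d \<theta>))"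
      unfolding D_def two \<theta>_def[symmetric] by (simp add: algebra_simps flip: scaleR_2)
    ultimately have "norm (D \<eta> (Suc n) - D \<eta> n) \<le> 2 ^ n * (L * (norm \<theta> * norm \<theta>))"
      by simp
    also have "\<dots> = L * (norm \<eta>)\<^sup>2 * ((1 / 2) ^ Suc n) * (1 / 2)"
      by (simp add: \<theta>_def power2_eq_square power_one_over field_simps)
    also have "\<dots> \<le> L * (norm \<eta>)\<^sup>2 * ((1 / 2) ^ Suc n)"
      using L by (intro mult_right_le_one_le) auto
    finally show ?thesis .
  qed
  have "convergent (D \<eta>)" for \<eta>
  proof -
    have "summable (\<lambda>n. D \<eta> (Suc n) - D \<eta> n)"
    proof (rule summable_comparison_test_ev)
      show "\<forall>\<^sub>F n in sequentially. norm (D \<eta> (Suc n) - D \<eta> n) \<le> L * (norm \<eta>)\<^sup>2 * (1 / 2) ^ Suc n"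
        using small[OF \<delta>, of \<eta>] by eventually_elim (rule step)
      show "summable (\<lambda>n. L * (norm \<eta>)\<^sup>2 * (1 / 2) ^ Suc n)"
        by (intro summable_mult iffD2[OF summable_Suc_iff] summable_geometric) auto
    qed
    then have "convergent (\<lambda>n. \<Sum>i<n. D \<eta> (Suc i) - D \<eta> i)"
      by (simp add: summable_iff_convergent)
    then show ?thesis
      using convergent_add[OF _ convergent_const[of "D \<eta> 0"]] by (fastforce simp: sum_lessThan_telescope)
  qed
  then obtain X where X: "\<And>\<eta>. D \<eta> \<longlonglongrightarrow> X \<eta>"
    unfolding convergent_def by metis
  have X_add: "X (\<eta> + \<theta>) = X \<eta> + X \<theta>" for \<eta> \<theta>
  proof -
    have "(\<lambda>n. D (\<eta> + \<theta>) n - D \<eta> n - D \<theta> n) \<longlonglongrightarrow> 0"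
    proof (rule tendsto_norm_zero_cancel, rule tendsto_sandwich)
      show "\<forall>\<^sub>F n in sequentially. 0 \<le> norm (D (\<eta> + \<theta>) n - D \<eta> n - D \<theta> n)" by simp
      have "(\<lambda>n. (1 / 2) ^ n * (L * (norm \<eta> * norm \<theta>))) \<longlonglongrightarrow> 0 * (L * (norm \<eta> * norm \<theta>))"
        by (intro tendsto_intros LIMSEQ_realpow_zero) auto
      then show "(\<lambda>n. (1 / 2) ^ n * (L * (norm \<eta> * norm \<theta>))) \<longlonglongrightarrow> 0" by simp
      have "\<forall>\<^sub>F n in sequentially. norm ((1 / 2 ^ n) *\<^sub>R \<eta>) < \<delta> / 2" "\<forall>\<^sub>F n in sequentially. norm ((1 / 2 ^ n) *\<^sub>R \<theta>) < \<delta> / 2"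
        using \<delta> by (intro small, simp)+
      then show "\<forall>\<^sub>F n in sequentially. norm (D (\<eta> + \<theta>) n - D \<eta> n - D \<theta> n) \<le> (1 / 2) ^ n * (L * (norm \<eta> * norm \<theta>))"
      proof eventually_elim
        case (elim n)
        define h where "h = (1 / 2 ^ n :: real)"
        have "norm (h *\<^sub>R \<eta>) + norm (h *\<^sub>R \<theta>) < \<delta>" using elim unfolding h_def by linarith
        then have "norm (d (h *\<^sub>R \<eta> + h *\<^sub>R \<theta>) - d (h *\<^sub>R \<eta>) - d (h *\<^sub>R \<theta>)) \<le> L * (norm (h *\<^sub>R \<eta>) * norm (h *\<^sub>R \<theta>))"
          by (rule d_add)
        moreover have "D (\<eta> + \<theta>) n - D \<eta> n - D \<theta> n = 2 ^ n *\<^sub>R (d (h *\<^sub>R \<eta> + h *\<^sub>R \<theta>) - d (h *\<^sub>R \<eta>) - d (h *\<^sub>R \<theta>))"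
          unfolding D_def h_def by (simp add: algebra_simps)
        ultimately have "norm (D (\<eta> + \<theta>) n - D \<eta> n - D \<theta> n) \<le> 2 ^ n * (L * (norm (h *\<^sub>R \<eta>) * norm (h *\<^sub>R \<theta>)))"
          by simp
        also have "\<dots> = (1 / 2) ^ n * (L * (norm \<eta> * norm \<theta>))"
          by (simp add: h_def power_one_over field_simps)
        finally show ?case .
      qed
    qed simp
    moreover have "(\<lambda>n. D (\<eta> + \<theta>) n - D \<eta> n - D \<theta> n) \<longlonglongrightarrow> X (\<eta> + \<theta>) - X \<eta> - X \<theta>"
      by (intro tendsto_diff X)
    ultimately have "X (\<eta> + \<theta>) - X \<eta> - X \<theta> = 0" by (rule LIMSEQ_unique[rotated])
    then show ?thesis by (simp add: algebra_simps)
  qed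
  have X_bound: "norm (X \<eta>) \<le> L * norm \<eta>" for \<eta>
  proof (rule tendsto_upperbound[OF tendsto_norm[OF X]])
    show "\<forall>\<^sub>F n in sequentially. norm (D \<eta> n) \<le> L * norm \<eta>"
      using small[OF \<delta>, of \<eta>]
    proof eventually_elim
      case (elim n)
      from d_lip[OF this] show ?case by (simp add: D_def field_simps)
    qed
  qed simp
  have remainder: "norm (d \<eta> - X \<eta>) \<le> L * (norm \<eta>)\<^sup>2" if "norm \<eta> < \<delta>" for \<eta>
  proof (rule tendsto_upperbound[OF tendsto_norm[OF tendsto_diff[OF tendsto_const X]]])
    have "norm (d \<eta> - D \<eta> n) \<le> L * (norm \<eta>)\<^sup>2 * (1 - (1 / 2) ^ n)" for n
    proof (induction n)
      case 0
      then show ?case by (simp add: D_def)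
    next
      case (Suc n)
      have "norm ((1 / 2 ^ n) *\<^sub>R \<eta>) \<le> norm \<eta>"
        by (simp add: divide_le_eq mult_le_cancel_left1)
      then have "norm (D \<eta> (Suc n) - D \<eta> n) \<le> L * (norm \<eta>)\<^sup>2 * (1 / 2) ^ Suc n"
        using that by (intro step) linarith
      then have "norm (d \<eta> - D \<eta> (Suc n)) \<le> L * (norm \<eta>)\<^sup>2 * (1 - (1 / 2) ^ n) + L * (norm \<eta>)\<^sup>2 * (1 / 2) ^ Suc n"
        using Suc norm_triangle_ineq4[of "d \<eta> - D \<eta> n" "D \<eta> (Suc n) - D \<eta> n"] by simp
      also have "\<dots> = L * (norm \<eta>)\<^sup>2 * (1 - (1 / 2) ^ Suc n)"
        by (simp add: algebra_simps)
      finally show ?case .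
    qed
    moreover have "L * (norm \<eta>)\<^sup>2 * (1 - (1 / 2) ^ n) \<le> L * (norm \<eta>)\<^sup>2" for n
      using L by (intro mult_right_le_one_le) (auto simp: power_le_one)
    ultimately show "\<forall>\<^sub>F n in sequentially. norm (d \<eta> - D \<eta> n) \<le> L * (norm \<eta>)\<^sup>2"
      by (intro always_eventually allI) (rule order_trans)
  qed simp
  have "(f has_derivative X) (at x)"
    unfolding has_derivative_at
  proof (intro conjI)
    show "bounded_linear X"
      using X_add X_bound by (rule additive_bounded_imp_bounded_linear)
    show "(\<lambda>h. norm (f (x + h) - f x - X h) / norm h) \<midarrow>0\<rightarrow> 0"
    proof (rule tendsto_sandwich)
      show "\<forall>\<^sub>F h in at 0. 0 \<le> norm (f (x + h) - f x - X h) / norm h" by simp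
      have "((\<lambda>h :: 'a. L * norm h) \<longlongrightarrow> L * norm (0 :: 'a)) (at 0)" by (rule tendsto_mult[OF tendsto_const tendsto_norm[OF tendsto_ident_at]])
      then show "((\<lambda>h :: 'a. L * norm h) \<longlongrightarrow> 0) (at 0)" by simp
      have "\<forall>\<^sub>F h in at (0 :: 'a). norm h < \<delta> \<and> h \<noteq> 0"
        using \<delta> unfolding eventually_at by (intro exI[of _ \<delta>]) (auto simp: dist_norm)
      then show "\<forall>\<^sub>F h in at 0. norm (f (x + h) - f x - X h) / norm h \<le> L * norm h"
      proof eventually_elim
        case (elim h)
        then show ?case
          using remainder[of h] by (simp add: d_def divide_le_eq power2_eq_square mult.assoc)
      qed
    qed simp
  qed
  then show thesis
    using that[of X] X_bound remainder by (simp add: d_def)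
qed

section \<open>Exponentially decaying orbits along an approximate dichotomy\<close>

text \<open>The contraction principle for sequences with the norm \<open>sup\<^sub>k norm (u k) / \<theta> ^ k\<close>. It is stated for plain
  functions on \<open>nat\<close>, the norm being expressed by pointwise bounds.\<close>

lemma weighted_contraction_fixpoint:
  fixes F :: "(nat \<Rightarrow> 'a::banach) \<Rightarrow> nat \<Rightarrow> 'a"
  assumes \<theta>: "0 \<le> \<theta>" and \<rho>: "0 \<le> \<rho>"
    and into: "\<And>u k. (\<And>k. norm (u k) \<le> \<rho> * \<theta> ^ k) \<Longrightarrow> norm (F u k) \<le> \<rho> * \<theta> ^ k"
    and contr: "\<And>u w D k. (\<And>k. norm (u k) \<le> \<rho> * \<theta> ^ k) \<Longrightarrow> (\<And>k. norm (w k) \<le> \<rho> * \<theta> ^ k) \<Longrightarrow>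
      (\<And>k. norm (u k - w k) \<le> D * \<theta> ^ k) \<Longrightarrow> norm (F u k - F w k) \<le> D / 2 * \<theta> ^ k"
  obtains u where "\<And>k. norm (u k) \<le> \<rho> * \<theta> ^ k" "\<And>k. u k = F u k"
proof -
  define U where "U n = (F ^^ n) (\<lambda>_. 0)" for n
  have U_Suc: "U (Suc n) = F (U n)" for n by (simp add: U_def)
  have U_bound: "norm (U n k) \<le> \<rho> * \<theta> ^ k" for n k
  proof (induction n arbitrary: k)
    case 0
    then show ?case using \<theta> \<rho> by (simp add: U_def)
  next
    case (Suc n)
    then show ?case unfolding U_Suc by (rule into)
  qed
  have step: "norm (U (Suc n) k - U n k) \<le> \<rho> / 2 ^ n * \<theta> ^ k" for n k
  proof (induction n arbitrary: k)
    case 0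
    then show ?case using U_bound[of 1 k] by (simp add: U_def)
  next
    case (Suc n)
    show ?case
      using contr[of "U (Suc n)" "U n", OF U_bound U_bound Suc, of k] by (simp add: U_Suc mult.commute)
  qed
  have dist_U: "norm (U (n + m) k - U n k) \<le> (2 * \<rho> / 2 ^ n) * \<theta> ^ k * (1 - (1 / 2) ^ m)" for n m k
  proof (induction m)
    case (Suc m)
    have "norm (U (n + Suc m) k - U n k) \<le> norm (U (Suc (n + m)) k - U (n + m) k) + norm (U (n + m) k - U n k)"
      using norm_triangle_ineq[of "U (Suc (n + m)) k - U (n + m) k" "U (n + m) k - U n k"] by simp
    also have "\<dots> \<le> \<rho> / 2 ^ (n + m) * \<theta> ^ k + (2 * \<rho> / 2 ^ n) * \<theta> ^ k * (1 - (1 / 2) ^ m)"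
      by (intro add_mono step Suc)
    also have "\<dots> = (2 * \<rho> / 2 ^ n) * \<theta> ^ k * (1 - (1 / 2) ^ Suc m)"
      by (simp add: power_add field_simps power_one_over)
    finally show ?case .
  qed simp
  have dist_U': "norm (U (n + m) k - U n k) \<le> (2 * \<rho> / 2 ^ n) * \<theta> ^ k" for n m k
  proof -
    have "(2 * \<rho> / 2 ^ n) * \<theta> ^ k * (1 - (1 / 2) ^ m) \<le> (2 * \<rho> / 2 ^ n) * \<theta> ^ k"
      using \<theta> \<rho> by (intro mult_right_le_one_le) (auto simp: power_le_one)
    then show ?thesis using dist_U[of n m k] by linarith
  qed
  have to_zero: "(\<lambda>n. (c / 2 ^ n) * \<theta> ^ k) \<longlonglongrightarrow> 0" for c k
  proof -
    have "(\<lambda>n. c * (1 / 2) ^ n * \<theta> ^ k) \<longlonglongrightarrow> c * 0 * \<theta> ^ k"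
      by (intro tendsto_intros LIMSEQ_realpow_zero) auto
    then show ?thesis by (simp add: power_one_over)
  qed
  have "Cauchy (\<lambda>n. U n k)" for k
  proof (rule CauchyI)
    fix e :: real assume "0 < e"
    from order_tendstoD(2)[OF to_zero[of "2 * \<rho>" k] half_gt_zero[OF this]]
    obtain N where N: "(2 * \<rho> / 2 ^ N) * \<theta> ^ k < e / 2" by (auto simp: eventually_sequentially)
    have near: "norm (U m k - U N k) < e / 2" if "N \<le> m" for m
      using dist_U'[of N "m - N" k] N that by simp
    have "norm (U m k - U n k) < e" if "N \<le> m" "N \<le> n" for m n
      using near[OF that(1)] near[OF that(2)] norm_triangle_ineq4[of "U m k - U N k" "U n k - U N k"] by simp
    then show "\<exists>M. \<forall>m\<ge>M. \<forall>n\<ge>M. norm (U m k - U n k) < e" by blast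
  qed
  then obtain u where u: "\<And>k. (\<lambda>n. U n k) \<longlonglongrightarrow> u k"
    unfolding Cauchy_convergent_iff convergent_def by metis
  have u_bound: "norm (u k) \<le> \<rho> * \<theta> ^ k" for k
    by (rule tendsto_upperbound[OF tendsto_norm[OF u]]) (auto simp: U_bound)
  have u_near: "norm (u k - U n k) \<le> (2 * \<rho> / 2 ^ n) * \<theta> ^ k" for n k
  proof (rule tendsto_upperbound)
    show "(\<lambda>m. norm (U (n + m) k - U n k)) \<longlonglongrightarrow> norm (u k - U n k)"
      using LIMSEQ_ignore_initial_segment[OF u[of k], of n]
      by (intro tendsto_intros) (simp add: add.commute)
  qed (use dist_U' in simp_all)
  have "F u k = u k" for k
  proof (rule LIMSEQ_unique)
    show "(\<lambda>n. U (Suc n) k) \<longlonglongrightarrow> u k" by (rule LIMSEQ_Suc[OF u])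
    have "norm (U (Suc n) k - F u k) \<le> (\<rho> / 2 ^ n) * \<theta> ^ k" for n
      using contr[of u "U n", OF u_bound U_bound u_near, of k]
      by (simp add: U_Suc norm_minus_commute)
    then have "(\<lambda>n. U (Suc n) k - F u k) \<longlonglongrightarrow> 0"
      by (intro Lim_null_comparison[OF _ to_zero[of \<rho> k]]) auto
    then show "(\<lambda>n. U (Suc n) k) \<longlonglongrightarrow> F u k" by (rule LIM_zero_cancel)
  qed
  with u_bound show thesis by (metis that)
qed

text \<open>One step of a linear nonautonomous system near a hyperbolic one: \<open>A k\<close> is the step, \<open>B k\<close> its inverse, \<open>P k\<close>
  the projection to the stable directions. The projections need not be invariant under \<open>A\<close>:
  \<open>P_A_small\<close> allows for leakage from the complement. In coordinates rescaled by \<open>\<theta> ^ k\<close> the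
  stable part contracts forwards and the complement contracts backwards, both by \<open>\<kappa>\<close>. The last
  assumption says that no step can hide an error from both projections.\<close>

locale approximate_dichotomy =
  fixes A B P :: "nat \<Rightarrow> 'a::euclidean_space \<Rightarrow> 'a" and K \<kappa> \<beta> \<theta> :: real
  assumes \<theta>: "0 < \<theta>" "\<theta> < 1" and K: "1 \<le> K" and \<beta>: "0 \<le> \<beta>" and \<kappa>: "0 \<le> \<kappa>" "\<kappa> \<le> 1 / 8"
    and linear_A: "linear (A k)" and linear_B: "linear (B k)" and linear_P: "linear (P k)"
    and P_bound: "norm (P k w) \<le> K * norm w"
    and P_idem: "P k (P k w) = P k w"
    and P_A_small: "norm (P (Suc k) (A k w)) \<le> \<kappa> * \<theta> * norm w"
    and Q_B_bound: "norm (B k w - P k (B k w)) \<le> \<beta> * norm w"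
    and \<beta>_\<theta>: "\<beta> * \<theta> \<le> \<kappa>"
    and B_A: "B k (A k w) = w"
    and transversal: "P (Suc k) r = 0 \<Longrightarrow> P k (B k r) = B k r \<Longrightarrow> r = 0"
begin

definition Q :: "nat \<Rightarrow> 'a \<Rightarrow> 'a" where "Q k w = w - P k w"

lemma linear_Q: "linear (Q k)"
  unfolding Q_def[abs_def] by (intro linear_compose_sub linear_P linear_ident)

lemmas P_linear = linear_add[OF linear_P] linear_diff[OF linear_P] linear_0[OF linear_P]
lemmas QB_linear = linear_add[OF linear_compose[OF linear_B linear_Q, unfolded o_def]]
  linear_diff[OF linear_compose[OF linear_B linear_Q, unfolded o_def]]
  linear_0[OF linear_compose[OF linear_B linear_Q, unfolded o_def]]

lemma QB_bound: "norm (Q k (B k w)) \<le> \<beta> * norm w"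
  using Q_B_bound by (simp add: Q_def)

lemma P_Q: "P k (Q k w) = 0"
  by (simp add: Q_def P_linear P_idem)

lemma Q_P: "Q k (P k w) = 0"
  by (simp add: Q_def P_idem)

lemma stable_step_bound:
  assumes n: "norm n \<le> \<epsilon> * norm w" and \<epsilon>: "K * \<epsilon> \<le> \<kappa> * \<theta>"
  shows "norm (P (Suc k) (A k w + n)) \<le> 2 * \<kappa> * \<theta> * norm w"
proof -
  have "norm (P (Suc k) n) \<le> K * (\<epsilon> * norm w)"
    using order_trans[OF P_bound mult_left_mono[OF n]] K by simp
  also have "\<dots> \<le> \<kappa> * \<theta> * norm w"
    using mult_right_mono[OF \<epsilon>, of "norm w"] by (simp add: mult.assoc)
  finally show ?thesis
    using norm_triangle_ineq[of "P (Suc k) (A k w)" "P (Suc k) n"] P_A_small[of k w]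
    by (simp add: P_linear)
qed

lemma unstable_step_bound:
  assumes n: "norm n \<le> \<epsilon> * norm w" and \<epsilon>: "\<beta> * \<epsilon> \<le> \<kappa>"
    and w: "norm w \<le> \<theta> ^ k * D" and w': "norm w' \<le> \<theta> ^ Suc k * D"
  shows "norm (Q k (B k (w' - n))) \<le> 2 * \<kappa> * (\<theta> ^ k * D)"
proof -
  have D: "0 \<le> \<theta> ^ k * D" using w norm_ge_zero order_trans by blast
  have "norm (Q k (B k (w' - n))) \<le> \<beta> * norm (w' - n)" by (rule QB_bound)
  also have "\<dots> \<le> \<beta> * (norm w' + norm n)"
    by (intro mult_left_mono norm_triangle_ineq4 \<beta>)
  also have "\<dots> \<le> \<beta> * norm w' + \<beta> * \<epsilon> * norm w"
    using mult_left_mono[OF n \<beta>] by (simp add: algebra_simps)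
  also have "\<dots> \<le> \<kappa> * (\<theta> ^ k * D) + \<kappa> * (\<theta> ^ k * D)"
  proof (rule add_mono)
    have "\<beta> * norm w' \<le> \<beta> * (\<theta> ^ Suc k * D)" by (intro mult_left_mono w' \<beta>)
    also have "\<dots> = \<beta> * \<theta> * (\<theta> ^ k * D)" by simp
    also have "\<dots> \<le> \<kappa> * (\<theta> ^ k * D)" by (intro mult_right_mono \<beta>_\<theta> D)
    finally show "\<beta> * norm w' \<le> \<kappa> * (\<theta> ^ k * D)" .
    have "\<beta> * \<epsilon> * norm w \<le> \<kappa> * norm w" by (intro mult_right_mono \<epsilon>) auto
    also have "\<dots> \<le> \<kappa> * (\<theta> ^ k * D)" by (intro mult_left_mono w \<kappa>)
    finally show "\<beta> * \<epsilon> * norm w \<le> \<kappa> * (\<theta> ^ k * D)" .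
  qed
  finally show ?thesis by (simp add: algebra_simps)
qed

text \<open>Lyapunov-Perron. For \<open>g k\<close> close to \<open>A k\<close>, the equation \<open>\<eta> (Suc k) = g k (\<eta> k)\<close> is equivalent to a pair of
  equations, one for \<open>P (Suc k)\<close> read forwards and one for the complement read backwards through
  \<open>B k\<close>; the equivalence is \<open>transversal\<close>. Together with \<open>P 0 (\<eta> 0)\<close> they form a contraction of sequences that
  decay like \<open>\<theta> ^ k\<close>.\<close>

lemma decaying_orbit_exists:
  assumes \<rho>: "0 < \<rho>" and a: "K * norm a \<le> \<rho> / 2"
    and \<epsilon>: "K * \<epsilon> \<le> \<kappa> * \<theta>" "\<beta> * \<epsilon> \<le> \<kappa>"
    and g0: "\<And>k. g k 0 = 0"
    and g: "\<And>k \<eta> \<eta>'. norm \<eta> \<le> \<rho> \<Longrightarrow> norm \<eta>' \<le> \<rho> \<Longrightarrow>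
      norm (g k \<eta> - g k \<eta>' - A k (\<eta> - \<eta>')) \<le> \<epsilon> * norm (\<eta> - \<eta>')"
  obtains \<eta> where "P 0 (\<eta> 0) = P 0 a" "\<And>k. \<eta> (Suc k) = g k (\<eta> k)" "\<And>k. norm (\<eta> k) \<le> \<rho> * \<theta> ^ k"
proof -
  define G where "G u k =
     (case k of 0 \<Rightarrow> P 0 a | Suc j \<Rightarrow> P k (g j (u j)))
       + Q k (B k (u (Suc k) - (g k (u k) - A k (u k))))" for u k
  define S where "S = {u :: nat \<Rightarrow> 'a. \<forall>k. norm (u k) \<le> \<rho> * \<theta> ^ k}"
  have S_norm: "norm (u k) \<le> \<rho>" if "u \<in> S" for u k
  proof -
    have "norm (u k) \<le> \<rho> * \<theta> ^ k" using that by (simp add: S_def)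
    also have "\<dots> \<le> \<rho>" using \<rho> \<theta> by (simp add: mult_left_le power_le_one)
    finally show ?thesis .
  qed
  have contr: "norm (G u k - G w k) \<le> D / 2 * \<theta> ^ k"
    if u: "u \<in> S" and w: "w \<in> S" and uw: "\<And>k. norm (u k - w k) \<le> D * \<theta> ^ k" for u w :: "nat \<Rightarrow> 'a" and D k
  proof -
    have D: "0 \<le> D" using order_trans[OF norm_ge_zero uw[of 0]] by simp
    have diff: "norm (u k - w k) \<le> \<theta> ^ k * D" for k using uw[of k] by (simp add: mult.commute)
    define n where "n k = g k (u k) - g k (w k) - A k (u k - w k)" for k
    have n: "norm (n k) \<le> \<epsilon> * norm (u k - w k)" for k
      unfolding n_def by (intro g S_norm u w)
    have gdiff: "g k (u k) - g k (w k) = A k (u k - w k) + n k" for k by (simp add: n_def)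
    define p where "p u k = (case k of 0 \<Rightarrow> P 0 a | Suc j \<Rightarrow> P k (g j (u j)))" for u k
    have 1: "norm (p u k - p w k) \<le> 2 * \<kappa> * (\<theta> ^ k * D)"
    proof (cases k)
      case 0
      then show ?thesis using \<kappa> D by (simp add: p_def)
    next
      case (Suc j)
      have "p u k - p w k = P (Suc j) (A j (u j - w j) + n j)"
        using Suc by (simp add: p_def flip: P_linear gdiff)
      also have "norm \<dots> \<le> 2 * \<kappa> * \<theta> * norm (u j - w j)"
        by (rule stable_step_bound[OF n \<epsilon>(1)])
      also have "\<dots> \<le> 2 * \<kappa> * \<theta> * (\<theta> ^ j * D)"
        using \<kappa> \<theta> by (intro mult_left_mono diff) auto
      finally show ?thesis by (simp add: Suc)
    qed
    have "G u k - G w k = (p u k - p w k) + Q k (B k ((u (Suc k) - w (Suc k)) - n k))"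
      unfolding G_def p_def[symmetric]
      by (simp add: n_def linear_diff[OF linear_A] algebra_simps flip: QB_linear)
    moreover have 2: "norm (Q k (B k ((u (Suc k) - w (Suc k)) - n k))) \<le> 2 * \<kappa> * (\<theta> ^ k * D)"
      by (rule unstable_step_bound[OF n \<epsilon>(2) diff diff])
    ultimately have "norm (G u k - G w k) \<le> 2 * \<kappa> * (\<theta> ^ k * D) + 2 * \<kappa> * (\<theta> ^ k * D)"
      by (simp only: norm_triangle_mono[OF 1 2])
    also have "\<dots> = (4 * \<kappa>) * (\<theta> ^ k * D)" by simp
    also have "\<dots> \<le> (1 / 2) * (\<theta> ^ k * D)"
      using \<kappa> D \<theta> by (intro mult_right_mono) auto
    finally show ?thesis by (simp add: mult.commute)
  qed
  have zero_in_S: "(\<lambda>_. 0) \<in> S" using \<rho> \<theta> by (simp add: S_def)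
  have G0: "norm (G (\<lambda>_. 0) k) \<le> \<theta> ^ k * (\<rho> / 2)" for k
  proof (cases k)
    case 0
    have "norm (P 0 a) \<le> \<rho> / 2" using P_bound[of 0 a] a by linarith
    then show ?thesis
      by (simp add: 0 G_def g0 linear_0[OF linear_A] QB_linear)
  next
    case (Suc j)
    then show ?thesis
      using \<rho> \<theta> by (simp add: G_def g0 linear_0[OF linear_A] QB_linear P_linear)
  qed
  have G_norm: "norm (G u k) \<le> \<rho> * \<theta> ^ k" if "u \<in> S" for u k
    using norm_triangle_sub[of "G u k" "G (\<lambda>_. 0) k"] G0[of k]
      contr[OF that zero_in_S, of \<rho> k] that by (simp add: S_def field_simps)
  obtain u where u: "u \<in> S" and fixpt: "\<And>k. u k = G u k"
    using weighted_contraction_fixpoint[of \<theta> \<rho> G] \<theta> \<rho> G_norm contr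
    unfolding S_def mem_Collect_eq by (metis less_imp_le)
  show thesis
  proof (rule that[of "u"])
    show "P 0 (u 0) = P 0 a"
      unfolding fixpt[of 0] by (simp add: G_def P_linear P_Q P_idem)
    show "norm (u k) \<le> \<rho> * \<theta> ^ k" for k
      unfolding fixpt[of k] using G_norm[OF u(1), of k] by (simp add: mult.commute)
    show "u (Suc k) = g k (u k)" for k
    proof -
      \<comment> \<open>the fixed point equations say that the defect \<open>r\<close> is invisible to both projections\<close>
      define r where "r = u (Suc k) - g k (u k)"
      have "P (Suc k) (u (Suc k)) = P (Suc k) (g k (u k))"
        unfolding fixpt[of "Suc k"] by (simp add: G_def P_linear P_Q P_idem)
      then have "P (Suc k) r = 0" by (simp add: r_def P_linear)
      moreover have "Q k (B k r) = 0"
      proof -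
        have "Q k (G u k) = Q k (B k (r + A k (u k)))"
          by (cases k) (simp_all add: G_def r_def linear_add[OF linear_Q] Q_P, simp_all add: Q_def P_linear P_idem algebra_simps)
        then have "Q k (u k) = Q k (B k r) + Q k (B k (A k (u k)))"
          unfolding fixpt[symmetric] by (simp add: QB_linear)
        then show ?thesis by (simp add: B_A)
      qed
      ultimately have "r = 0" using transversal[of k r] by (simp add: Q_def)
      then show ?thesis by (simp add: r_def)
    qed
  qed
qed

text \<open>The complementary component at time 0 is determined by the future, hence it depends on the stable
  component only with the small constant \<open>4 * \<kappa>\<close>. Replacing \<open>g\<close> by a system \<open>g'\<close> whose error is proportional
  to \<open>norm \<eta>\<close> costs a decaying error term, which is why decaying orbits move little with the base orbit.\<close>

lemma decaying_orbits_compare: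
  assumes \<rho>: "0 \<le> \<rho>" and \<sigma>: "0 \<le> \<sigma>"
    and \<epsilon>: "K * \<epsilon> \<le> \<kappa> * \<theta>" "\<beta> * \<epsilon> \<le> \<kappa>"
    and g: "\<And>k \<eta> \<eta>'. norm \<eta> \<le> \<rho> \<Longrightarrow> norm \<eta>' \<le> \<rho> \<Longrightarrow>
      norm (g k \<eta> - g k \<eta>' - A k (\<eta> - \<eta>')) \<le> \<epsilon> * norm (\<eta> - \<eta>')"
    and gg': "\<And>k \<eta>. norm \<eta> \<le> \<rho> \<Longrightarrow> norm (g k \<eta> - g' k \<eta>) \<le> \<sigma> * norm \<eta>"
    and \<eta>: "\<And>k. \<eta> (Suc k) = g k (\<eta> k)" "\<And>k. norm (\<eta> k) \<le> \<rho> * \<theta> ^ k"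
    and \<eta>': "\<And>k. \<eta>' (Suc k) = g' k (\<eta>' k)" "\<And>k. norm (\<eta>' k) \<le> \<rho> * \<theta> ^ k"
  shows "norm (Q 0 (\<eta> 0 - \<eta>' 0)) \<le> 4 * \<kappa> * norm (P 0 (\<eta> 0 - \<eta>' 0)) + 2 * (\<sigma> * \<rho> * (K / \<theta> + \<beta>))"
proof -
  define \<Delta> where "\<Delta> k = \<eta> k - \<eta>' k" for k
  \<comment> \<open>the weighted distance of the two orbits, to be estimated by itself\<close>
  define D where "D = (SUP k. norm (\<Delta> k) / \<theta> ^ k)"
  define a where "a = norm (P 0 (\<Delta> 0))"
  have bdd: "bdd_above (range (\<lambda>k. norm (\<Delta> k) / \<theta> ^ k))"
  proof (rule bdd_aboveI2)
    show "norm (\<Delta> k) / \<theta> ^ k \<le> 2 * \<rho>" for k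
      using norm_triangle_ineq4[of "\<eta> k" "\<eta>' k"] \<eta>(2)[of k] \<eta>'(2)[of k] \<theta>
      by (simp add: \<Delta>_def divide_le_eq)
  qed
  have le_D: "norm (\<Delta> k) \<le> \<theta> ^ k * D" for k
    using cSUP_upper[OF UNIV_I bdd, of k] \<theta> by (simp add: D_def divide_le_eq mult.commute)
  have small: "norm (\<eta> k) \<le> \<rho>" "norm (\<eta>' k) \<le> \<rho>" for k
  proof -
    have "\<rho> * \<theta> ^ k \<le> \<rho>" using \<rho> \<theta> by (simp add: mult_left_le power_le_one)
    then show "norm (\<eta> k) \<le> \<rho>" "norm (\<eta>' k) \<le> \<rho>" using \<eta>(2)[of k] \<eta>'(2)[of k] by linarith+
  qed
  define n where "n k = g k (\<eta> k) - g k (\<eta>' k) - A k (\<Delta> k)" for k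
  define m where "m k = g k (\<eta>' k) - g' k (\<eta>' k)" for k
  have n: "norm (n k) \<le> \<epsilon> * norm (\<Delta> k)" for k
    unfolding n_def \<Delta>_def by (intro g small)
  have m: "norm (m k) \<le> \<sigma> * \<rho> * \<theta> ^ k" for k
    using gg'[OF small(2), of k k] mult_left_mono[OF \<eta>'(2)[of k] \<sigma>] by (simp add: m_def mult.assoc)
  have \<Delta>_Suc: "\<Delta> (Suc k) = A k (\<Delta> k) + n k + m k" for k
    by (simp add: \<Delta>_def n_def m_def \<eta> \<eta>')
  have D0: "0 \<le> D" using order_trans[OF norm_ge_zero le_D[of 0]] by simp
  have P_le: "norm (P k (\<Delta> k)) \<le> \<theta> ^ k * (a + 2 * \<kappa> * D + \<sigma> * \<rho> * K / \<theta>)" for k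
  proof (cases k)
    case 0
    then show ?thesis using \<kappa> D0 \<sigma> \<rho> K \<theta> by (simp add: a_def)
  next
    case (Suc j)
    have "norm (P (Suc j) (\<Delta> (Suc j))) \<le> norm (P (Suc j) (A j (\<Delta> j) + n j)) + norm (P (Suc j) (m j))"
      unfolding \<Delta>_Suc P_linear by (rule norm_triangle_ineq)
    also have "\<dots> \<le> 2 * \<kappa> * \<theta> * norm (\<Delta> j) + K * norm (m j)"
      by (intro add_mono stable_step_bound[OF n \<epsilon>(1)] P_bound)
    also have "\<dots> \<le> 2 * \<kappa> * \<theta> * (\<theta> ^ j * D) + K * (\<sigma> * \<rho> * \<theta> ^ j)"
      using \<kappa> \<theta> K by (intro add_mono mult_left_mono le_D m) auto
    also have "\<dots> = \<theta> ^ Suc j * (2 * \<kappa> * D + \<sigma> * \<rho> * K / \<theta>)"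
      using \<theta> by (simp add: field_simps)
    also have "\<dots> \<le> \<theta> ^ Suc j * (a + 2 * \<kappa> * D + \<sigma> * \<rho> * K / \<theta>)"
      using \<theta> by (intro mult_left_mono) (auto simp: a_def)
    finally show ?thesis by (simp add: Suc)
  qed
  have Q_le: "norm (Q k (\<Delta> k)) \<le> \<theta> ^ k * (2 * \<kappa> * D + \<sigma> * \<rho> * \<beta>)" for k
  proof -
    have "Q k (\<Delta> k) = Q k (B k (A k (\<Delta> k)))" by (simp add: B_A)
    also have "A k (\<Delta> k) = (\<Delta> (Suc k) - n k) - m k" by (simp add: \<Delta>_Suc)
    finally have "norm (Q k (\<Delta> k)) \<le> norm (Q k (B k (\<Delta> (Suc k) - n k))) + norm (Q k (B k (m k)))"
      by (simp only: QB_linear(2) norm_triangle_ineq4)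
    also have "\<dots> \<le> 2 * \<kappa> * (\<theta> ^ k * D) + \<beta> * (\<sigma> * \<rho> * \<theta> ^ k)"
      by (intro add_mono unstable_step_bound[OF n \<epsilon>(2) le_D le_D]
          order_trans[OF QB_bound] mult_left_mono m \<beta>)
    finally show ?thesis by (simp add: algebra_simps)
  qed
  have "D \<le> a + 4 * \<kappa> * D + \<sigma> * \<rho> * (K / \<theta> + \<beta>)"
    unfolding D_def
  proof (rule cSUP_least)
    fix k
    have "\<Delta> k = P k (\<Delta> k) + Q k (\<Delta> k)" by (simp add: Q_def)
    then have "norm (\<Delta> k) \<le> norm (P k (\<Delta> k)) + norm (Q k (\<Delta> k))"
      by (metis norm_triangle_ineq)
    also have "\<dots> \<le> \<theta> ^ k * (a + 4 * \<kappa> * D + \<sigma> * \<rho> * (K / \<theta> + \<beta>))"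
      using add_mono[OF P_le Q_le, of k k] by (simp add: algebra_simps)
    finally show "norm (\<Delta> k) / \<theta> ^ k \<le> a + 4 * \<kappa> * (SUP k. norm (\<Delta> k) / \<theta> ^ k) + \<sigma> * \<rho> * (K / \<theta> + \<beta>)"
      using \<theta> by (simp add: divide_le_eq mult.commute D_def)
  qed simp
  define S where "S = \<sigma> * \<rho> * (K / \<theta> + \<beta>)"
  have "4 * \<kappa> * D \<le> D / 2" using mult_right_mono[OF \<kappa>(2) D0] by simp
  then have "D \<le> 2 * a + 2 * S" using \<open>D \<le> a + _ + _\<close> by (simp add: S_def)
  then have "2 * \<kappa> * D \<le> 2 * \<kappa> * (2 * a + 2 * S)" using \<kappa> by (intro mult_left_mono) auto
  moreover have "4 * \<kappa> * S \<le> S / 2"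
  proof -
    have "0 \<le> S" using \<sigma> \<rho> K \<theta> \<beta> by (simp add: S_def)
    then show ?thesis using mult_right_mono[OF \<kappa>(2), of S] by simp
  qed
  moreover have "\<sigma> * \<rho> * \<beta> \<le> S"
    unfolding S_def using \<sigma> \<rho> K \<theta> by (intro mult_left_mono) auto
  moreover have "0 \<le> \<sigma> * \<rho> * \<beta>" using \<sigma> \<rho> \<beta> by simp
  ultimately have "norm (Q 0 (\<Delta> 0)) \<le> 4 * \<kappa> * a + 2 * S"
    using Q_le[of 0] by (simp add: algebra_simps)
  then show ?thesis by (simp add: \<Delta>_def a_def S_def)
qed

end

section \<open>The linearised flow along the invariant set\<close>

lemma direct_sum3_commute:
  assumes "direct_sum3 A B C"
  shows "direct_sum3 B A C"
  unfolding direct_sum3_def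
proof
  fix w
  from assms have *: "\<exists>!(a, b, c). a \<in> A \<and> b \<in> B \<and> c \<in> C \<and> w = a + b + c"
    by (simp add: direct_sum3_def)
  then obtain a b c where abc: "a \<in> A" "b \<in> B" "c \<in> C" "w = a + b + c" by auto
  show "\<exists>!(a, b, c). a \<in> B \<and> b \<in> A \<and> c \<in> C \<and> w = a + b + c"
  proof (rule ex1I[of _ "(b, a, c)"])
    show "case (b, a, c) of (a, b, c) \<Rightarrow> a \<in> B \<and> b \<in> A \<and> c \<in> C \<and> w = a + b + c"
      using abc by (simp add: add.commute)
    fix t assume t: "case t of (a, b, c) \<Rightarrow> a \<in> B \<and> b \<in> A \<and> c \<in> C \<and> w = a + b + c"
    obtain b' a' c' where t': "t = (b', a', c')" by (cases t)
    have "case (a', b', c') of (a, b, c) \<Rightarrow> a \<in> A \<and> b \<in> B \<and> c \<in> C \<and> w = a + b + c"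
      using t by (simp add: t' add.commute)
    moreover have "case (a, b, c) of (a, b, c) \<Rightarrow> a \<in> A \<and> b \<in> B \<and> c \<in> C \<and> w = a + b + c"
      using abc by simp
    ultimately have "(a', b', c') = (a, b, c)" using * by (metis (mono_tags, lifting) Ex1_def)
    then show "t = (b, a, c)" by (simp add: t')
  qed
qed

text \<open>The hypotheses on the two planes are symmetric under time reversal, which exchanges \<open>Es\<close> and \<open>Eu\<close>. Every
  statement about stable directions therefore has an unstable counterpart by
  \<open>reversed_hyperbolic_flow\<close>.\<close>

locale hyperbolic_flow = C2_flow v \<Phi>
  for v :: "'a::euclidean_space \<Rightarrow> 'a" and \<Phi> :: "real \<Rightarrow> 'a \<Rightarrow> 'a" +
  fixes M :: "'a set" and Es Eu :: "'a \<Rightarrow> 'a set" and c \<alpha> :: real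
  assumes compact_M: "compact M" and inv: "invariant_set \<Phi> M"
    and v_nonzero: "x \<in> M \<Longrightarrow> v x \<noteq> 0"
    and subspaces: "x \<in> M \<Longrightarrow> subspace (Es x)" "x \<in> M \<Longrightarrow> subspace (Eu x)"
    and splitting: "x \<in> M \<Longrightarrow> direct_sum3 (Es x) (Eu x) (range (\<lambda>l. l *\<^sub>R v x))"
    and Es_invariant: "x \<in> M \<Longrightarrow> \<eta> \<in> Es x \<Longrightarrow> flow_derivative \<Phi> t x \<eta> \<in> Es (\<Phi> t x)"
    and Eu_invariant: "x \<in> M \<Longrightarrow> \<eta> \<in> Eu x \<Longrightarrow> flow_derivative \<Phi> t x \<eta> \<in> Eu (\<Phi> t x)"
    and c: "1 \<le> c" and \<alpha>: "0 < \<alpha>"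
    and Es_contracts: "x \<in> M \<Longrightarrow> \<eta> \<in> Es x \<Longrightarrow> 0 \<le> t \<Longrightarrow>
      norm (flow_derivative \<Phi> t x \<eta>) \<le> c * exp (- \<alpha> * t) * norm \<eta>"
    and Eu_contracts: "x \<in> M \<Longrightarrow> \<eta> \<in> Eu x \<Longrightarrow> t \<le> 0 \<Longrightarrow>
      norm (flow_derivative \<Phi> t x \<eta>) \<le> c * exp (\<alpha> * t) * norm \<eta>"
begin

abbreviation X :: "real \<Rightarrow> 'a \<Rightarrow> 'a \<Rightarrow> 'a" where "X \<equiv> flow_derivative \<Phi>"

abbreviation Ec :: "'a \<Rightarrow> 'a set" where "Ec x \<equiv> range (\<lambda>l. l *\<^sub>R v x)"

lemma flow_in_M: "x \<in> M \<Longrightarrow> \<Phi> t x \<in> M"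
  using inv unfolding invariant_set_def by blast

lemma reversed_hyperbolic_flow: "hyperbolic_flow (\<lambda>x. - v x) (\<lambda>t. \<Phi> (- t)) M Eu Es c \<alpha>"
proof -
  interpret rev: C2_flow "\<lambda>x. - v x" "\<lambda>t. \<Phi> (- t)" by (rule reversed_flow)
  have D: "flow_derivative (\<lambda>t. \<Phi> (- t)) t x = X (- t) x" for t x
    by (simp add: flow_derivative_def)
  show ?thesis
  proof
    show "invariant_set (\<lambda>t. \<Phi> (- t)) M" using inv by (simp add: invariant_set_def)
    fix x assume x: "x \<in> M"
    show "direct_sum3 (Eu x) (Es x) (range (\<lambda>l. l *\<^sub>R - v x))"
    proof -
      have "range (\<lambda>l. l *\<^sub>R - v x) = Ec x"
      proof (intro set_eqI iffI)
        show "d \<in> Ec x" if "d \<in> range (\<lambda>l. l *\<^sub>R - v x)" for d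
        proof -
          obtain l where "d = (- l) *\<^sub>R v x" using \<open>d \<in> _\<close> by auto
          then show ?thesis by blast
        qed
        show "d \<in> range (\<lambda>l. l *\<^sub>R - v x)" if "d \<in> Ec x" for d
        proof -
          obtain l where "d = (- l) *\<^sub>R - v x" using \<open>d \<in> _\<close> by auto
          then show ?thesis by blast
        qed
      qed
      moreover have "direct_sum3 (Eu x) (Es x) (Ec x)"
        by (rule direct_sum3_commute[OF splitting[OF x]])
      ultimately show ?thesis by simp
    qed
  qed (use compact_M v_nonzero subspaces Es_invariant Eu_invariant c \<alpha>
      Es_contracts Eu_contracts[of _ _ "- _"] Es_contracts[of _ _ "- _"] in \<open>auto simp: D\<close>)
qed

lemma flow_derivative_estimates:
  obtains \<delta> L where "0 < \<delta>" "0 \<le> L"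
    "\<And>x a b. x \<in> M \<Longrightarrow> {a, b} \<subseteq> ball x \<delta> \<Longrightarrow> norm (\<Phi> t a - \<Phi> t b) \<le> L * norm (a - b)"
    "\<And>x a b a' b'. x \<in> M \<Longrightarrow> {a, b, a', b'} \<subseteq> ball x \<delta> \<Longrightarrow> a - b = a' - b' \<Longrightarrow>
      norm (\<Phi> t a - \<Phi> t b - (\<Phi> t a' - \<Phi> t b')) \<le> L * (norm (a - b) * norm (b - b'))"
    "\<And>x. x \<in> M \<Longrightarrow> (\<Phi> t has_derivative X t x) (at x)"
    "\<And>x \<eta>. x \<in> M \<Longrightarrow> norm (X t x \<eta>) \<le> L * norm \<eta>"
    "\<And>x \<eta>. x \<in> M \<Longrightarrow> norm \<eta> < \<delta> \<Longrightarrow> norm (\<Phi> t (x + \<eta>) - \<Phi> t x - X t x \<eta>) \<le> L * (norm \<eta>)\<^sup>2"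
proof -
  have t: "t \<in> {- \<bar>t\<bar>..\<bar>t\<bar>}" by auto
  obtain \<delta> L where \<delta>: "0 < \<delta>" "0 \<le> L"
    and lip: "\<And>x s a b. x \<in> M \<Longrightarrow> s \<in> {- \<bar>t\<bar>..\<bar>t\<bar>} \<Longrightarrow> {a, b} \<subseteq> ball x \<delta> \<Longrightarrow>
      norm (\<Phi> s a - \<Phi> s b) \<le> L * norm (a - b)"
    and snd: "\<And>x s a b a' b'. x \<in> M \<Longrightarrow> s \<in> {- \<bar>t\<bar>..\<bar>t\<bar>} \<Longrightarrow> {a, b, a', b'} \<subseteq> ball x \<delta> \<Longrightarrow>
      a - b = a' - b' \<Longrightarrow>
      norm (\<Phi> s a - \<Phi> s b - (\<Phi> s a' - \<Phi> s b')) \<le> L * (norm (a - b) * norm (b - b'))"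
    using flow_estimates[OF compact_M inv] by blast
  note * = \<delta> lip[OF _ t] snd[OF _ t]
  have der: "(\<Phi> t has_derivative X t x) (at x) \<and> (\<forall>\<eta>. norm (X t x \<eta>) \<le> L * norm \<eta>) \<and>
     (\<forall>\<eta>. norm \<eta> < \<delta> \<longrightarrow> norm (\<Phi> t (x + \<eta>) - \<Phi> t x - X t x \<eta>) \<le> L * (norm \<eta>)\<^sup>2)" if x: "x \<in> M" for x
  proof -
    have "\<exists>Y. (\<Phi> t has_derivative Y) (at x) \<and> (\<forall>\<eta>. norm (Y \<eta>) \<le> L * norm \<eta>) \<and>
      (\<forall>\<eta>. norm \<eta> < \<delta> \<longrightarrow> norm (\<Phi> t (x + \<eta>) - \<Phi> t x - Y \<eta>) \<le> L * (norm \<eta>)\<^sup>2)"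
    proof (rule second_difference_imp_derivative[where f = "\<Phi> t" and x = x, OF \<delta>])
      show "norm (\<Phi> t a - \<Phi> t b) \<le> L * norm (a - b)" if "{a, b} \<subseteq> ball x \<delta>" for a b
        by (rule lip[OF x t that])
      show "norm (\<Phi> t a - \<Phi> t b - (\<Phi> t a' - \<Phi> t b')) \<le> L * (norm (a - b) * norm (b - b'))"
        if "{a, b, a', b'} \<subseteq> ball x \<delta>" "a - b = a' - b'" for a b a' b'
        by (rule snd[OF x t that])
    qed blast
    then obtain Y where Y: "(\<Phi> t has_derivative Y) (at x)" "\<And>\<eta>. norm (Y \<eta>) \<le> L * norm \<eta>"
      "\<And>\<eta>. norm \<eta> < \<delta> \<Longrightarrow> norm (\<Phi> t (x + \<eta>) - \<Phi> t x - Y \<eta>) \<le> L * (norm \<eta>)\<^sup>2"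
      by blast
    have "X t x = Y" unfolding flow_derivative_def by (rule frechet_derivative_at[OF Y(1), symmetric])
    then show ?thesis using Y by simp
  qed
  show thesis by (rule that[OF *]) (use der in auto)
qed

lemma X_has_derivative: "x \<in> M \<Longrightarrow> (\<Phi> t has_derivative X t x) (at x)"
  using flow_derivative_estimates[of t] by blast

lemma linear_X: "x \<in> M \<Longrightarrow> linear (X t x)"
  using X_has_derivative has_derivative_linear by blast

lemma X_add: "x \<in> M \<Longrightarrow> X (s + t) x w = X s (\<Phi> t x) (X t x w)"
proof -
  assume x: "x \<in> M"
  have "\<Phi> (s + t) = (\<lambda>y. \<Phi> s (\<Phi> t y))" by (simp add: fun_eq_iff flow_add)
  have "((\<lambda>y. \<Phi> s (\<Phi> t y)) has_derivative (\<lambda>w. X s (\<Phi> t x) (X t x w))) (at x)"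
    by (rule has_derivative_compose[OF X_has_derivative[OF x] X_has_derivative[OF flow_in_M[OF x]]])
  then have "(\<Phi> (s + t) has_derivative (\<lambda>w. X s (\<Phi> t x) (X t x w))) (at x)"
    by (simp add: \<open>\<Phi> (s + t) = _\<close>)
  from has_derivative_unique[OF this X_has_derivative[OF x]] show ?thesis by metis
qed

lemma X_zero: "x \<in> M \<Longrightarrow> X 0 x w = w"
proof -
  assume x: "x \<in> M"
  have "\<Phi> 0 = (\<lambda>x. x)" by (simp add: fun_eq_iff)
  then have "(\<Phi> 0 has_derivative (\<lambda>w. w)) (at x)" by simp
  from has_derivative_unique[OF this X_has_derivative[OF x]] show ?thesis by metis
qed

lemma X_inverse: "x \<in> M \<Longrightarrow> X (- t) (\<Phi> t x) (X t x w) = w"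
  using X_add[of x "- t" t w] X_zero by simp

lemma X_v: "x \<in> M \<Longrightarrow> X t x (v x) = v (\<Phi> t x)"
proof -
  assume x: "x \<in> M"
  have 1: "((\<lambda>s. \<Phi> t (\<Phi> s x)) has_vector_derivative X t x (v x)) (at 0)"
    using has_derivative_compose[of "\<lambda>s. \<Phi> s x" "\<lambda>h. h *\<^sub>R v x" 0 UNIV "\<Phi> t" "X t x"]
      X_has_derivative[OF x] flow_has_vector_derivative[of x 0] linear_scale[OF linear_X[OF x]]
    by (simp add: has_vector_derivative_def)
  have comm: "\<Phi> t (\<Phi> s x) = \<Phi> s (\<Phi> t x)" for s by (metis add.commute flow_add)
  have "((\<lambda>s. \<Phi> s (\<Phi> t x)) has_vector_derivative v (\<Phi> t x)) (at 0)"
    using flow_has_vector_derivative[of "\<Phi> t x" 0] by simp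
  with 1 show ?thesis unfolding comm by (rule vector_derivative_unique_at)
qed

text \<open>Divide the second-difference bound by the length of the increment and let that length tend to 0.\<close>

lemma X_diff_bound:
  assumes "0 < \<delta>" "0 \<le> L" and x: "x \<in> M" and y: "y \<in> M" "y \<in> ball x \<delta>"
    and snd: "\<And>a b a' b'. {a, b, a', b'} \<subseteq> ball x \<delta> \<Longrightarrow> a - b = a' - b' \<Longrightarrow>
      norm (\<Phi> t a - \<Phi> t b - (\<Phi> t a' - \<Phi> t b')) \<le> L * (norm (a - b) * norm (b - b'))"
    and rem: "\<And>z \<eta>. z \<in> M \<Longrightarrow> norm \<eta> < \<delta> \<Longrightarrow> norm (\<Phi> t (z + \<eta>) - \<Phi> t z - X t z \<eta>) \<le> L * (norm \<eta>)\<^sup>2"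
  shows "norm (X t x w - X t y w) \<le> L * (norm w * norm (x - y))"
proof -
  define B where "B = L * (norm w * norm (x - y))"
  have "norm (X t x w - X t y w) \<le> B + 0 * (2 * L * (norm w)\<^sup>2)"
  proof (rule tendsto_lowerbound)
    show "((\<lambda>h. B + h * (2 * L * (norm w)\<^sup>2)) \<longlongrightarrow> B + 0 * (2 * L * (norm w)\<^sup>2)) (at_right 0)"
      by (intro tendsto_intros)
    have "\<forall>\<^sub>F h in at_right 0. (0 :: real) < h" by (simp add: eventually_at_right_less)
    moreover have "\<forall>\<^sub>F h in at_right 0. h * norm w < \<delta> - dist x y"
    proof -
      have "((\<lambda>h. h * norm w) \<longlongrightarrow> 0 * norm w) (at_right 0)" by (intro tendsto_intros)
      then show ?thesis using y(2) by (intro order_tendstoD(2)) auto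
    qed
    ultimately show "\<forall>\<^sub>F h in at_right 0. norm (X t x w - X t y w) \<le> B + h * (2 * L * (norm w)\<^sup>2)"
    proof eventually_elim
      case (elim h)
      have h: "norm (h *\<^sub>R w) = h * norm w" using elim by simp
      have hw: "norm (h *\<^sub>R w) < \<delta>" using h elim zero_le_dist[of x y] by linarith
      have "dist x (y + h *\<^sub>R w) \<le> dist x y + h * norm w"
        using norm_triangle_ineq4[of "x - y" "h *\<^sub>R w"] unfolding h by (simp add: dist_norm diff_diff_eq)
      moreover have "dist x (x + h *\<^sub>R w) = h * norm w" using h by (simp add: dist_norm)
      ultimately have "{x + h *\<^sub>R w, x, y + h *\<^sub>R w, y} \<subseteq> ball x \<delta>"
        using elim y(2) \<open>0 < \<delta>\<close> hw[unfolded h] unfolding insert_subset mem_ball dist_self by auto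
      from snd[OF this]
      have 1: "norm (\<Phi> t (x + h *\<^sub>R w) - \<Phi> t x - (\<Phi> t (y + h *\<^sub>R w) - \<Phi> t y)) \<le> h * B"
        unfolding B_def using elim by (simp add: mult_ac)
      define e where "e z = \<Phi> t (z + h *\<^sub>R w) - \<Phi> t z - h *\<^sub>R X t z w" for z
      have 2: "norm (e z) \<le> L * (h * norm w)\<^sup>2" if "z \<in> M" for z
        using rem[OF that hw] unfolding h by (simp add: e_def linear_scale[OF linear_X[OF that]])
      have "h *\<^sub>R (X t x w - X t y w) =
          (\<Phi> t (x + h *\<^sub>R w) - \<Phi> t x - (\<Phi> t (y + h *\<^sub>R w) - \<Phi> t y)) - (e x - e y)"
        by (simp add: e_def algebra_simps)
      then have "norm (h *\<^sub>R (X t x w - X t y w)) \<le> h * B + (L * (h * norm w)\<^sup>2 + L * (h * norm w)\<^sup>2)"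
        using norm_triangle_ineq4[of "\<Phi> t (x + h *\<^sub>R w) - \<Phi> t x - (\<Phi> t (y + h *\<^sub>R w) - \<Phi> t y)" "e x - e y"]
          norm_triangle_ineq4[of "e x" "e y"] 1 2[OF x] 2[OF y(1)] by (smt (verit))
      then have "h * norm (X t x w - X t y w) \<le> h * (B + h * (2 * L * (norm w)\<^sup>2))"
        using elim by (simp only: norm_scaleR abs_of_pos) (simp add: power2_eq_square distrib_left mult_ac)
      then show ?case using elim by simp
    qed
  qed simp
  then show ?thesis by (simp add: B_def)
qed

lemma X_tendsto:
  assumes xn: "\<And>n. xs n \<in> M" "xs \<longlonglongrightarrow> x" "x \<in> M" and a: "as \<longlonglongrightarrow> a"
  shows "(\<lambda>n. X t (xs n) (as n)) \<longlonglongrightarrow> X t x a"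
proof -
  obtain \<delta> L where \<delta>: "0 < \<delta>" "0 \<le> L"
    and "\<And>x a b. x \<in> M \<Longrightarrow> {a, b} \<subseteq> ball x \<delta> \<Longrightarrow> norm (\<Phi> t a - \<Phi> t b) \<le> L * norm (a - b)"
    and snd: "\<And>x a b a' b'. x \<in> M \<Longrightarrow> {a, b, a', b'} \<subseteq> ball x \<delta> \<Longrightarrow> a - b = a' - b' \<Longrightarrow>
      norm (\<Phi> t a - \<Phi> t b - (\<Phi> t a' - \<Phi> t b')) \<le> L * (norm (a - b) * norm (b - b'))"
    and "\<And>x. x \<in> M \<Longrightarrow> (\<Phi> t has_derivative X t x) (at x)"
    and bnd: "\<And>x \<eta>. x \<in> M \<Longrightarrow> norm (X t x \<eta>) \<le> L * norm \<eta>"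
    and rem: "\<And>x \<eta>. x \<in> M \<Longrightarrow> norm \<eta> < \<delta> \<Longrightarrow> norm (\<Phi> t (x + \<eta>) - \<Phi> t x - X t x \<eta>) \<le> L * (norm \<eta>)\<^sup>2"
    by (rule flow_derivative_estimates[of t]) (rule that)
  have "(\<lambda>n. X t (xs n) (as n) - X t x a) \<longlonglongrightarrow> 0"
  proof (rule Lim_null_comparison)
    have "(\<lambda>n. L * norm (as n - a) + L * (norm a * norm (x - xs n))) \<longlonglongrightarrow> L * norm (a - a) + L * (norm a * norm (x - x))"
      by (intro tendsto_intros xn a)
    then show "(\<lambda>n. L * norm (as n - a) + L * (norm a * norm (x - xs n))) \<longlonglongrightarrow> 0" by simp
    have "\<forall>\<^sub>F n in sequentially. xs n \<in> ball x \<delta>"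
      using tendstoD[OF xn(2) \<delta>(1)] by eventually_elim (simp add: dist_commute)
    then show "\<forall>\<^sub>F n in sequentially. norm (X t (xs n) (as n) - X t x a)
        \<le> L * norm (as n - a) + L * (norm a * norm (x - xs n))"
    proof eventually_elim
      case (elim n)
      have "X t (xs n) (as n) - X t x a = X t (xs n) (as n - a) - (X t x a - X t (xs n) a)"
        by (simp add: linear_diff[OF linear_X[OF xn(1)]])
      then have "norm (X t (xs n) (as n) - X t x a) \<le> norm (X t (xs n) (as n - a)) + norm (X t x a - X t (xs n) a)"
        by (simp only: norm_triangle_ineq4)
      also have "\<dots> \<le> L * norm (as n - a) + L * (norm a * norm (x - xs n))"
        by (rule add_mono[OF bnd[OF xn(1)] X_diff_bound[OF \<delta> xn(3) xn(1) elim snd[OF xn(3)] rem]])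
      finally show ?case .
    qed
  qed
  then show ?thesis by (rule LIM_zero_cancel)
qed

end

section \<open>The splitting and its projections\<close>

text \<open>At \<open>t = C / (r * \<alpha>)\<close> the inequality \<open>1 + \<alpha> * t \<le> exp (\<alpha> * t)\<close> already contradicts \<open>r > 0\<close>.\<close>

lemma nonpos_if_exp_decay:
  fixes r C \<alpha> :: real
  assumes \<alpha>: "0 < \<alpha>" and bound: "\<And>t. 0 \<le> t \<Longrightarrow> r \<le> C * exp (- \<alpha> * t)"
  shows "r \<le> 0"
proof (rule ccontr)
  assume "\<not> r \<le> 0"
  then have r: "0 < r" by simp
  have "r \<le> C" using bound[of 0] by simp
  define t where "t = C / (r * \<alpha>)"
  have t: "0 \<le> t" using r \<alpha> \<open>r \<le> C\<close> by (simp add: t_def)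
  have "r + C = r * (1 + \<alpha> * t)" using r \<alpha> by (simp add: t_def field_simps)
  also have "\<dots> \<le> r * exp (\<alpha> * t)" using r by (intro mult_left_mono exp_ge_add_one_self) auto
  also have "\<dots> \<le> C" using bound[OF t] by (simp add: exp_minus field_simps)
  finally show False using r by simp
qed

context hyperbolic_flow
begin

lemma speed_bounds:
  obtains m V where "0 < m" "0 \<le> V" "\<And>x. x \<in> M \<Longrightarrow> m \<le> norm (v x)" "\<And>x. x \<in> M \<Longrightarrow> norm (v x) \<le> V"
proof (cases "M = {}")
  case True
  then show ?thesis using that[of 1 0] by simp
next
  case False
  have cont: "continuous_on M (\<lambda>x. norm (v x))" by (intro continuous_intros continuous_on_v)
  obtain y z where "y \<in> M" "\<And>x. x \<in> M \<Longrightarrow> norm (v y) \<le> norm (v x)"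
    "z \<in> M" "\<And>x. x \<in> M \<Longrightarrow> norm (v x) \<le> norm (v z)"
    using continuous_attains_inf[OF compact_M False cont] continuous_attains_sup[OF compact_M False cont] by blast
  then show ?thesis using that[of "norm (v y)" "norm (v z)"] v_nonzero by simp
qed

text \<open>A vector that decays can have neither an unstable component, which would grow, nor a component along
  the flow, whose length stays comparable to the speed. This describes the stable planes by closed
  conditions on the continuous cocycle \<open>X\<close>, so their graph over \<open>M\<close> is closed.\<close>

lemma Es_iff:
  assumes x: "x \<in> M"
  shows "a \<in> Es x \<longleftrightarrow> (\<forall>t\<ge>0. norm (X t x a) \<le> c * exp (- \<alpha> * t) * norm a)"
proof
  show "a \<in> Es x \<Longrightarrow> \<forall>t\<ge>0. norm (X t x a) \<le> c * exp (- \<alpha> * t) * norm a"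
    using Es_contracts[OF x] by blast
next
  assume decay: "\<forall>t\<ge>0. norm (X t x a) \<le> c * exp (- \<alpha> * t) * norm a"
  obtain s u l where sul: "s \<in> Es x" "u \<in> Eu x" "a = s + u + l *\<^sub>R v x"
    using splitting[OF x] unfolding direct_sum3_def by blast
  obtain m V where mV: "0 < m" "0 \<le> V" "\<And>x. x \<in> M \<Longrightarrow> m \<le> norm (v x)" "\<And>x. x \<in> M \<Longrightarrow> norm (v x) \<le> V"
    by (rule speed_bounds) (rule that)
  have Xa: "X t x a = X t x s + X t x u + l *\<^sub>R v (\<Phi> t x)" for t
    using linear_X[OF x] X_v[OF x] by (simp add: sul linear_add linear_scale)
  define N where "N = c * norm a + c * norm s"
  have as: "norm (X t x a - X t x s) \<le> N * exp (- \<alpha> * t)" if "0 \<le> t" for t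
    using norm_triangle_ineq4[of "X t x a" "X t x s"] decay[rule_format, OF that] Es_contracts[OF x sul(1) that]
    by (simp add: N_def algebra_simps)
  have "norm u \<le> (c * (N + \<bar>l\<bar> * V)) * exp (- \<alpha> * t)" if t: "0 \<le> t" for t
  proof -
    have "X t x u = (X t x a - X t x s) - l *\<^sub>R v (\<Phi> t x)" by (simp add: Xa)
    then have "norm (X t x u) \<le> norm (X t x a - X t x s) + norm (l *\<^sub>R v (\<Phi> t x))"
      by (simp only: norm_triangle_ineq4)
    also have "\<dots> \<le> N * exp (- \<alpha> * t) + \<bar>l\<bar> * V"
      using as[OF t] mV(4)[OF flow_in_M[OF x]] by (intro add_mono) (auto intro!: mult_left_mono)
    also have "\<dots> \<le> N * 1 + \<bar>l\<bar> * V"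
      using t \<alpha> c by (intro add_mono mult_left_mono order_refl) (auto simp: N_def)
    finally have Xu: "norm (X t x u) \<le> N + \<bar>l\<bar> * V" by simp
    have "norm u = norm (X (- t) (\<Phi> t x) (X t x u))" by (simp add: X_inverse[OF x])
    also have "\<dots> \<le> c * exp (\<alpha> * (- t)) * norm (X t x u)"
      using t by (intro Eu_contracts flow_in_M[OF x] Eu_invariant[OF x sul(2)]) auto
    also have "\<dots> \<le> c * exp (\<alpha> * (- t)) * (N + \<bar>l\<bar> * V)"
      using c by (intro mult_left_mono Xu) auto
    finally show ?thesis by (simp add: mult_ac)
  qed
  from nonpos_if_exp_decay[OF \<alpha> this] have u0: "u = 0" by simp
  have "\<bar>l\<bar> * m \<le> N * exp (- \<alpha> * t)" if t: "0 \<le> t" for t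
  proof -
    have "\<bar>l\<bar> * m \<le> \<bar>l\<bar> * norm (v (\<Phi> t x))" by (intro mult_left_mono mV(3) flow_in_M x) auto
    also have "\<dots> = norm (X t x a - X t x s)" using u0 linear_0[OF linear_X[OF x]] by (simp add: Xa)
    finally show ?thesis using as[OF t] by linarith
  qed
  from nonpos_if_exp_decay[OF \<alpha> this] have "l = 0" using mV(1) by (simp add: mult_le_0_iff)
  then show "a \<in> Es x" using sul u0 by simp
qed

lemma Es_closed:
  assumes "\<And>n. xs n \<in> M" "xs \<longlonglongrightarrow> x" "x \<in> M" and "\<And>n. as n \<in> Es (xs n)" "as \<longlonglongrightarrow> a"
  shows "a \<in> Es x"
  unfolding Es_iff[OF assms(3)]
proof (intro allI impI)
  fix t :: real assume t: "0 \<le> t"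
  show "norm (X t x a) \<le> c * exp (- \<alpha> * t) * norm a"
  proof (rule tendsto_le[OF sequentially_bot])
    show "(\<lambda>n. norm (X t (xs n) (as n))) \<longlonglongrightarrow> norm (X t x a)"
      by (intro tendsto_norm X_tendsto assms)
    show "(\<lambda>n. c * exp (- \<alpha> * t) * norm (as n)) \<longlonglongrightarrow> c * exp (- \<alpha> * t) * norm a"
      by (intro tendsto_intros assms)
    show "\<forall>\<^sub>F n in sequentially. norm (X t (xs n) (as n)) \<le> c * exp (- \<alpha> * t) * norm (as n)"
      using Es_contracts[OF assms(1,4) t] by simp
  qed
qed

lemmas Eu_closed = hyperbolic_flow.Es_closed[OF reversed_hyperbolic_flow]

text \<open>The equation says that \<open>d\<close> is its own orthogonal projection to the line spanned by \<open>v x\<close>, and it is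
  visibly closed in \<open>(x, d)\<close>.\<close>

lemma Ec_iff: "x \<in> M \<Longrightarrow> d \<in> Ec x \<longleftrightarrow> (norm (v x))\<^sup>2 *\<^sub>R d = (d \<bullet> v x) *\<^sub>R v x"
proof
  assume "x \<in> M" "(norm (v x))\<^sup>2 *\<^sub>R d = (d \<bullet> v x) *\<^sub>R v x"
  then have "d = ((d \<bullet> v x) / (norm (v x))\<^sup>2) *\<^sub>R v x"
    using v_nonzero[of x] by (metis (no_types) divide_inverse_commute norm_eq_zero power_not_zero real_vector_eq_affinity scaleR_scaleR left_inverse scaleR_one)
  then show "d \<in> Ec x" by blast
qed (auto simp: power2_norm_eq_inner)

lemma Ec_closed:
  assumes "\<And>n. xs n \<in> M" "xs \<longlonglongrightarrow> x" "x \<in> M" and "\<And>n. ds n \<in> Ec (xs n)" "ds \<longlonglongrightarrow> d"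
  shows "d \<in> Ec x"
proof -
  have v: "(\<lambda>n. v (xs n)) \<longlonglongrightarrow> v x"
    using continuous_on_v[of UNIV] assms(2) by (auto simp: continuous_on_eq_continuous_at isCont_tendsto_compose)
  have "(norm (v (xs n)))\<^sup>2 *\<^sub>R ds n = (ds n \<bullet> v (xs n)) *\<^sub>R v (xs n)" for n
    using Ec_iff[OF assms(1)] assms(4) by blast
  moreover have "(\<lambda>n. (norm (v (xs n)))\<^sup>2 *\<^sub>R ds n) \<longlonglongrightarrow> (norm (v x))\<^sup>2 *\<^sub>R d"
    "(\<lambda>n. (ds n \<bullet> v (xs n)) *\<^sub>R v (xs n)) \<longlonglongrightarrow> (d \<bullet> v x) *\<^sub>R v x"
    by (intro tendsto_intros v assms)+
  ultimately have "(norm (v x))\<^sup>2 *\<^sub>R d = (d \<bullet> v x) *\<^sub>R v x" by (simp add: LIMSEQ_unique)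
  then show ?thesis using Ec_iff[OF assms(3)] by blast
qed

definition components :: "'a \<Rightarrow> 'a \<Rightarrow> 'a \<times> 'a \<times> 'a" where
  "components x w = (THE (a, b, d). a \<in> Es x \<and> b \<in> Eu x \<and> d \<in> Ec x \<and> w = a + b + d)"

definition Ps :: "'a \<Rightarrow> 'a \<Rightarrow> 'a" where "Ps x w = fst (components x w)"

lemma components_eq_iff:
  assumes x: "x \<in> M"
  shows "components x w = (a, b, d) \<longleftrightarrow> a \<in> Es x \<and> b \<in> Eu x \<and> d \<in> Ec x \<and> w = a + b + d"
proof -
  have ex1: "\<exists>!t. case t of (a, b, d) \<Rightarrow> a \<in> Es x \<and> b \<in> Eu x \<and> d \<in> Ec x \<and> w = a + b + d"
    by (rule spec[OF splitting[OF x, unfolded direct_sum3_def]])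
  show ?thesis
  proof
    assume "components x w = (a, b, d)"
    with theI'[OF ex1] show "a \<in> Es x \<and> b \<in> Eu x \<and> d \<in> Ec x \<and> w = a + b + d"
      unfolding components_def[symmetric] by (simp only: prod.case)
  next
    assume "a \<in> Es x \<and> b \<in> Eu x \<and> d \<in> Ec x \<and> w = a + b + d"
    then show "components x w = (a, b, d)"
      unfolding components_def by (intro the1_equality[OF ex1]) (simp only: prod.case)
  qed
qed

lemma Ps_eq: "x \<in> M \<Longrightarrow> a \<in> Es x \<Longrightarrow> b \<in> Eu x \<Longrightarrow> Ps x (a + b + l *\<^sub>R v x) = a"
  using components_eq_iff[of x "a + b + l *\<^sub>R v x" a b "l *\<^sub>R v x"]
    rangeI[of "\<lambda>l. l *\<^sub>R v x" l] by (simp add: Ps_def)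

lemma decompose:
  assumes "x \<in> M"
  obtains b l where "Ps x w \<in> Es x" "b \<in> Eu x" "w = Ps x w + b + l *\<^sub>R v x"
proof -
  obtain a b d where abd: "components x w = (a, b, d)" by (cases "components x w")
  then have "a \<in> Es x \<and> b \<in> Eu x \<and> d \<in> Ec x \<and> w = a + b + d"
    using components_eq_iff[OF assms] by blast
  moreover from this obtain l where "d = l *\<^sub>R v x" by blast
  ultimately show thesis using that[of b l] abd by (simp add: Ps_def)
qed

lemma Ps_in_Es: "x \<in> M \<Longrightarrow> Ps x w \<in> Es x"
  by (rule decompose)

lemma Ps_on_Es: "x \<in> M \<Longrightarrow> a \<in> Es x \<Longrightarrow> Ps x a = a"
  using Ps_eq[of x a 0 0] subspaces(2)[of x] by (simp add: subspace_0)

lemma Ps_idem: "x \<in> M \<Longrightarrow> Ps x (Ps x w) = Ps x w"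
  by (simp add: Ps_in_Es Ps_on_Es)

lemma linear_Ps:
  assumes x: "x \<in> M"
  shows "linear (Ps x)"
proof (rule linearI)
  fix w w' :: 'a and r :: real
  obtain b l where 1: "Ps x w \<in> Es x" "b \<in> Eu x" "w = Ps x w + b + l *\<^sub>R v x"
    by (rule decompose[OF x])
  obtain b' l' where 2: "Ps x w' \<in> Es x" "b' \<in> Eu x" "w' = Ps x w' + b' + l' *\<^sub>R v x"
    by (rule decompose[OF x])
  have "w + w' = (Ps x w + b + l *\<^sub>R v x) + (Ps x w' + b' + l' *\<^sub>R v x)"
    by (rule arg_cong2[OF 1(3) 2(3), of "(+)"])
  also have "\<dots> = (Ps x w + Ps x w') + (b + b') + (l + l') *\<^sub>R v x"
    by (simp add: algebra_simps)
  finally show "Ps x (w + w') = Ps x w + Ps x w'"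
    using Ps_eq[OF x subspace_add[OF subspaces(1)[OF x] 1(1) 2(1)] subspace_add[OF subspaces(2)[OF x] 1(2) 2(2)]]
    by metis
  have "r *\<^sub>R w = r *\<^sub>R Ps x w + r *\<^sub>R b + (r * l) *\<^sub>R v x"
    using 1(3) by (metis scaleR_add_right scaleR_scaleR)
  then show "Ps x (r *\<^sub>R w) = r *\<^sub>R Ps x w"
    using Ps_eq[OF x subspace_scale[OF subspaces(1)[OF x] 1(1)] subspace_scale[OF subspaces(2)[OF x] 1(2)]]
    by metis
qed

lemma Ps_commutes:
  assumes x: "x \<in> M"
  shows "Ps (\<Phi> t x) (X t x w) = X t x (Ps x w)"
proof -
  obtain b l where 1: "Ps x w \<in> Es x" "b \<in> Eu x" "w = Ps x w + b + l *\<^sub>R v x"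
    by (rule decompose[OF x])
  have "X t x w = X t x (Ps x w) + X t x b + l *\<^sub>R v (\<Phi> t x)"
    using linear_X[OF x] X_v[OF x] by (subst 1(3)) (simp add: linear_add linear_scale)
  then show ?thesis
    using Ps_eq[OF flow_in_M[OF x] Es_invariant[OF x 1(1)] Eu_invariant[OF x 1(2)]] by metis
qed

lemma closed_splitting_graph:
  "closed {(x, a, b, d). x \<in> M \<and> a \<in> Es x \<and> b \<in> Eu x \<and> d \<in> Ec x}"
  unfolding closed_sequential_limits
proof (intro allI impI)
  fix f l assume f: "(\<forall>n. f n \<in> {(x, a, b, d). x \<in> M \<and> a \<in> Es x \<and> b \<in> Eu x \<and> d \<in> Ec x}) \<and> f \<longlonglongrightarrow> l"
  obtain x a b d where l: "l = (x, a, b, d)" by (cases l)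
  define xs as bs ds where "xs n = fst (f n)" and "as n = fst (snd (f n))"
    and "bs n = fst (snd (snd (f n)))" and "ds n = snd (snd (snd (f n)))" for n
  have fl: "f \<longlonglongrightarrow> l" using f by blast
  have lim: "xs \<longlonglongrightarrow> x" "as \<longlonglongrightarrow> a" "bs \<longlonglongrightarrow> b" "ds \<longlonglongrightarrow> d"
    using tendsto_fst[OF fl] tendsto_fst[OF tendsto_snd[OF fl]] tendsto_fst[OF tendsto_snd[OF tendsto_snd[OF fl]]]
      tendsto_snd[OF tendsto_snd[OF tendsto_snd[OF fl]]]
    unfolding xs_def[abs_def] as_def[abs_def] bs_def[abs_def] ds_def[abs_def] l by simp_all
  have mem: "xs n \<in> M" "as n \<in> Es (xs n)" "bs n \<in> Eu (xs n)" "ds n \<in> Ec (xs n)" for n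
    using f unfolding xs_def as_def bs_def ds_def by (auto simp: case_prod_beta)
  have x: "x \<in> M"
    using closed_sequentially[OF compact_imp_closed[OF compact_M] mem(1) lim(1)] .
  show "l \<in> {(x, a, b, d). x \<in> M \<and> a \<in> Es x \<and> b \<in> Eu x \<and> d \<in> Ec x}"
    using Es_closed[OF mem(1) lim(1) x mem(2) lim(2)] Eu_closed[OF mem(1) lim(1) x mem(3) lim(3)]
      Ec_closed[OF mem(1) lim(1) x mem(4) lim(4)] x by (simp add: l)
qed

text \<open>On the compact set of triples of norm 1 in the graph of the splitting, the length of the sum of the three
  components has a positive minimum, because the sum is direct at every point.\<close>

lemma components_bound:
  obtains K where "1 \<le> K" "\<And>x w. x \<in> M \<Longrightarrow> norm (components x w) \<le> K * norm w"
proof -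
  define G where "G = {(x, a, b, d). x \<in> M \<and> a \<in> Es x \<and> b \<in> Eu x \<and> d \<in> Ec x}"
  define S where "S = G \<inter> (M \<times> sphere 0 1)"
  have S: "compact S"
    unfolding S_def G_def
    by (intro closed_Int_compact closed_splitting_graph compact_Times compact_M compact_sphere)
  define f where "f t = norm (fst (snd t) + fst (snd (snd t)) + snd (snd (snd t)))" for t :: "'a \<times> 'a \<times> 'a \<times> 'a"
  have contf: "continuous_on S f" unfolding f_def by (intro continuous_intros)
  obtain \<mu> where \<mu>: "0 < \<mu>" "\<And>t. t \<in> S \<Longrightarrow> \<mu> \<le> f t"
  proof (cases "S = {}")
    case True
    then show thesis using that[of 1] by simp
  next
    case False
    obtain t where t: "t \<in> S" "\<And>t'. t' \<in> S \<Longrightarrow> f t \<le> f t'"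
      using continuous_attains_inf[OF S False contf] by blast
    obtain x a b d where xabd: "t = (x, a, b, d)" by (cases t)
    have mem: "x \<in> M" "a \<in> Es x" "b \<in> Eu x" "d \<in> Ec x" "norm (a, b, d) = 1"
      using t(1) by (auto simp: S_def G_def xabd)
    have "a + b + d \<noteq> 0"
    proof
      assume 0: "a + b + d = 0"
      have "components x 0 = (a, b, d)" "components x 0 = (0, 0, 0)"
        unfolding components_eq_iff[OF mem(1)] using mem 0 subspaces[OF mem(1)]
        by (auto simp: subspace_0 intro: rev_image_eqI[of 0])
      then show False using mem(5) by simp
    qed
    then have "0 < f t" by (simp add: f_def xabd)
    then show thesis using that[of "f t"] t(2) by blast
  qed
  show thesis
  proof (rule that[of "max 1 (1 / \<mu>)"])
    fix x w assume x: "x \<in> M"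
    obtain a b d where abd: "components x w = (a, b, d)" by (cases "components x w")
    then have mem: "a \<in> Es x" "b \<in> Eu x" "d \<in> Ec x" "w = a + b + d"
      using components_eq_iff[OF x] by blast+
    define r where "r = norm (a, b, d)"
    have "r \<le> (1 / \<mu>) * norm w"
    proof (cases "r = 0")
      case True
      then show ?thesis using \<mu>(1) by simp
    next
      case False
      then have r: "0 < r" unfolding r_def by simp
      have "inverse r *\<^sub>R a \<in> Es x" "inverse r *\<^sub>R b \<in> Eu x" "inverse r *\<^sub>R d \<in> Ec x"
        using mem subspaces[OF x] by (auto simp: subspace_scale)
      moreover have "norm (inverse r *\<^sub>R a, inverse r *\<^sub>R b, inverse r *\<^sub>R d) = 1"
      proof -
        have "(inverse r *\<^sub>R a, inverse r *\<^sub>R b, inverse r *\<^sub>R d) = inverse r *\<^sub>R (a, b, d)" by simp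
        also have "norm \<dots> = \<bar>inverse r\<bar> * r" unfolding r_def by (rule norm_scaleR)
        finally show ?thesis using r by simp
      qed
      ultimately have "(x, inverse r *\<^sub>R a, inverse r *\<^sub>R b, inverse r *\<^sub>R d) \<in> S"
        using x by (simp add: S_def G_def)
      from \<mu>(2)[OF this] have "\<mu> \<le> norm (inverse r *\<^sub>R w)"
        by (simp add: f_def mem(4) scaleR_add_right)
      then show ?thesis using r \<mu>(1) by (simp add: field_simps)
    qed
    also have "\<dots> \<le> max 1 (1 / \<mu>) * norm w" by (intro mult_right_mono) auto
    finally show "norm (components x w) \<le> max 1 (1 / \<mu>) * norm w" by (simp add: abd r_def)
  qed simp
qed

text \<open>A bounded map with closed graph is continuous.\<close>

lemma components_continuous: "continuous_on M (\<lambda>x. components x w)"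
proof -
  obtain K where K: "1 \<le> K" "\<And>x w. x \<in> M \<Longrightarrow> norm (components x w) \<le> K * norm w"
    by (rule components_bound) (rule that)
  show ?thesis
  proof (rule continuous_from_closed_graph[of "cball 0 (K * norm w)"])
    show "(\<lambda>x. components x w) \<in> M \<rightarrow> cball 0 (K * norm w)" using K(2) by simp
    have "(\<lambda>x. (x, components x w)) ` M = {(x, a, b, d). x \<in> M \<and> a \<in> Es x \<and> b \<in> Eu x \<and> d \<in> Ec x}
        \<inter> {t. fst (snd t) + fst (snd (snd t)) + snd (snd (snd t)) = w}"
      (is "?L = ?R")
    proof (intro set_eqI iffI)
      fix t assume "t \<in> ?L"
      then obtain x where x: "x \<in> M" "t = (x, components x w)" by blast
      obtain a b d where abd: "components x w = (a, b, d)" by (cases "components x w")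
      then show "t \<in> ?R" using x components_eq_iff[OF x(1), of w a b d] by auto
    next
      fix t assume t: "t \<in> ?R"
      obtain x a b d where xabd: "t = (x, a, b, d)" by (cases t)
      have "x \<in> M" "components x w = (a, b, d)"
        using t components_eq_iff[of x w a b d] by (auto simp: xabd)
      then show "t \<in> ?L" unfolding xabd by (intro image_eqI[of _ _ x]) simp_all
    qed
    moreover have "closed {t :: 'a \<times> 'a \<times> 'a \<times> 'a. fst (snd t) + fst (snd (snd t)) + snd (snd (snd t)) = w}"
      by (intro closed_Collect_eq continuous_intros)
    ultimately show "closed ((\<lambda>x. (x, components x w)) ` M)"
      using closed_splitting_graph by (simp add: closed_Int)
  qed simp
qed

lemma Ps_bound:
  obtains K where "1 \<le> K" "\<And>x w. x \<in> M \<Longrightarrow> norm (Ps x w) \<le> K * norm w"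
    "\<And>x w l a b. x \<in> M \<Longrightarrow> a \<in> Es x \<Longrightarrow> b \<in> Eu x \<Longrightarrow> w = a + b + l *\<^sub>R v x \<Longrightarrow> norm b \<le> K * norm w \<and> norm (l *\<^sub>R v x) \<le> K * norm w"
proof -
  obtain K where K: "1 \<le> K" "\<And>x w. x \<in> M \<Longrightarrow> norm (components x w) \<le> K * norm w"
    by (rule components_bound) (rule that)
  have fst_le: "norm (fst t) \<le> norm t" and snd_le: "norm (snd t) \<le> norm t"
    for t :: "'b::real_normed_vector \<times> 'c::real_normed_vector"
    by (auto simp: norm_prod_def intro: real_le_rsqrt)
  show thesis
  proof (rule that[OF K(1)])
    show "norm (Ps x w) \<le> K * norm w" if "x \<in> M" for x w
      unfolding Ps_def using fst_le K(2)[OF that] order_trans by blast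
    fix x w l a b assume x: "x \<in> M" and "a \<in> Es x" "b \<in> Eu x" "w = a + b + l *\<^sub>R v x"
    then have comp: "components x w = (a, b, l *\<^sub>R v x)" using components_eq_iff[OF x] by blast
    show "norm b \<le> K * norm w \<and> norm (l *\<^sub>R v x) \<le> K * norm w"
      using K(2)[OF x, of w] snd_le[of "components x w"] fst_le[of "snd (components x w)"] snd_le[of "snd (components x w)"]
      unfolding comp by auto
  qed
qed

lemma Ps_uniformly_continuous:
  assumes "0 < \<epsilon>"
  obtains \<delta> where "0 < \<delta>"
    "\<And>x y w. x \<in> M \<Longrightarrow> y \<in> M \<Longrightarrow> dist x y < \<delta> \<Longrightarrow> norm (Ps x w - Ps y w) \<le> \<epsilon> * norm w"
proof -
  define B where "B x = Blinfun (Ps x)" for x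
  have B: "blinfun_apply (B x) = Ps x" if "x \<in> M" for x
    unfolding B_def using linear_Ps[OF that] by (intro bounded_linear_Blinfun_apply) (simp add: linear_conv_bounded_linear)
  have "continuous_on M B"
  proof (rule continuous_on_blinfun_componentwise)
    show "continuous_on M (\<lambda>x. blinfun_apply (B x) i)" for i
      using continuous_on_fst[OF components_continuous[of i]] B by (simp add: Ps_def cong: continuous_on_cong)
  qed
  then have "uniformly_continuous_on M B" using compact_M by (rule compact_uniformly_continuous)
  then obtain \<delta> where \<delta>: "0 < \<delta>" "\<And>x y. x \<in> M \<Longrightarrow> y \<in> M \<Longrightarrow> dist y x < \<delta> \<Longrightarrow> dist (B y) (B x) < \<epsilon>"
    unfolding uniformly_continuous_on_def using assms by metis
  show thesis
  proof (rule that[OF \<delta>(1)])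
    fix x y w assume xy: "x \<in> M" "y \<in> M" "dist x y < \<delta>"
    have "norm (Ps x w - Ps y w) = norm (blinfun_apply (B x - B y) w)"
      using xy by (simp add: B blinfun.diff_left)
    also have "\<dots> \<le> norm (B x - B y) * norm w" by (rule norm_blinfun)
    also have "\<dots> \<le> \<epsilon> * norm w"
      using \<delta>(2)[OF xy(2,1,3)] by (intro mult_right_mono) (auto simp: dist_norm)
    finally show "norm (Ps x w - Ps y w) \<le> \<epsilon> * norm w" .
  qed
qed

text \<open>Backwards in time unstable vectors contract, and a multiple of \<open>v\<close> keeps its length up to the ratio of the
  extreme speeds on \<open>M\<close>. The bound does not depend on \<open>t\<close>, so \<open>T\<close> may be chosen after \<open>\<beta>\<close>.\<close>

lemma complement_backward_bound:
  obtains \<beta> where "0 \<le> \<beta>"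
    "\<And>y t w. y \<in> M \<Longrightarrow> 0 \<le> t \<Longrightarrow> norm (X (- t) y (w - Ps y w)) \<le> \<beta> * norm w"
proof -
  obtain m V where mV: "0 < m" "0 \<le> V" "\<And>x. x \<in> M \<Longrightarrow> m \<le> norm (v x)" "\<And>x. x \<in> M \<Longrightarrow> norm (v x) \<le> V"
    by (rule speed_bounds) (rule that)
  obtain K where K: "1 \<le> K" "\<And>x w. x \<in> M \<Longrightarrow> norm (Ps x w) \<le> K * norm w"
    "\<And>x w l a b. x \<in> M \<Longrightarrow> a \<in> Es x \<Longrightarrow> b \<in> Eu x \<Longrightarrow> w = a + b + l *\<^sub>R v x \<Longrightarrow> norm b \<le> K * norm w \<and> norm (l *\<^sub>R v x) \<le> K * norm w"
    by (rule Ps_bound) (rule that)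
  show thesis
  proof (rule that[of "c * K + V / m * K"])
    show "0 \<le> c * K + V / m * K" using c K(1) mV by simp
    fix y w and t :: real assume y: "y \<in> M" and t: "0 \<le> t"
    obtain b l where bl: "Ps y w \<in> Es y" "b \<in> Eu y" "w = Ps y w + b + l *\<^sub>R v y"
      by (rule decompose[OF y])
    have bounds: "norm b \<le> K * norm w" "norm (l *\<^sub>R v y) \<le> K * norm w"
      using K(3)[OF y bl] by auto
    have "w - Ps y w = b + l *\<^sub>R v y" using bl(3) by (metis add.assoc add_diff_cancel_left')
    then have "X (- t) y (w - Ps y w) = X (- t) y b + l *\<^sub>R v (\<Phi> (- t) y)"
      using linear_X[OF y] X_v[OF y] by (simp add: linear_add linear_scale)
    then have "norm (X (- t) y (w - Ps y w)) \<le> norm (X (- t) y b) + norm (l *\<^sub>R v (\<Phi> (- t) y))"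
      by (simp only: norm_triangle_ineq)
    also have "\<dots> \<le> c * (K * norm w) + V / m * (K * norm w)"
    proof (rule add_mono)
      have "norm (X (- t) y b) \<le> c * exp (\<alpha> * - t) * norm b"
        using t by (intro Eu_contracts y bl) auto
      also have "\<dots> \<le> c * 1 * (K * norm w)"
        using c \<alpha> t bounds(1) by (intro mult_mono) auto
      finally show "norm (X (- t) y b) \<le> c * (K * norm w)" by simp
      have "\<bar>l\<bar> * m \<le> \<bar>l\<bar> * norm (v y)" by (intro mult_left_mono mV(3) y) auto
      then have "\<bar>l\<bar> * m \<le> K * norm w" using bounds(2) by simp
      then have l: "\<bar>l\<bar> \<le> K * norm w / m" using mV(1) by (simp add: pos_le_divide_eq)
      have "norm (l *\<^sub>R v (\<Phi> (- t) y)) \<le> \<bar>l\<bar> * V"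
        using mV(4)[OF flow_in_M[OF y]] by (auto intro!: mult_left_mono)
      also have "\<dots> \<le> K * norm w / m * V" by (intro mult_right_mono l mV)
      finally show "norm (l *\<^sub>R v (\<Phi> (- t) y)) \<le> V / m * (K * norm w)" by (simp add: mult_ac)
    qed
    finally show "norm (X (- t) y (w - Ps y w)) \<le> (c * K + V / m * K) * norm w"
      by (simp add: algebra_simps)
  qed
qed

end

section \<open>Strong stable leaves\<close>

context hyperbolic_flow
begin

definition leaf :: "real \<Rightarrow> real \<Rightarrow> real \<Rightarrow> 'a \<Rightarrow> 'a set" where
  "leaf T \<theta> \<rho> p = {y. \<forall>k::nat. norm (\<Phi> (real k * T) y - \<Phi> (real k * T) p) \<le> \<rho> * \<theta> ^ k}"

text \<open>The points \<open>x k\<close> are where the flow is linearised; they need not form an orbit.\<close>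

definition shadowed :: "real \<Rightarrow> real \<Rightarrow> (nat \<Rightarrow> 'a) \<Rightarrow> 'a \<Rightarrow> bool" where
  "shadowed T \<delta> x p \<longleftrightarrow> (\<forall>k. x k \<in> M \<and> dist (x k) (\<Phi> (real k * T) p) < \<delta>)"

lemma flow_Suc: "\<Phi> (real (Suc k) * T) p = \<Phi> T (\<Phi> (real k * T) p)"
  using flow_add[of T "real k * T" p] by (simp add: algebra_simps)

text \<open>At each step the projection at \<open>x (Suc k)\<close> is compared with the invariant one at \<open>\<Phi> T (x k)\<close>; the
  difference \<open>\<epsilon>\<close> accounts for the leakage and, being less than 1, also gives transversality.\<close>

lemma dichotomy_along_shadow:
  assumes M: "\<And>k. x k \<in> M" and T: "0 \<le> T"
    and K: "1 \<le> K" "\<And>x w. x \<in> M \<Longrightarrow> norm (Ps x w) \<le> K * norm w"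
    and \<beta>: "0 \<le> \<beta>" "\<And>y t w. y \<in> M \<Longrightarrow> 0 \<le> t \<Longrightarrow> norm (X (- t) y (w - Ps y w)) \<le> \<beta> * norm w"
    and \<theta>: "0 < \<theta>" "\<theta> < 1" and \<kappa>: "0 \<le> \<kappa>" "\<kappa> \<le> 1 / 8" and \<beta>\<theta>: "\<beta> * \<theta> \<le> \<kappa>"
    and L: "0 \<le> L" "\<And>x \<eta>. x \<in> M \<Longrightarrow> norm (X T x \<eta>) \<le> L * norm \<eta>"
    and \<epsilon>: "\<epsilon> < 1" "\<epsilon> * L + K * c * exp (- \<alpha> * T) \<le> \<kappa> * \<theta>"
      "\<And>k w. norm (Ps (x (Suc k)) w - Ps (\<Phi> T (x k)) w) \<le> \<epsilon> * norm w"
  shows "approximate_dichotomy (\<lambda>k. X T (x k)) (\<lambda>k. X (- T) (\<Phi> T (x k))) (\<lambda>k. Ps (x k)) K \<kappa> \<beta> \<theta>"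
proof (rule approximate_dichotomy.intro)
  fix k w
  define y where "y = \<Phi> T (x k)"
  have y: "y \<in> M" unfolding y_def by (rule flow_in_M[OF M])
  have y_back: "\<Phi> (- T) y = x k" by (simp add: y_def)
  have QB: "X (- T) y w - Ps (x k) (X (- T) y w) = X (- T) y (w - Ps y w)" for w
    using Ps_commutes[OF y, of "- T" w] by (simp add: y_back linear_diff[OF linear_X[OF y]])
  show "linear (X T (x k))" "linear (X (- T) (\<Phi> T (x k)))" "linear (Ps (x k))"
    by (intro linear_X linear_Ps flow_in_M M)+
  show "norm (Ps (x k) w) \<le> K * norm w" by (rule K(2)[OF M])
  show "Ps (x k) (Ps (x k) w) = Ps (x k) w" by (rule Ps_idem[OF M])
  show "X (- T) (\<Phi> T (x k)) (X T (x k) w) = w" by (rule X_inverse[OF M])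
  show "norm (X (- T) (\<Phi> T (x k)) w - Ps (x k) (X (- T) (\<Phi> T (x k)) w)) \<le> \<beta> * norm w"
    unfolding y_def[symmetric] QB by (rule \<beta>(2)[OF y T])
  show "norm (Ps (x (Suc k)) (X T (x k) w)) \<le> \<kappa> * \<theta> * norm w"
  proof -
    have "Ps (x (Suc k)) (X T (x k) w) = (Ps (x (Suc k)) (X T (x k) w) - Ps y (X T (x k) w)) + X T (x k) (Ps (x k) w)"
      by (simp add: y_def Ps_commutes[OF M])
    then have "norm (Ps (x (Suc k)) (X T (x k) w)) \<le>
        norm (Ps (x (Suc k)) (X T (x k) w) - Ps y (X T (x k) w)) + norm (X T (x k) (Ps (x k) w))"
      by (metis norm_triangle_ineq)
    also have "\<dots> \<le> \<epsilon> * norm (X T (x k) w) + c * exp (- \<alpha> * T) * norm (Ps (x k) w)"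
      unfolding y_def by (intro add_mono \<epsilon> Es_contracts Ps_in_Es M T)
    also have "\<dots> \<le> \<epsilon> * (L * norm w) + c * exp (- \<alpha> * T) * (K * norm w)"
    proof -
      have "0 \<le> \<epsilon> * norm w" using order_trans[OF norm_ge_zero \<epsilon>(3)[of k w]] .
      then have "0 \<le> \<epsilon> \<or> w = 0" by (auto simp: zero_le_mult_iff)
      then have XT: "\<epsilon> * norm (X T (x k) w) \<le> \<epsilon> * (L * norm w)"
        using L(2)[OF M, of k w] linear_0[OF linear_X[OF M]] by (auto intro: mult_left_mono)
      then show ?thesis using K(2)[OF M, of k w] c by (intro add_mono[OF XT] mult_left_mono) auto
    qed
    also have "\<dots> = (\<epsilon> * L + K * c * exp (- \<alpha> * T)) * norm w" by (simp add: algebra_simps)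
    also have "\<dots> \<le> \<kappa> * \<theta> * norm w" by (intro mult_right_mono \<epsilon>(2)) auto
    finally show ?thesis .
  qed
  fix r assume r: "Ps (x (Suc k)) r = 0" "Ps (x k) (X (- T) (\<Phi> T (x k)) r) = X (- T) (\<Phi> T (x k)) r"
  have "X (- T) y (r - Ps y r) = 0" using QB[of r] r(2) by (simp add: y_def)
  then have "X T (\<Phi> (- T) y) (X (- T) y (r - Ps y r)) = 0"
    using linear_0[OF linear_X[OF M]] by (simp add: y_back)
  then have "r - Ps y r = 0" using X_inverse[OF y, of "- T"] by simp
  then have "norm r \<le> \<epsilon> * norm r"
    using \<epsilon>(3)[of k r] r(1) by (simp add: y_def)
  then have "(1 - \<epsilon>) * norm r \<le> 0" by (simp add: algebra_simps)
  then show "r = 0" using \<epsilon>(1) by (simp add: mult_le_0_iff)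
qed (use \<theta> K \<beta> \<kappa> \<beta>\<theta> in auto)

text \<open>Two properties of the leaves of base points that are shadowed by the same points of \<open>M\<close>. Every small
  stable displacement at \<open>x 0\<close> is realised on the leaf. For points on two leaves, the complementary part of the
  difference of their displacements is controlled with factor \<open>\<kappa>\<close> by the stable part and by the
  largest distance \<open>W\<close> of the base orbits; for \<open>p = p'\<close> and \<open>W = 0\<close> this says that the leaf is a
  \<open>\<kappa>\<close>-Lipschitz graph.\<close>

definition stable_leaves :: "real \<Rightarrow> real \<Rightarrow> real \<Rightarrow> real \<Rightarrow> real \<Rightarrow> real \<Rightarrow> bool" where
  "stable_leaves \<kappa> T \<theta> \<delta> \<rho> r \<longleftrightarrow> 0 < T \<and> 0 < \<theta> \<and> \<theta> < 1 \<and> 0 < \<delta> \<and> 0 < \<rho> \<and> 0 < r \<and>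
     (\<forall>x p a. shadowed T \<delta> x p \<longrightarrow> norm a \<le> r \<longrightarrow>
        (\<exists>y\<in>leaf T \<theta> \<rho> p. Ps (x 0) (y - p) = Ps (x 0) a)) \<and>
     (\<forall>x p p'. \<forall>y\<in>leaf T \<theta> \<rho> p. \<forall>y'\<in>leaf T \<theta> \<rho> p'. \<forall>W.
        shadowed T \<delta> x p \<longrightarrow> shadowed T \<delta> x p' \<longrightarrow>
        (\<forall>k::nat. norm (\<Phi> (real k * T) p - \<Phi> (real k * T) p') \<le> W) \<longrightarrow>
        (let d = (y - p) - (y' - p') in
         norm (d - Ps (x 0) d) \<le> \<kappa> * norm (Ps (x 0) d) + \<kappa> * W))"

lemma stable_leaves_exist:
  assumes "stable_leaves \<kappa> T \<theta> \<delta> \<rho> r" "shadowed T \<delta> x p" "norm a \<le> r"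
  shows "\<exists>y\<in>leaf T \<theta> \<rho> p. Ps (x 0) (y - p) = Ps (x 0) a"
  using assms unfolding stable_leaves_def by blast

lemma stable_leaves_compare:
  assumes "stable_leaves \<kappa> T \<theta> \<delta> \<rho> r" "shadowed T \<delta> x p" "shadowed T \<delta> x p'"
    and "y \<in> leaf T \<theta> \<rho> p" "y' \<in> leaf T \<theta> \<rho> p'"
    and "\<And>k::nat. norm (\<Phi> (real k * T) p - \<Phi> (real k * T) p') \<le> W" "d = (y - p) - (y' - p')"
  shows "norm (d - Ps (x 0) d) \<le> \<kappa> * norm (Ps (x 0) d) + \<kappa> * W"
  using assms unfolding stable_leaves_def Let_def by blast

text \<open>The order of the choices matters: \<open>\<theta>\<close> and \<open>T\<close> depend only on the bounds for the splitting; then come the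
  Taylor constants of the time-\<open>T\<close> map, then the admissible errors, and last the sizes of the
  neighbourhood and of the leaves.\<close>

lemma strong_stable_leaves:
  assumes \<kappa>: "0 < \<kappa>"
  shows "\<exists>T \<theta> \<delta> \<rho> r. stable_leaves \<kappa> T \<theta> \<delta> \<rho> r"
proof -
  obtain K where K: "1 \<le> K" "\<And>x w. x \<in> M \<Longrightarrow> norm (Ps x w) \<le> K * norm w"
    "\<And>x w l a b. x \<in> M \<Longrightarrow> a \<in> Es x \<Longrightarrow> b \<in> Eu x \<Longrightarrow> w = a + b + l *\<^sub>R v x \<Longrightarrow> norm b \<le> K * norm w \<and> norm (l *\<^sub>R v x) \<le> K * norm w"
    by (rule Ps_bound) (rule that)
  obtain \<beta> where \<beta>: "0 \<le> \<beta>"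
    "\<And>y t w. y \<in> M \<Longrightarrow> 0 \<le> t \<Longrightarrow> norm (X (- t) y (w - Ps y w)) \<le> \<beta> * norm w"
    by (rule complement_backward_bound) (rule that)
  define \<kappa>' where "\<kappa>' = min (1 / 8) (\<kappa> / 4)"
  have \<kappa>': "0 < \<kappa>'" "\<kappa>' \<le> 1 / 8" "4 * \<kappa>' \<le> \<kappa>" using \<kappa> by (auto simp: \<kappa>'_def)
  define R where "R = 2 * (K * c) + \<beta> + 1"
  have Kc: "1 \<le> K * c" using K(1) c by (simp add: mult_ge1_I)
  then have R: "1 < R" "2 * (K * c) \<le> R" "\<beta> \<le> R" using \<beta>(1) by (auto simp: R_def)
  \<comment> \<open>\<open>T\<close> is chosen below so that \<open>\<theta> = exp (- \<alpha> * T / 2)\<close>: the contraction on \<open>Es\<close> is of order \<open>\<theta>\<^sup>2\<close>\<close>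
  define \<theta> where "\<theta> = \<kappa>' / R"
  have \<theta>: "0 < \<theta>" "\<theta> < 1" "R * \<theta> = \<kappa>'" using \<kappa>' R by (auto simp: \<theta>_def divide_less_eq)
  define T where "T = - 2 * ln \<theta> / \<alpha>"
  have T: "0 < T" using \<theta> \<alpha> by (simp add: T_def divide_neg_pos)
  have expT: "exp (- \<alpha> * T) = \<theta> * \<theta>"
    using \<alpha> \<theta>(1) by (simp add: T_def exp_double power2_eq_square)
  have \<beta>\<theta>: "\<beta> * \<theta> \<le> \<kappa>'" using mult_right_mono[OF R(3), of \<theta>] \<theta> by simp
  have KcT: "K * c * exp (- \<alpha> * T) \<le> \<kappa>' * \<theta> / 2"
  proof -
    have "2 * (K * c) * \<theta> \<le> \<kappa>'" using mult_right_mono[OF R(2), of \<theta>] \<theta> by simp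
    from mult_right_mono[OF this, of \<theta>] show ?thesis using \<theta>(1) unfolding expT by (simp add: algebra_simps)
  qed
  obtain \<delta>0 L where \<delta>0: "0 < \<delta>0" and L: "0 \<le> L"
    and lip: "\<And>x a b. x \<in> M \<Longrightarrow> {a, b} \<subseteq> ball x \<delta>0 \<Longrightarrow> norm (\<Phi> T a - \<Phi> T b) \<le> L * norm (a - b)"
    and snd: "\<And>x a b a' b'. x \<in> M \<Longrightarrow> {a, b, a', b'} \<subseteq> ball x \<delta>0 \<Longrightarrow> a - b = a' - b' \<Longrightarrow>
      norm (\<Phi> T a - \<Phi> T b - (\<Phi> T a' - \<Phi> T b')) \<le> L * (norm (a - b) * norm (b - b'))"
    and "\<And>x. x \<in> M \<Longrightarrow> (\<Phi> T has_derivative X T x) (at x)"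
    and bnd: "\<And>x \<eta>. x \<in> M \<Longrightarrow> norm (X T x \<eta>) \<le> L * norm \<eta>"
    and rem: "\<And>x \<eta>. x \<in> M \<Longrightarrow> norm \<eta> < \<delta>0 \<Longrightarrow> norm (\<Phi> T (x + \<eta>) - \<Phi> T x - X T x \<eta>) \<le> L * (norm \<eta>)\<^sup>2"
    by (rule flow_derivative_estimates[of T]) (rule that)
  define \<epsilon>1 where "\<epsilon>1 = min (1 / 2) (\<kappa>' * \<theta> / (2 * (L + 1)))"
  have \<epsilon>1: "0 < \<epsilon>1" "\<epsilon>1 < 1" using \<kappa>' \<theta> L by (auto simp: \<epsilon>1_def)
  have \<epsilon>1L: "\<epsilon>1 * L \<le> \<kappa>' * \<theta> / 2"
  proof -
    have "\<epsilon>1 * L \<le> \<kappa>' * \<theta> / (2 * (L + 1)) * (L + 1)"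
      using L \<kappa>' \<theta> by (intro mult_mono) (auto simp: \<epsilon>1_def)
    also have "\<dots> = \<kappa>' * \<theta> / 2" using L by (simp add: field_simps)
    finally show ?thesis .
  qed
  obtain \<delta>1 where \<delta>1: "0 < \<delta>1"
    "\<And>x y w. x \<in> M \<Longrightarrow> y \<in> M \<Longrightarrow> dist x y < \<delta>1 \<Longrightarrow> norm (Ps x w - Ps y w) \<le> \<epsilon>1 * norm w"
    by (rule Ps_uniformly_continuous[OF \<epsilon>1(1)]) (rule that)
  define \<epsilon> where "\<epsilon> = \<kappa>' * \<theta> / (K + \<beta> + 1)"
  have \<epsilon>: "0 < \<epsilon>" "K * \<epsilon> \<le> \<kappa>' * \<theta>" "\<beta> * \<epsilon> \<le> \<kappa>'"
  proof -
    have S: "0 < K + \<beta> + 1" using K(1) \<beta>(1) by simp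
    show pos: "0 < \<epsilon>" using S \<kappa>' \<theta> by (simp add: \<epsilon>_def)
    have eq: "(K + \<beta> + 1) * \<epsilon> = \<kappa>' * \<theta>" using S by (simp add: \<epsilon>_def)
    have "K * \<epsilon> \<le> (K + \<beta> + 1) * \<epsilon>" using pos \<beta>(1) by (intro mult_right_mono) auto
    then show "K * \<epsilon> \<le> \<kappa>' * \<theta>" by (simp only: eq)
    have "\<beta> * \<epsilon> \<le> (K + \<beta> + 1) * \<epsilon>" using pos K(1) by (intro mult_right_mono) auto
    also have "\<dots> \<le> \<kappa>' * 1" unfolding eq using \<kappa>' \<theta> by (intro mult_left_mono) auto
    finally show "\<beta> * \<epsilon> \<le> \<kappa>'" by simp
  qed
  \<comment> \<open>within distance \<open>2 * b\<close> of \<open>M\<close> the time-\<open>T\<close> map differs from its linearisation by an \<open>\<epsilon>\<close>-Lipschitz map\<close>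
  define b where "b = min (\<delta>0 / 4) (\<epsilon> / (4 * (L + 1)))"
  have b: "0 < b" "4 * b \<le> \<delta>0" using \<delta>0 \<epsilon> L by (auto simp: b_def)
  have Lb: "4 * b * L \<le> \<epsilon>"
  proof -
    have "4 * b * L \<le> 4 * (\<epsilon> / (4 * (L + 1))) * (L + 1)"
      using L \<epsilon>(1) b(1) by (intro mult_mono) (auto simp: b_def)
    also have "\<dots> = \<epsilon>" using L by (simp add: field_simps)
    finally show ?thesis .
  qed
  define S where "S = K / \<theta> + \<beta>"
  have S: "0 < S" using K(1) \<theta>(1) \<beta>(1) by (simp add: S_def add_pos_nonneg)
  define \<rho> where "\<rho> = min b (\<kappa> / (2 * (L + 1) * S))"
  have \<rho>: "0 < \<rho>" "\<rho> \<le> b" using b \<kappa> L S by (auto simp: \<rho>_def)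
  have L\<rho>S: "2 * (L * \<rho> * S) \<le> \<kappa>"
  proof -
    have "2 * (L * \<rho> * S) \<le> 2 * ((L + 1) * (\<kappa> / (2 * (L + 1) * S)) * S)"
      using L S \<rho>(1) \<kappa> by (intro mult_mono) (auto simp: \<rho>_def)
    also have "\<dots> = \<kappa>"
    proof -
      have "2 * (N * (\<kappa> / (2 * N * S)) * S) = \<kappa>" if "0 < N" for N
        using that S by (simp add: field_simps)
      from this[of "L + 1"] show ?thesis using L by simp
    qed
    finally show ?thesis .
  qed
  define \<delta> where "\<delta> = min b (\<delta>1 / (2 * (L + 1)))"
  have \<delta>: "0 < \<delta>" "\<delta> \<le> b" using b \<delta>1 L by (auto simp: \<delta>_def)
  have L\<delta>: "(1 + L) * \<delta> < \<delta>1"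
  proof -
    have "(1 + L) * \<delta> \<le> (1 + L) * (\<delta>1 / (2 * (L + 1)))"
      using L by (intro mult_left_mono) (auto simp: \<delta>_def)
    also have "\<dots> = \<delta>1 / 2"
    proof -
      have "N * (\<delta>1 / (2 * N)) = \<delta>1 / 2" if "0 < N" for N
        using that by (simp add: field_simps)
      from this[of "L + 1"] show ?thesis using L by (simp only: add.commute[of 1 L])
    qed
    also have "\<dots> < \<delta>1" using \<delta>1(1) by simp
    finally show ?thesis .
  qed
  define r where "r = \<rho> / (2 * K)"
  have r: "0 < r" "K * r = \<rho> / 2" using \<rho> K(1) by (auto simp: r_def)
  define g where "g p k \<eta> = \<Phi> T (\<Phi> (real k * T) p + \<eta>) - \<Phi> T (\<Phi> (real k * T) p)" for p and k :: nat and \<eta>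
  have dich: "approximate_dichotomy (\<lambda>k. X T (x k)) (\<lambda>k. X (- T) (\<Phi> T (x k))) (\<lambda>k. Ps (x k)) K \<kappa>' \<beta> \<theta>"
    if sh: "shadowed T \<delta> x p" for x p
  proof (rule dichotomy_along_shadow[where L = L and \<epsilon> = \<epsilon>1])
    have M: "x k \<in> M" and near: "dist (x k) (\<Phi> (real k * T) p) < \<delta>" for k
      using sh by (auto simp: shadowed_def)
    show "norm (Ps (x (Suc k)) w - Ps (\<Phi> T (x k)) w) \<le> \<epsilon>1 * norm w" for k w
    proof (rule \<delta>1(2)[OF M flow_in_M[OF M]])
      have "norm (\<Phi> T (\<Phi> (real k * T) p) - \<Phi> T (x k)) \<le> L * norm (\<Phi> (real k * T) p - x k)"
        using near[of k] \<delta> b by (intro lip[OF M[of k]]) auto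
      also have "\<dots> \<le> L * \<delta>"
        using near[of k] L by (intro mult_left_mono) (auto simp: dist_norm norm_minus_commute)
      finally have "dist (\<Phi> (real (Suc k) * T) p) (\<Phi> T (x k)) \<le> L * \<delta>"
        unfolding flow_Suc dist_norm .
      then show "dist (x (Suc k)) (\<Phi> T (x k)) < \<delta>1"
        using near[of "Suc k"] dist_triangle[of "x (Suc k)" "\<Phi> T (x k)" "\<Phi> (real (Suc k) * T) p"] L\<delta>
        by (simp add: algebra_simps)
    qed
    show "x k \<in> M" for k by (rule M)
    show "\<epsilon>1 * L + K * c * exp (- \<alpha> * T) \<le> \<kappa>' * \<theta>" using \<epsilon>1L KcT by linarith
  qed (use T K(1,2) \<beta> \<theta>(1,2) \<kappa>' \<beta>\<theta> L bnd \<epsilon>1 in \<open>simp_all\<close>)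
  have g_close: "norm (g p k \<eta> - g p k \<eta>' - X T (x k) (\<eta> - \<eta>')) \<le> \<epsilon> * norm (\<eta> - \<eta>')"
    if sh: "shadowed T \<delta> x p" and small: "norm \<eta> \<le> \<rho>" "norm \<eta>' \<le> \<rho>" for x p k \<eta> \<eta>'
  proof -
    define z where "z = \<Phi> (real k * T) p"
    define \<zeta> where "\<zeta> = \<eta> - \<eta>'"
    have M: "x k \<in> M" and near: "dist (x k) z < \<delta>"
      using sh by (auto simp: shadowed_def z_def)
    have \<zeta>: "norm \<zeta> \<le> 2 * \<rho>" using small norm_triangle_ineq4[of \<eta> \<eta>'] by (simp add: \<zeta>_def)
    have dist_z: "dist (x k) (z + \<eta>) < 2 * b" if "norm \<eta> \<le> \<rho>" for \<eta>
      using near that \<delta> \<rho> dist_triangle[of "x k" "z + \<eta>" z] by (simp add: dist_norm)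
    have pts: "{z + \<eta>, z + \<eta>', x k + \<zeta>, x k} \<subseteq> ball (x k) \<delta>0"
      using dist_z[OF small(1)] dist_z[OF small(2)] \<zeta> \<rho> b by (auto simp: dist_norm)
    have "norm (\<Phi> T (z + \<eta>) - \<Phi> T (z + \<eta>') - (\<Phi> T (x k + \<zeta>) - \<Phi> T (x k))) \<le> L * (norm \<zeta> * norm (z + \<eta>' - x k))"
      using snd[OF M pts] by (simp add: \<zeta>_def)
    also have "\<dots> \<le> L * (norm \<zeta> * (2 * b))"
      using dist_z[OF small(2)] L by (intro mult_left_mono) (auto simp: dist_norm norm_minus_commute)
    finally have 1: "norm (\<Phi> T (z + \<eta>) - \<Phi> T (z + \<eta>') - (\<Phi> T (x k + \<zeta>) - \<Phi> T (x k))) \<le> L * (norm \<zeta> * (2 * b))" .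
    have "norm (\<Phi> T (x k + \<zeta>) - \<Phi> T (x k) - X T (x k) \<zeta>) \<le> L * (norm \<zeta>)\<^sup>2"
      using \<zeta> \<rho> b by (intro rem M) auto
    also have "\<dots> \<le> L * (norm \<zeta> * (2 * b))"
      unfolding power2_eq_square using L \<zeta> \<rho> by (intro mult_left_mono) auto
    finally have 2: "norm (\<Phi> T (x k + \<zeta>) - \<Phi> T (x k) - X T (x k) \<zeta>) \<le> L * (norm \<zeta> * (2 * b))" .
    have "g p k \<eta> - g p k \<eta>' - X T (x k) \<zeta> =
       (\<Phi> T (z + \<eta>) - \<Phi> T (z + \<eta>') - (\<Phi> T (x k + \<zeta>) - \<Phi> T (x k))) + (\<Phi> T (x k + \<zeta>) - \<Phi> T (x k) - X T (x k) \<zeta>)"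
      by (simp add: g_def z_def)
    then have "norm (g p k \<eta> - g p k \<eta>' - X T (x k) \<zeta>) \<le> L * (norm \<zeta> * (2 * b)) + L * (norm \<zeta> * (2 * b))"
      by (simp only: norm_triangle_mono[OF 1 2])
    also have "\<dots> = 4 * b * L * norm \<zeta>" by simp
    also have "\<dots> \<le> \<epsilon> * norm \<zeta>" by (intro mult_right_mono Lb) auto
    finally show ?thesis by (simp add: \<zeta>_def)
  qed
  have "stable_leaves \<kappa> T \<theta> \<delta> \<rho> r"
    unfolding stable_leaves_def Let_def
  proof (intro conjI allI ballI impI)
    fix x p and a :: 'a assume sh: "shadowed T \<delta> x p" and a: "norm a \<le> r"
    have Ka: "K * norm a \<le> \<rho> / 2" using mult_left_mono[OF a, of K] K(1) r(2) by simp
    have g0: "g p k 0 = 0" for k by (simp add: g_def)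
    have "\<exists>\<eta>. Ps (x 0) (\<eta> 0) = Ps (x 0) a \<and> (\<forall>k. \<eta> (Suc k) = g p k (\<eta> k)) \<and>
      (\<forall>k. norm (\<eta> k) \<le> \<rho> * \<theta> ^ k)"
    proof (rule approximate_dichotomy.decaying_orbit_exists[OF dich[OF sh] \<rho>(1) Ka \<epsilon>(2,3), where g = "g p"])
      show "g p k 0 = 0" for k by (rule g0)
      show "norm (g p k \<eta> - g p k \<eta>' - X T (x k) (\<eta> - \<eta>')) \<le> \<epsilon> * norm (\<eta> - \<eta>')"
        if "norm \<eta> \<le> \<rho>" "norm \<eta>' \<le> \<rho>" for k \<eta> \<eta>'
        by (rule g_close[OF sh that])
    qed blast
    then obtain \<eta> where \<eta>: "Ps (x 0) (\<eta> 0) = Ps (x 0) a" "\<And>k. \<eta> (Suc k) = g p k (\<eta> k)"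
      "\<And>k. norm (\<eta> k) \<le> \<rho> * \<theta> ^ k" by blast
    have orbit: "\<Phi> (real k * T) (p + \<eta> 0) = \<Phi> (real k * T) p + \<eta> k" for k
      by (induction k) (simp, simp only: flow_Suc \<eta>(2) g_def, simp)
    show "\<exists>y\<in>leaf T \<theta> \<rho> p. Ps (x 0) (y - p) = Ps (x 0) a"
      by (rule bexI[of _ "p + \<eta> 0"]) (use \<eta> in \<open>simp_all add: leaf_def orbit\<close>)
  next
    fix x p p' y y' W
    assume sh: "shadowed T \<delta> x p" and sh': "shadowed T \<delta> x p'"
      and y: "y \<in> leaf T \<theta> \<rho> p" and y': "y' \<in> leaf T \<theta> \<rho> p'"
      and "\<forall>k::nat. norm (\<Phi> (real k * T) p - \<Phi> (real k * T) p') \<le> W"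
    then have W: "norm (\<Phi> (real k * T) p - \<Phi> (real k * T) p') \<le> W" for k :: nat by blast
    have W0: "0 \<le> W" using order_trans[OF norm_ge_zero W] .
    define d where d: "d = (y - p) - (y' - p')"
    define \<eta> where "\<eta> k = \<Phi> (real k * T) y - \<Phi> (real k * T) p" for k :: nat
    define \<eta>' where "\<eta>' k = \<Phi> (real k * T) y' - \<Phi> (real k * T) p'" for k :: nat
    have "norm (approximate_dichotomy.Q (\<lambda>k. Ps (x k)) 0 (\<eta> 0 - \<eta>' 0)) \<le>
        4 * \<kappa>' * norm (Ps (x 0) (\<eta> 0 - \<eta>' 0)) + 2 * (L * W * \<rho> * (K / \<theta> + \<beta>))"
    proof (rule approximate_dichotomy.decaying_orbits_compare[OF dich[OF sh] _ _ \<epsilon>(2,3) g_close[OF sh],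
          where g' = "g p'"])
      show "norm (g p k \<eta> - g p' k \<eta>) \<le> L * W * norm \<eta>" if small: "norm \<eta> \<le> \<rho>" for k \<eta>
      proof -
        define z z' where "z = \<Phi> (real k * T) p" and "z' = \<Phi> (real k * T) p'"
        have M: "x k \<in> M" and near: "dist (x k) z < \<delta>" "dist (x k) z' < \<delta>"
          using sh sh' by (auto simp: shadowed_def z_def z'_def)
        have "{z + \<eta>, z, z' + \<eta>, z'} \<subseteq> ball (x k) \<delta>0"
          using near small \<delta> \<rho> b dist_triangle[of "x k" "z + \<eta>" z] dist_triangle[of "x k" "z' + \<eta>" z']
          by (auto simp: dist_norm)
        from snd[OF M this] have "norm (g p k \<eta> - g p' k \<eta>) \<le> L * (norm \<eta> * norm (z - z'))"
          by (simp add: g_def z_def z'_def)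
        also have "\<dots> \<le> L * (norm \<eta> * W)"
          using W[of k] L by (intro mult_left_mono) (auto simp: z_def z'_def)
        finally show ?thesis by (simp add: mult_ac)
      qed
      show "\<eta> (Suc k) = g p k (\<eta> k)" "\<eta>' (Suc k) = g p' k (\<eta>' k)" for k
        by (simp_all only: \<eta>_def \<eta>'_def g_def flow_Suc) simp_all
      show "norm (\<eta> k) \<le> \<rho> * \<theta> ^ k" "norm (\<eta>' k) \<le> \<rho> * \<theta> ^ k" for k
        using y y' by (auto simp: leaf_def \<eta>_def \<eta>'_def)
    qed (use \<rho> L W0 in auto)
    moreover have "\<eta> 0 - \<eta>' 0 = d" by (simp add: \<eta>_def \<eta>'_def d)
    ultimately have "norm (d - Ps (x 0) d) \<le> 4 * \<kappa>' * norm (Ps (x 0) d) + 2 * (L * W * \<rho> * S)"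
      by (simp add: approximate_dichotomy.Q_def[OF dich[OF sh]] S_def)
    also have "2 * (L * W * \<rho> * S) = 2 * (L * \<rho> * S) * W" by simp
    also have "4 * \<kappa>' * norm (Ps (x 0) d) + 2 * (L * \<rho> * S) * W \<le> \<kappa> * norm (Ps (x 0) d) + \<kappa> * W"
      by (intro add_mono mult_right_mono \<kappa>' L\<rho>S W0) auto
    finally show "norm (y - p - (y' - p') - Ps (x 0) (y - p - (y' - p')))
        \<le> \<kappa> * norm (Ps (x 0) (y - p - (y' - p'))) + \<kappa> * W" unfolding d .
  qed (fact T \<theta>(1) \<theta>(2) \<delta>(1) \<rho>(1) r(1))+
  then show ?thesis by blast
qed

end

section \<open>Asymptotic phase\<close>

lemma decay_below:
  fixes \<theta> \<rho> e :: real
  assumes "0 < \<theta>" "\<theta> < 1" "0 < e"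
  obtains N where "\<And>k. N \<le> k \<Longrightarrow> \<rho> * \<theta> ^ k < e"
proof -
  have "(\<lambda>k. \<rho> * \<theta> ^ k) \<longlonglongrightarrow> \<rho> * 0"
    using assms by (intro tendsto_intros LIMSEQ_realpow_zero) auto
  then have "\<forall>\<^sub>F k in sequentially. \<rho> * \<theta> ^ k < e"
    using assms by (intro order_tendstoD(2)) auto
  then show thesis using that by (auto simp: eventually_sequentially)
qed

context hyperbolic_flow
begin

lemma leaf_imp_asymptotic:
  assumes q: "q \<in> M" "q \<in> leaf T \<theta> \<rho> p" and T: "0 < T" and \<theta>: "0 < \<theta>" "\<theta> < 1"
  shows "((\<lambda>t. norm (\<Phi> t p - \<Phi> t q)) \<longlongrightarrow> 0) at_top"
proof -
  obtain \<delta> L where \<delta>: "0 < \<delta>" "0 \<le> L"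
    and lip: "\<And>x s a b. x \<in> M \<Longrightarrow> s \<in> {- T..T} \<Longrightarrow> {a, b} \<subseteq> ball x \<delta> \<Longrightarrow>
      norm (\<Phi> s a - \<Phi> s b) \<le> L * norm (a - b)"
    and "\<And>x s a b a' b'. x \<in> M \<Longrightarrow> s \<in> {- T..T} \<Longrightarrow> {a, b, a', b'} \<subseteq> ball x \<delta> \<Longrightarrow>
      a - b = a' - b' \<Longrightarrow>
      norm (\<Phi> s a - \<Phi> s b - (\<Phi> s a' - \<Phi> s b')) \<le> L * (norm (a - b) * norm (b - b'))"
    by (rule flow_estimates[OF compact_M inv, of T]) (rule that)
  show ?thesis
  proof (rule tendstoI)
    fix e :: real assume e: "0 < e"
    obtain N where N: "\<And>k. N \<le> k \<Longrightarrow> \<rho> * \<theta> ^ k < min \<delta> (e / (L + 1))"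
      using decay_below[OF \<theta>, of "min \<delta> (e / (L + 1))" \<rho>] \<delta> e by auto
    have "dist (norm (\<Phi> t p - \<Phi> t q)) 0 < e" if t: "real N * T \<le> t" for t
    proof -
      define k where "k = nat \<lfloor>t / T\<rfloor>"
      have "real N \<le> t / T" using t T by (simp add: pos_le_divide_eq)
      then have k: "N \<le> k" "real k \<le> t / T" "t / T < real k + 1"
        unfolding k_def by linarith+
      define s where "s = t - real k * T"
      have s: "s \<in> {- T..T}" using k T by (simp add: s_def field_simps)
      have split: "\<Phi> t y = \<Phi> s (\<Phi> (real k * T) y)" for y
        using flow_add[of s "real k * T" y] by (simp add: s_def)
      have near: "norm (\<Phi> (real k * T) p - \<Phi> (real k * T) q) < min \<delta> (e / (L + 1))"
        using q(2) N[OF k(1)] by (auto simp: leaf_def norm_minus_commute intro: le_less_trans)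
      have "norm (\<Phi> t p - \<Phi> t q) \<le> L * norm (\<Phi> (real k * T) p - \<Phi> (real k * T) q)"
        unfolding split using near \<delta>
        by (intro lip[OF flow_in_M[OF q(1)] s, of _ _ "real k * T"]) (auto simp: dist_norm norm_minus_commute)
      also have "\<dots> \<le> L * (e / (L + 1))"
        using near \<delta> by (intro mult_left_mono) auto
      also have "\<dots> < e" using \<delta> e by (simp add: field_simps)
      finally show ?thesis by simp
    qed
    then show "\<forall>\<^sub>F t in at_top. dist (norm (\<Phi> t p - \<Phi> t q)) 0 < e"
      using eventually_ge_at_top[of "real N * T"] by (rule eventually_mono[rotated])
  qed
qed

text \<open>If \<open>q\<close> were outside \<open>M\<close>, stability could be applied to the neighbourhood \<open>- {q}\<close>.\<close>

lemma stable_set_contains_backward_attracted: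
  assumes stable: "stable_set \<Phi> M" and T: "0 \<le> T" and \<theta>: "0 < \<theta>" "\<theta> < 1" and x: "x \<in> M"
    and close: "\<And>k::nat. norm (\<Phi> (- (real k * T)) q - \<Phi> (- (real k * T)) x) \<le> \<rho> * \<theta> ^ k"
  shows "q \<in> M"
proof (rule ccontr)
  assume "q \<notin> M"
  then have "M \<subseteq> - {q}" by blast
  then obtain V where V: "open V" "M \<subseteq> V" "\<And>x t. x \<in> V \<Longrightarrow> 0 \<le> t \<Longrightarrow> \<Phi> t x \<in> - {q}"
    using stable unfolding stable_set_def by (metis open_Compl closed_singleton)
  obtain e where e: "0 < e" "(\<Union>x\<in>M. ball x e) \<subseteq> V"
    using compact_subset_open_imp_ball_epsilon_subset[OF compact_M V(1,2)] .
  obtain k where "\<rho> * \<theta> ^ k < e"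
    using decay_below[OF \<theta> e(1), of \<rho>] by blast
  then have "\<Phi> (- (real k * T)) q \<in> ball (\<Phi> (- (real k * T)) x) e"
    using close[of k] by (simp add: dist_norm norm_minus_commute)
  then have "\<Phi> (- (real k * T)) q \<in> V"
    using e(2) flow_in_M[OF x] by blast
  from V(3)[OF this, of "real k * T"] show False using T by simp
qed

text \<open>Write \<open>w = A w + B w + \<sigma> w *\<^sub>R v \<xi>\<close> for the splitting at \<open>\<xi> = x 0\<close>. Let \<open>yf w\<close> be the point of the stable leaf of
  \<open>p\<close> with stable component \<open>- A w\<close>, and \<open>yb w\<close> the point of the unstable leaf of \<open>\<Phi> (\<sigma> w) \<xi>\<close> with unstable
  component \<open>B w\<close>. Up to the curvature of the leaves and of the orbit of \<open>\<xi>\<close>, the difference \<open>yf w - yb w\<close>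
  equals \<open>(p - \<xi>) - w\<close>, so \<open>yf w = yb w\<close> is a fixed point equation for \<open>w\<close> whose right-hand side is nearly
  constant.\<close>

lemma leaves_intersect:
  "\<exists>Tf \<theta>f \<delta>f \<rho>f Tb \<theta>b \<rho>b r. 0 < Tf \<and> 0 < \<theta>f \<and> \<theta>f < 1 \<and> 0 < \<delta>f \<and>
    0 < Tb \<and> 0 < \<theta>b \<and> \<theta>b < 1 \<and> 0 < r \<and>
    (\<forall>x p. shadowed Tf \<delta>f x p \<longrightarrow> dist (x 0) p < r \<longrightarrow>
      (\<exists>q s. q \<in> leaf Tf \<theta>f \<rho>f p \<and>
        (\<forall>k::nat. norm (\<Phi> (- (real k * Tb)) q - \<Phi> (- (real k * Tb)) (\<Phi> s (x 0))) \<le> \<rho>b * \<theta>b ^ k)))"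
proof -
  interpret rev: hyperbolic_flow "\<lambda>x. - v x" "\<lambda>t. \<Phi> (- t)" M Eu Es c \<alpha>
    by (rule reversed_hyperbolic_flow)
  obtain m V where mV: "0 < m" "0 \<le> V" "\<And>x. x \<in> M \<Longrightarrow> m \<le> norm (v x)" "\<And>x. x \<in> M \<Longrightarrow> norm (v x) \<le> V"
    by (rule speed_bounds) (rule that)
  obtain K where K: "1 \<le> K" "\<And>x w. x \<in> M \<Longrightarrow> norm (Ps x w) \<le> K * norm w"
    "\<And>x w l a b. x \<in> M \<Longrightarrow> a \<in> Es x \<Longrightarrow> b \<in> Eu x \<Longrightarrow> w = a + b + l *\<^sub>R v x \<Longrightarrow> norm b \<le> K * norm w \<and> norm (l *\<^sub>R v x) \<le> K * norm w"
    by (rule Ps_bound) (rule that)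
  obtain R where R: "\<And>x. x \<in> M \<Longrightarrow> norm x \<le> R"
    using compact_imp_bounded[OF compact_M] unfolding bounded_iff by auto
  obtain Kv where Kv: "0 \<le> Kv"
    "\<And>x y. x \<in> cball 0 R \<Longrightarrow> y \<in> cball 0 R \<Longrightarrow> norm (v x - v y) \<le> Kv * norm (x - y)"
    "\<And>a b a' b'. {a, b, a', b', b + (a' - b')} \<subseteq> cball 0 R \<Longrightarrow>
       norm (v a - v b - (v a' - v b'))
         \<le> Kv * norm (a - b - (a' - b')) + Kv * (norm (a' - b') * norm (b - b'))"
    by (rule C2_imp_second_difference_bound[OF C2, of R]) (rule that)
  \<comment> \<open>with \<open>\<kappa> * c0 = 1 / 4\<close> the leaves, and with \<open>s0\<close> the orbit of \<open>\<xi>\<close>, each contribute at most 1/4 to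
    the contraction constant\<close>
  define c0 where "c0 = K + K + V * (K / m)"
  have c0: "0 < c0" using K(1) mV by (simp add: c0_def add_pos_nonneg)
  define \<kappa> where "\<kappa> = 1 / (4 * c0)"
  have \<kappa>: "0 < \<kappa>" "\<kappa> * c0 = 1 / 4" using c0 by (auto simp: \<kappa>_def)
  define c1 where "c1 = Kv * V * (K / m) + 1"
  have c1: "0 < c1" using Kv(1) K(1) mV by (simp add: c1_def add_nonneg_pos)
  define s0 where "s0 = 1 / (4 * c1)"
  have s0: "0 < s0" using c1 by (simp add: s0_def)
  have s0': "Kv * V * s0 * (K / m) \<le> 1 / 4"
  proof -
    have "Kv * V * s0 * (K / m) = (c1 - 1) * s0" by (simp add: c1_def)
    also have "\<dots> \<le> c1 * s0" using s0 by (simp add: algebra_simps)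
    also have "\<dots> = 1 / 4" using c1 by (simp add: s0_def)
    finally show ?thesis .
  qed
  obtain Tf \<theta>f \<delta>f \<rho>f rf where F: "stable_leaves \<kappa> Tf \<theta>f \<delta>f \<rho>f rf"
    using strong_stable_leaves[OF \<kappa>(1)] by blast
  then have f: "0 < Tf" "0 < \<theta>f" "\<theta>f < 1" "0 < \<delta>f" "0 < \<rho>f" "0 < rf"
    by (simp_all add: stable_leaves_def)
  note f_ex = stable_leaves_exist[OF F] and f_cmp = stable_leaves_compare[OF F]
  obtain Tb \<theta>b \<delta>b \<rho>b rb where B: "rev.stable_leaves \<kappa> Tb \<theta>b \<delta>b \<rho>b rb"
    using rev.strong_stable_leaves[OF \<kappa>(1)] by blast
  then have b: "0 < Tb" "0 < \<theta>b" "\<theta>b < 1" "0 < \<delta>b" "0 < \<rho>b" "0 < rb"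
    by (simp_all add: rev.stable_leaves_def)
  note b_ex = rev.stable_leaves_exist[OF B] and b_cmp = rev.stable_leaves_compare[OF B]
  define r1 where "r1 = min (min rf rb) (min (s0 * m) (\<delta>b * m / (2 * (V + 1)))) / K"
  have r1: "0 < r1" using K(1) f b s0 mV by (simp add: r1_def)
  have Kr1: "K * r1 = min (min rf rb) (min (s0 * m) (\<delta>b * m / (2 * (V + 1))))"
    using K(1) by (simp add: r1_def)
  have Kr1_le: "K * r1 \<le> rf" "K * r1 \<le> rb" "K * r1 / m \<le> s0" "V * (K * r1 / m) < \<delta>b"
  proof -
    show "K * r1 \<le> rf" "K * r1 \<le> rb" unfolding Kr1 by auto
    show "K * r1 / m \<le> s0" unfolding Kr1 using mV(1) by (simp add: pos_divide_le_eq)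
    have "K * r1 / m \<le> \<delta>b / (2 * (V + 1))"
      unfolding Kr1 using mV(1) by (simp add: pos_divide_le_eq)
    then have "V * (K * r1 / m) \<le> V * (\<delta>b / (2 * (V + 1)))" using mV(2) by (intro mult_left_mono)
    also have "\<dots> \<le> (V + 1) * (\<delta>b / (2 * (V + 1)))" using mV(2) b by (intro mult_right_mono) auto
    also have "\<dots> = \<delta>b / 2" using mV(2) by (simp add: field_simps)
    finally show "V * (K * r1 / m) < \<delta>b" using b(4) by linarith
  qed
  have "\<exists>q s. q \<in> leaf Tf \<theta>f \<rho>f p \<and>
        (\<forall>k::nat. norm (\<Phi> (- (real k * Tb)) q - \<Phi> (- (real k * Tb)) (\<Phi> s (x 0))) \<le> \<rho>b * \<theta>b ^ k)"
    if sh: "shadowed Tf \<delta>f x p" and xp: "dist (x 0) p < r1 / 2" for x p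
  proof -
    define \<xi> where "\<xi> = x 0"
    have \<xi>: "\<xi> \<in> M" using sh by (simp add: shadowed_def \<xi>_def)
    define A where "A = Ps \<xi>"
    define B where "B = rev.Ps \<xi>"
    define \<sigma> where "\<sigma> w = ((w - A w - B w) \<bullet> v \<xi>) / (v \<xi> \<bullet> v \<xi>)" for w
    have linA: "linear A" and linB: "linear B"
      unfolding A_def B_def by (intro linear_Ps rev.linear_Ps \<xi>)+
    have dec: "w = A w + B w + \<sigma> w *\<^sub>R v \<xi> \<and> norm (A w) \<le> K * norm w \<and> norm (B w) \<le> K * norm w
        \<and> \<bar>\<sigma> w\<bar> \<le> K / m * norm w" for w
    proof -
      obtain u l where ul: "Ps \<xi> w \<in> Es \<xi>" "u \<in> Eu \<xi>" "w = Ps \<xi> w + u + l *\<^sub>R v \<xi>"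
        by (rule decompose[OF \<xi>])
      have "rev.Ps \<xi> (u + Ps \<xi> w + (- l) *\<^sub>R - v \<xi>) = u"
        by (rule rev.Ps_eq[OF \<xi> ul(2,1)])
      moreover have "u + Ps \<xi> w + (- l) *\<^sub>R - v \<xi> = w"
        by (subst (2) ul(3)) (simp add: add.commute)
      ultimately have Bw: "B w = u" by (simp add: B_def)
      have "w - A w - B w = l *\<^sub>R v \<xi>" using ul(3) unfolding Bw A_def by (metis add_diff_cancel_left' add.commute diff_diff_eq)
      then have \<sigma>w: "\<sigma> w = l" using v_nonzero[OF \<xi>] by (simp add: \<sigma>_def)
      have bounds: "norm u \<le> K * norm w" "norm (l *\<^sub>R v \<xi>) \<le> K * norm w"
        using K(3)[OF \<xi> ul] by auto
      have "\<bar>l\<bar> * m \<le> \<bar>l\<bar> * norm (v \<xi>)" by (intro mult_left_mono mV(3) \<xi>) auto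
      then have "\<bar>l\<bar> * m \<le> K * norm w" using bounds(2) by simp
      then have "\<bar>l\<bar> \<le> K / m * norm w" using mV(1) by (simp add: field_simps)
      then show ?thesis
        using ul(3) bounds(1) K(2)[OF \<xi>] unfolding \<sigma>w Bw A_def by blast
    qed
    have \<sigma>_diff: "\<sigma> w - \<sigma> w' = \<sigma> (w - w')" for w w'
      by (simp add: \<sigma>_def linear_diff[OF linA] linear_diff[OF linB] inner_diff_left diff_divide_distrib)
    have speed: "norm (\<Phi> s y - \<Phi> s' y) \<le> V * \<bar>s - s'\<bar>" if "y \<in> M" for y s s'
      by (rule curve_lipschitz[of "min s s'" "max s s'" _ "\<lambda>s. v (\<Phi> s y)"])
         (auto intro: flow_has_vector_derivative mV flow_in_M that)
    define h where "h s = \<Phi> s \<xi> - \<xi> - s *\<^sub>R v \<xi>" for s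
    have h_lip: "norm (h s - h s') \<le> Kv * V * s0 * \<bar>s - s'\<bar>" if "\<bar>s\<bar> \<le> s0" "\<bar>s'\<bar> \<le> s0" for s s'
    proof (rule curve_lipschitz[of "- s0" s0 _ "\<lambda>s. v (\<Phi> s \<xi>) - v \<xi>"])
      show "(h has_vector_derivative v (\<Phi> s \<xi>) - v \<xi>) (at s)" for s
        unfolding h_def
        by (auto intro!: derivative_eq_intros flow_has_vector_derivative)
      show "norm (v (\<Phi> s \<xi>) - v \<xi>) \<le> Kv * V * s0" if "s \<in> {- s0..s0}" for s
      proof -
        have "norm (v (\<Phi> s \<xi>) - v \<xi>) \<le> Kv * norm (\<Phi> s \<xi> - \<xi>)"
          using R[OF flow_in_M[OF \<xi>]] R[OF \<xi>] by (intro Kv(2)) auto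
        also have "\<dots> \<le> Kv * (V * \<bar>s\<bar>)"
          using speed[OF \<xi>, of s 0] Kv(1) by (intro mult_left_mono) auto
        also have "\<dots> \<le> Kv * (V * s0)"
          using that Kv(1) mV(2) by (intro mult_left_mono) auto
        finally show ?thesis by (simp add: mult.assoc)
      qed
    qed (use that in auto)
    define xb where "xb k = \<Phi> (- (real k * Tb)) \<xi>" for k :: nat
    have small_\<sigma>: "\<bar>\<sigma> w\<bar> \<le> s0" "V * \<bar>\<sigma> w\<bar> < \<delta>b" if "norm w \<le> r1" for w
    proof -
      have "\<bar>\<sigma> w\<bar> \<le> K / m * norm w" using dec by blast
      also have "\<dots> \<le> K / m * r1" using that K(1) mV(1) by (intro mult_left_mono) auto
      finally have s: "\<bar>\<sigma> w\<bar> \<le> K * r1 / m" by simp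
      then show "\<bar>\<sigma> w\<bar> \<le> s0" using Kr1_le(3) by linarith
      have "V * \<bar>\<sigma> w\<bar> \<le> V * (K * r1 / m)" by (intro mult_left_mono s mV)
      then show "V * \<bar>\<sigma> w\<bar> < \<delta>b" using Kr1_le(4) by linarith
    qed
    have comm: "\<Phi> t (\<Phi> s y) = \<Phi> s (\<Phi> t y)" for s t y by (metis add.commute flow_add)
    have sh_b: "rev.shadowed Tb \<delta>b xb (\<Phi> (\<sigma> w) \<xi>)" if "norm w \<le> r1" for w
      unfolding rev.shadowed_def xb_def
    proof (intro allI conjI flow_in_M \<xi>)
      fix k :: nat
      have "dist (\<Phi> (- (real k * Tb)) \<xi>) (\<Phi> (\<sigma> w) (\<Phi> (- (real k * Tb)) \<xi>)) \<le> V * \<bar>\<sigma> w\<bar>"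
        using speed[OF flow_in_M[OF \<xi>], of 0 "- (real k * Tb)" "\<sigma> w"] by (simp add: dist_norm)
      then show "dist (\<Phi> (- (real k * Tb)) \<xi>) (\<Phi> (- (real k * Tb)) (\<Phi> (\<sigma> w) \<xi>)) < \<delta>b"
        using small_\<sigma>(2)[OF that] unfolding comm[of _ "\<sigma> w"] by linarith
    qed
    have xb0: "xb 0 = \<xi>" by (simp add: xb_def)
    have "\<forall>w\<in>cball 0 r1. \<exists>y. y \<in> leaf Tf \<theta>f \<rho>f p \<and> A (y - p) = - A w"
    proof
      fix w assume w: "w \<in> cball (0::'a) r1"
      have "norm (- A w) \<le> K * norm w" using dec by simp
      also have "\<dots> \<le> K * r1" using w K(1) by (intro mult_left_mono) auto
      finally have "norm (- A w) \<le> rf" using Kr1_le(1) by simp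
      from f_ex[OF sh this] show "\<exists>y. y \<in> leaf Tf \<theta>f \<rho>f p \<and> A (y - p) = - A w"
        unfolding A_def \<xi>_def[symmetric] linear_neg[OF linear_Ps[OF \<xi>]] Ps_idem[OF \<xi>] by blast
    qed
    then obtain yf where yf: "\<And>w. w \<in> cball 0 r1 \<Longrightarrow> yf w \<in> leaf Tf \<theta>f \<rho>f p"
      "\<And>w. w \<in> cball 0 r1 \<Longrightarrow> A (yf w - p) = - A w" by metis
    have "\<forall>w\<in>cball 0 r1. \<exists>y. y \<in> rev.leaf Tb \<theta>b \<rho>b (\<Phi> (\<sigma> w) \<xi>) \<and> B (y - \<Phi> (\<sigma> w) \<xi>) = B w"
    proof
      fix w assume w: "w \<in> cball (0::'a) r1"
      have "norm (B w) \<le> K * norm w" using dec by simp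
      also have "\<dots> \<le> K * r1" using w K(1) by (intro mult_left_mono) auto
      finally have "norm (B w) \<le> rb" using Kr1_le(2) by simp
      from b_ex[OF sh_b this] w show "\<exists>y. y \<in> rev.leaf Tb \<theta>b \<rho>b (\<Phi> (\<sigma> w) \<xi>) \<and> B (y - \<Phi> (\<sigma> w) \<xi>) = B w"
        unfolding xb0 B_def rev.Ps_idem[OF \<xi>] by auto
    qed
    then obtain yb where yb: "\<And>w. w \<in> cball 0 r1 \<Longrightarrow> yb w \<in> rev.leaf Tb \<theta>b \<rho>b (\<Phi> (\<sigma> w) \<xi>)"
      "\<And>w. w \<in> cball 0 r1 \<Longrightarrow> B (yb w - \<Phi> (\<sigma> w) \<xi>) = B w" by metis
    \<comment> \<open>\<open>G w = w\<close> is \<open>yf w = yb w\<close> with the linear terms collected on the right\<close>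
    define G where "G w = (p - \<xi>) + ((yf w - p) + A w) - ((yb w - \<Phi> (\<sigma> w) \<xi>) - B w) - h (\<sigma> w)" for w
    have contr: "norm (G w - G w') \<le> 1 / 2 * norm (w - w')"
      if w: "w \<in> cball 0 r1" and w': "w' \<in> cball 0 r1" for w w'
    proof -
      define n where "n = norm (w - w')"
      define d1 where "d1 = (yf w - p) - (yf w' - p)"
      define d2 where "d2 = (yb w - \<Phi> (\<sigma> w) \<xi>) - (yb w' - \<Phi> (\<sigma> w') \<xi>)"
      have "A d1 = A (yf w - p) - A (yf w' - p)" unfolding d1_def by (rule linear_diff[OF linA])
      also have "\<dots> = - A (w - w')" by (simp add: yf(2)[OF w] yf(2)[OF w'] linear_diff[OF linA, of w])
      finally have A1: "A d1 = - A (w - w')" .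
      have "B d2 = B (yb w - \<Phi> (\<sigma> w) \<xi>) - B (yb w' - \<Phi> (\<sigma> w') \<xi>)"
        unfolding d2_def by (rule linear_diff[OF linB])
      also have "\<dots> = B (w - w')" by (simp add: yb(2)[OF w] yb(2)[OF w'] linear_diff[OF linB, of w])
      finally have B2: "B d2 = B (w - w')" .
      have Aw: "norm (A (w - w')) \<le> K * n" and Bw: "norm (B (w - w')) \<le> K * n"
        and \<sigma>w: "\<bar>\<sigma> w - \<sigma> w'\<bar> \<le> K / m * n"
        using dec[of "w - w'"] by (auto simp: n_def \<sigma>_diff)
      have "norm (d1 - A d1) \<le> \<kappa> * norm (A d1) + \<kappa> * 0"
        unfolding A_def \<xi>_def by (rule f_cmp[OF sh sh yf(1)[OF w] yf(1)[OF w'] _ d1_def]) simp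
      also have "\<dots> \<le> \<kappa> * (K * n)" using Aw \<kappa>(1) unfolding A1 by simp
      finally have 1: "norm (d1 - A d1) \<le> \<kappa> * (K * n)" .
      have "norm (d2 - B d2) \<le> \<kappa> * norm (B d2) + \<kappa> * (V * \<bar>\<sigma> w - \<sigma> w'\<bar>)"
      proof -
        have "norm (\<Phi> (- (real k * Tb)) (\<Phi> (\<sigma> w) \<xi>) - \<Phi> (- (real k * Tb)) (\<Phi> (\<sigma> w') \<xi>)) \<le> V * \<bar>\<sigma> w - \<sigma> w'\<bar>" for k :: nat
          unfolding comm[of "- (real k * Tb)"] by (rule speed[OF flow_in_M[OF \<xi>]])
        from b_cmp[OF sh_b sh_b yb(1)[OF w] yb(1)[OF w'] this d2_def] show ?thesis
          using w w' by (simp add: xb0 B_def)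
      qed
      also have "\<dots> \<le> \<kappa> * (K * n) + \<kappa> * (V * (K / m * n))"
        unfolding B2 using \<kappa>(1) mV(2) by (intro add_mono mult_left_mono Bw \<sigma>w) auto
      finally have 2: "norm (d2 - B d2) \<le> \<kappa> * (K * n) + \<kappa> * (V * (K / m * n))" .
      have "norm (h (\<sigma> w) - h (\<sigma> w')) \<le> Kv * V * s0 * \<bar>\<sigma> w - \<sigma> w'\<bar>"
        using w w' by (intro h_lip small_\<sigma>) auto
      also have "\<dots> \<le> Kv * V * s0 * (K / m * n)"
        using Kv(1) mV(2) s0 by (intro mult_left_mono \<sigma>w) auto
      also have "\<dots> = Kv * V * s0 * (K / m) * n" by simp
      also have "\<dots> \<le> 1 / 4 * n" by (intro mult_right_mono s0') (simp add: n_def)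
      finally have 3: "norm (h (\<sigma> w) - h (\<sigma> w')) \<le> 1 / 4 * n" .
      have "G w - G w' = (d1 - A d1) - (d2 - B d2) - (h (\<sigma> w) - h (\<sigma> w'))"
        unfolding A1 B2 by (simp add: G_def d1_def d2_def linear_diff[OF linA] linear_diff[OF linB])
      then have "norm (G w - G w') \<le> norm (d1 - A d1) + norm (d2 - B d2) + norm (h (\<sigma> w) - h (\<sigma> w'))"
        by (smt (verit) norm_triangle_ineq4)
      also have "\<dots> \<le> \<kappa> * (K * n) + (\<kappa> * (K * n) + \<kappa> * (V * (K / m * n))) + 1 / 4 * n"
        by (intro add_mono 1 2 3)
      also have "\<dots> = \<kappa> * c0 * n + 1 / 4 * n" by (simp add: c0_def algebra_simps)
      also have "\<dots> = 1 / 2 * n" by (simp add: \<kappa>(2))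
      finally show ?thesis by (simp add: n_def)
    qed
    have zero: "0 \<in> cball (0::'a) r1" using r1 by simp
    have G0: "G 0 = p - \<xi>"
    proof -
      have A0: "A 0 = 0" "B 0 = 0" "\<sigma> 0 = 0"
        using linear_0[OF linA] linear_0[OF linB] by (auto simp: \<sigma>_def)
      \<comment> \<open>the points over 0 are the base points, because the leaves contain them and are graphs\<close>
      have p_leaf: "p \<in> leaf Tf \<theta>f \<rho>f p" using f by (simp add: leaf_def)
      have "norm ((yf 0 - p) - A (yf 0 - p)) \<le> \<kappa> * norm (A (yf 0 - p)) + \<kappa> * 0"
        unfolding A_def \<xi>_def by (rule f_cmp[OF sh sh yf(1)[OF zero] p_leaf]) simp_all
      then have "yf 0 = p" using yf(2)[OF zero] A0 by simp
      moreover have "yb 0 = \<xi>"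
      proof -
        have sh0: "rev.shadowed Tb \<delta>b xb \<xi>" using sh_b[of 0] r1 A0 by simp
        have yb0: "yb 0 \<in> rev.leaf Tb \<theta>b \<rho>b \<xi>" using yb(1)[OF zero] A0 by simp
        have \<xi>_leaf: "\<xi> \<in> rev.leaf Tb \<theta>b \<rho>b \<xi>" using b by (simp add: rev.leaf_def)
        have "norm ((yb 0 - \<xi>) - B (yb 0 - \<xi>)) \<le> \<kappa> * norm (B (yb 0 - \<xi>)) + \<kappa> * 0"
          unfolding B_def xb0[symmetric] by (rule b_cmp[OF sh0[folded xb0] sh0[folded xb0] yb0[folded xb0] \<xi>_leaf[folded xb0]]) simp_all
        then show ?thesis using yb(2)[OF zero] A0 by simp
      qed
      ultimately show ?thesis using A0 by (simp add: G_def h_def)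
    qed
    have "\<exists>!w\<in>cball 0 r1. G w = w"
    proof (rule Banach_fix[of _ "1 / 2"])
      show "complete (cball (0::'a) r1)" by (simp add: complete_eq_closed)
      show "G ` cball 0 r1 \<subseteq> cball 0 r1"
      proof clarify
        fix w assume w: "w \<in> cball (0::'a) r1"
        have "norm (G 0) < r1 / 2" unfolding G0 using xp by (simp add: \<xi>_def dist_norm norm_minus_commute)
        moreover have "norm (G w - G 0) \<le> r1 / 2" using contr[OF w zero] w by simp
        ultimately have "norm (G w) \<le> r1" using norm_triangle_sub[of "G w" "G 0"] by linarith
        then show "G w \<in> cball 0 r1" by simp
      qed
      show "dist (G w) (G w') \<le> 1 / 2 * dist w w'" if "w \<in> cball 0 r1" "w' \<in> cball 0 r1" for w w'
        using contr[OF that] by (simp add: dist_norm)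
    qed (use zero in auto)
    then obtain w where w: "w \<in> cball 0 r1" "G w = w" by blast
    have "G w = (yf w - yb w) + (A w + B w + \<sigma> w *\<^sub>R v \<xi>)"
      by (simp add: G_def h_def)
    also have "A w + B w + \<sigma> w *\<^sub>R v \<xi> = w" using dec[of w] by (metis)
    finally have "(yf w - yb w) + w = 0 + w" using w(2) by simp
    then have eq: "yf w = yb w" unfolding add_right_cancel by simp
    have "yf w \<in> leaf Tf \<theta>f \<rho>f p" using yf(1) w by blast
    moreover have "\<forall>k::nat. norm (\<Phi> (- (real k * Tb)) (yf w) - \<Phi> (- (real k * Tb)) (\<Phi> (\<sigma> w) \<xi>)) \<le> \<rho>b * \<theta>b ^ k"
      using yb(1)[OF w(1)] unfolding eq rev.leaf_def by simp
    ultimately show "\<exists>q s. q \<in> leaf Tf \<theta>f \<rho>f p \<and>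
        (\<forall>k::nat. norm (\<Phi> (- (real k * Tb)) q - \<Phi> (- (real k * Tb)) (\<Phi> s (x 0))) \<le> \<rho>b * \<theta>b ^ k)"
      unfolding \<xi>_def by blast
  qed
  moreover have "0 < r1 / 2" using r1 by simp
  ultimately show ?thesis using f(1-4) b(1-3) by blast
qed

theorem asymptotic_phase_of_stable:
  assumes stable: "stable_set \<Phi> M"
  shows "\<exists>U. open U \<and> M \<subseteq> U \<and> (\<forall>p\<in>U. has_asymptotic_phase \<Phi> M p)"
proof -
  obtain Tf \<theta>f \<delta>f \<rho>f Tb \<theta>b \<rho>b r where all: "0 < Tf \<and> 0 < \<theta>f \<and> \<theta>f < 1 \<and> 0 < \<delta>f \<and>
    0 < Tb \<and> 0 < \<theta>b \<and> \<theta>b < 1 \<and> 0 < r \<and>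
    (\<forall>x p. shadowed Tf \<delta>f x p \<longrightarrow> dist (x 0) p < r \<longrightarrow>
      (\<exists>q s. q \<in> leaf Tf \<theta>f \<rho>f p \<and>
        (\<forall>k::nat. norm (\<Phi> (- (real k * Tb)) q - \<Phi> (- (real k * Tb)) (\<Phi> s (x 0))) \<le> \<rho>b * \<theta>b ^ k)))"
    using leaves_intersect by (elim exE) (rule that)
  then have c: "0 < Tf" "0 < \<theta>f" "\<theta>f < 1" "0 < \<delta>f" "0 < Tb" "0 < \<theta>b" "\<theta>b < 1" "0 < r" by auto
  have nbhd: "open (\<Union>\<xi>\<in>M. ball \<xi> \<delta>f) \<and> M \<subseteq> (\<Union>\<xi>\<in>M. ball \<xi> \<delta>f)" using c(4) by auto
  obtain V where V: "open V" "M \<subseteq> V" "\<And>x t. x \<in> V \<Longrightarrow> 0 \<le> t \<Longrightarrow> \<Phi> t x \<in> (\<Union>\<xi>\<in>M. ball \<xi> \<delta>f)"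
    using stable[unfolded stable_set_def, rule_format, OF nbhd] by blast
  define U where "U = V \<inter> (\<Union>\<xi>\<in>M. ball \<xi> (min r \<delta>f))"
  have "open U" "M \<subseteq> U" using V c by (auto simp: U_def)
  moreover have "has_asymptotic_phase \<Phi> M p" if p: "p \<in> U" for p
  proof -
    obtain \<xi> where \<xi>: "\<xi> \<in> M" "dist \<xi> p < r" "dist \<xi> p < \<delta>f" using p by (auto simp: U_def)
    have "\<exists>y\<in>M. dist y (\<Phi> (real k * Tf) p) < \<delta>f" for k :: nat
      using V(3)[of p "real k * Tf"] p c(1) by (auto simp: U_def)
    then obtain y where y: "\<And>k::nat. y k \<in> M \<and> dist (y k) (\<Phi> (real k * Tf) p) < \<delta>f" by metis
    define x where "x = y(0 := \<xi>)"
    have "shadowed Tf \<delta>f x p" using y \<xi> by (simp add: shadowed_def x_def)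
    then obtain q s where q: "q \<in> leaf Tf \<theta>f \<rho>f p"
      "\<And>k::nat. norm (\<Phi> (- (real k * Tb)) q - \<Phi> (- (real k * Tb)) (\<Phi> s \<xi>)) \<le> \<rho>b * \<theta>b ^ k"
      using all \<xi>(2) by (fastforce simp: x_def)
    have "q \<in> M"
      by (rule stable_set_contains_backward_attracted[OF stable _ c(6,7) flow_in_M[OF \<xi>(1)] q(2)])
         (use c(5) in simp)
    then show ?thesis
      unfolding has_asymptotic_phase_def using leaf_imp_asymptotic[OF _ q(1) c(1-3)] by blast
  qed
  ultimately show ?thesis by blast
qed

end

theorem theorem1:
  fixes v :: "'a::euclidean_space \<Rightarrow> 'a"
    and \<Phi> :: "real \<Rightarrow> 'a \<Rightarrow> 'a"
    and D M :: "'a set"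
    and m :: nat
  assumes "C2_on UNIV v"
    and "flow_of v \<Phi>"
    and "open D" and "connected D" and "D \<noteq> {}"
    and "M \<subseteq> D"
    and "compact M"
    and "C1_submanifold m M" and "m < DIM('a)"
    and "invariant_set \<Phi> M"
    and "attracting_on \<Phi> D M"
    and "stable_set \<Phi> M"
    and "hyperbolic_along v \<Phi> M"
  shows "\<exists>U. open U \<and> M \<subseteq> U \<and> (\<forall>p\<in>U. has_asymptotic_phase \<Phi> M p)"
proof -
  obtain Es Eu Ec ns nu c \<alpha> where
    Ec: "\<forall>x\<in>M. Ec x = {l *\<^sub>R v x | l. True} \<and> dim (Ec x) = 1" and
    sum: "\<forall>x\<in>M. direct_sum3 (Es x) (Eu x) (Ec x)" and
    fields: "continuous_plane_field ns M Es" "continuous_plane_field nu M Eu" and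
    invariant: "\<forall>t. \<forall>x\<in>M. flow_derivative \<Phi> t x ` Es x = Es (\<Phi> t x)"
      "\<forall>t. \<forall>x\<in>M. flow_derivative \<Phi> t x ` Eu x = Eu (\<Phi> t x)" and
    const: "c \<ge> 1" "\<alpha> > 0" and
    rates: "\<forall>t\<ge>0. \<forall>x\<in>M. \<forall>\<eta>\<in>Es x. norm (flow_derivative \<Phi> t x \<eta>) \<le> c * exp (- \<alpha> * t) * norm \<eta>"
      "\<forall>t\<le>0. \<forall>x\<in>M. \<forall>\<eta>\<in>Eu x. norm (flow_derivative \<Phi> t x \<eta>) \<le> c * exp (\<alpha> * t) * norm \<eta>"
    using assms(13) unfolding hyperbolic_along_def by (elim exE conjE) (rule that)
  have range: "Ec x = range (\<lambda>l. l *\<^sub>R v x)" if "x \<in> M" for x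
    using Ec that by auto
  interpret hyperbolic_flow v \<Phi> M Es Eu c \<alpha>
  proof
    show "C2_on UNIV v" "flow_of v \<Phi>" "compact M" "invariant_set \<Phi> M" "1 \<le> c" "0 < \<alpha>"
      by (fact assms const)+
    fix x assume x: "x \<in> M"
    show "v x \<noteq> 0"
    proof
      assume "v x = 0"
      then have "Ec x = {0}" using range[OF x] by auto
      moreover have "dim (Ec x) = 1" using Ec x by blast
      ultimately show False by simp
    qed
    show "direct_sum3 (Es x) (Eu x) (range (\<lambda>l. l *\<^sub>R v x))"
      unfolding range[OF x, symmetric] using sum x by blast
    show "subspace (Es x)" "subspace (Eu x)"
      using fields x by (auto simp: continuous_plane_field_def)
    show "flow_derivative \<Phi> t x \<eta> \<in> Es (\<Phi> t x)" if "\<eta> \<in> Es x" for \<eta> t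
      using invariant(1) x that by blast
    show "flow_derivative \<Phi> t x \<eta> \<in> Eu (\<Phi> t x)" if "\<eta> \<in> Eu x" for \<eta> t
      using invariant(2) x that by blast
    show "norm (flow_derivative \<Phi> t x \<eta>) \<le> c * exp (- \<alpha> * t) * norm \<eta>"
      if "\<eta> \<in> Es x" "0 \<le> t" for \<eta> t
      using rates(1) x that by blast
    show "norm (flow_derivative \<Phi> t x \<eta>) \<le> c * exp (\<alpha> * t) * norm \<eta>"
      if "\<eta> \<in> Eu x" "t \<le> 0" for \<eta> t
      using rates(2) x that by blast
  qed
  show ?thesis by (rule asymptotic_phase_of_stable[OF assms(12)])
qed

end
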